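(* Let $H$ be an algorithmically stackable group, let $A,B\le H$ be finitely generated subgroups, and let $\psi:A\to B$ be an isomorphism. Suppose further that the subgroup membership problem is decidable for the subgroups $A$ and $B$ in $H$. Then the HNN extension $G=H\ast_\psi=\langle H,s\mid sas^{-1}=\psi(a)\ (a\in A)\rangle$ is also algorithmically stackable.
   Context: Let $G$ be a group with a finite inverse-closed generating set $X$, no element of which represents the identity. Let $\Gamma=\Gamma(G,X)$ be the Cayley graph, $\vec E$ its set of directed edges and $\vec P$ its set of directed edge paths. For $g\in G$, $a\in X$, $e_{g,a}$ is the directed edge from $g$ to $ga$ labeled $a$; $e_{g,a}$ and $e_{ga,a^{-1}}$ have the same underlying undirected edge. A flow function associated to a maximal tree $\mathcal T$ in $\Gamma$ is a function $\Phi:\vec E\to\vec P$ such that: (F1) $\Phi(e)$ has the same initial and terminal vertices as $e$; (F2d) if the undirected edge underlying $e$ lies in $\mathcal T$, then $\Phi(e)=e$; (F2r) the transitive closure of the relation $<$ on $\vec E$, where $e'<e$ whenever $e'$ lies on $\Phi(e)$ and the undirected edges underlying both $e$ and $e'$ do not lie in $\mathcal T$, is a well-founded strict partial ordering. It is bounded if there is a constant $k$ such that every path $\Phi(e)$ has length at most $k$. For $g\in G$, $\mathsf{nf}(g)\in X^*$ is the label of the unique path without backtracking in $\mathcal T$ from the identity to $g$, and $\mathcal N_{\mathcal T}=\{\mathsf{nf}(g)\mid g\in G\}$. The stacking map $\phi:\mathcal N_{\mathcal T}\times X\to X^*$ sends $(\mathsf{nf}(g),a)$ to the label of $\Phi(e_{g,a})$,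 and $\mathsf{graph}(\phi)=\{(\mathsf{nf}(g),a,\phi(\mathsf{nf}(g),a))\mid g\in G,a\in X\}\subseteq (X^* )^3$. $G$ is algorithmically stackable over $X$ if there is a bounded flow function on a maximal tree of $\Gamma(G,X)$ for which $\mathsf{graph}(\phi)$ is decidable (recursive); $G$ is algorithmically stackable if this holds for some finite inverse-closed generating set. For a group $H$ with finite inverse-closed generating set $Y$ and a subgroup $A$, the subgroup membership problem for $A$ in $H$ is decidable if there is an algorithm that, upon input of any word $w$ over $Y$, determines whether or not $w$ represents an element of $A$. *)

theory Defs
  imports "HOL-Algebra.Generated_Groups" "HOL-Library.Nat_Bijection" "Graph_Theory.Graph_Theory"
begin

section \<open>Recursive functions and decidable relations on words\<close>

text \<open>Total recursive functions of a given arity. Only the values on argument lists whose length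
  is the arity are significant. Unbounded minimization is applied to regular functions only
  (those for which the search always succeeds); this yields exactly the total functions among
  the partial recursive ones.\<close>

inductive recursive_fn :: "nat \<Rightarrow> (nat list \<Rightarrow> nat) \<Rightarrow> bool" where
  zero: "recursive_fn n (\<lambda>_. 0)"
| succ: "recursive_fn 1 (\<lambda>xs. Suc (xs ! 0))"
| proj: "i < n \<Longrightarrow> recursive_fn n (\<lambda>xs. xs ! i)"
| comp: "\<lbrakk>recursive_fn m f; length gs = m; \<forall>g\<in>set gs. recursive_fn n g\<rbrakk>
    \<Longrightarrow> recursive_fn n (\<lambda>xs. f (map (\<lambda>g. g xs) gs))"
| prim_rec: "\<lbrakk>recursive_fn n f; recursive_fn (Suc (Suc n)) g\<rbrakk>
    \<Longrightarrow> recursive_fn (Suc n)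
         (\<lambda>xs. rec_nat (f (tl xs)) (\<lambda>y r. g (y # r # tl xs)) (hd xs))"
| minimize: "\<lbrakk>recursive_fn (Suc n) f; \<And>xs. length xs = n \<Longrightarrow> \<exists>y. f (y # xs) = 0\<rbrakk>
    \<Longrightarrow> recursive_fn n (\<lambda>xs. LEAST y. f (y # xs) = 0)"

text \<open>A k-ary relation on words over a finite alphabet is given as a set of lists (of length k)
  of words. Letters are numbered by an arbitrary bijection; since the alphabet is finite,
  decidability does not depend on the numbering.\<close>

definition word_code :: "('x \<Rightarrow> nat) \<Rightarrow> 'x list \<Rightarrow> nat" where
  "word_code c w = list_encode (map c w)"

definition decidable_rel :: "nat \<Rightarrow> 'x set \<Rightarrow> 'x list list set \<Rightarrow> bool" where
  "decidable_rel k X R \<longleftrightarrow>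
     (\<exists>c f. bij_betw c X {..<card X} \<and> recursive_fn k f \<and>
        (\<forall>ws. length ws = k \<and> set ws \<subseteq> lists X \<longrightarrow>
           f (map (word_code c) ws) = (if ws \<in> R then 1 else 0)))"

section \<open>Finite generating sets and the subgroup membership problem\<close>

definition fin_inv_closed_gen_set :: "('g, 'm) monoid_scheme \<Rightarrow> 'g set \<Rightarrow> bool" where
  "fin_inv_closed_gen_set G X \<longleftrightarrow>
     finite X \<and> X \<subseteq> carrier G \<and> (\<forall>x\<in>X. inv\<^bsub>G\<^esub> x \<in> X) \<and> generate G X = carrier G"

definition fin_gen_subgroup :: "'g set \<Rightarrow> ('g, 'm) monoid_scheme \<Rightarrow> bool" where
  "fin_gen_subgroup A G \<longleftrightarrow> subgroup A G \<and> (\<exists>S. finite S \<and> S \<subseteq> carrier G \<and> generate G S = A)"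

definition word_value :: "('g, 'm) monoid_scheme \<Rightarrow> 'g list \<Rightarrow> 'g" where
  "word_value G w = foldr (\<lambda>x y. x \<otimes>\<^bsub>G\<^esub> y) w \<one>\<^bsub>G\<^esub>"

definition membership_decidable :: "('g, 'm) monoid_scheme \<Rightarrow> 'g set \<Rightarrow> 'g set \<Rightarrow> bool" where
  "membership_decidable G Y A \<longleftrightarrow> decidable_rel 1 Y {[w] | w. w \<in> lists Y \<and> word_value G w \<in> A}"

section \<open>Cayley graphs and maximal trees\<close>

text \<open>The pair (g, a) is the directed edge from g to ga labelled a. An undirected edge is a pair
  of mutually inverse directed edges, so undirected subgraphs are the subgraphs closed under
  \<open>cayley_rev\<close>.\<close>

definition cayley_graph :: "('g, 'm) monoid_scheme \<Rightarrow> 'g set \<Rightarrow> ('g, 'g \<times> 'g) pre_digraph" where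
  "cayley_graph G X =
     \<lparr>verts = carrier G, arcs = carrier G \<times> X, tail = fst, head = (\<lambda>(g, a). g \<otimes>\<^bsub>G\<^esub> a)\<rparr>"

definition cayley_rev :: "('g, 'm) monoid_scheme \<Rightarrow> 'g \<times> 'g \<Rightarrow> 'g \<times> 'g" where
  "cayley_rev G = (\<lambda>(g, a). (g \<otimes>\<^bsub>G\<^esub> a, inv\<^bsub>G\<^esub> a))"

definition path_label :: "('g \<times> 'g) list \<Rightarrow> 'g list" where
  "path_label p = map snd p"

definition no_backtracking :: "('e \<Rightarrow> 'e) \<Rightarrow> 'e list \<Rightarrow> bool" where
  "no_backtracking rv p \<longleftrightarrow> (\<forall>i. Suc i < length p \<longrightarrow> p ! Suc i \<noteq> rv (p ! i))"

text \<open>Here \<open>Digraph_Component.tree\<close> does not apply: it counts an edge followed by its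
  inverse as a cycle.\<close>

definition undirected_tree :: "('e \<Rightarrow> 'e) \<Rightarrow> ('v, 'e) pre_digraph \<Rightarrow> bool" where
  "undirected_tree rv T \<longleftrightarrow>
     (\<forall>e\<in>arcs T. rv e \<in> arcs T) \<and> connected T \<and>
     \<not> (\<exists>u p. pre_digraph.awalk T u p u \<and> p \<noteq> [] \<and> no_backtracking rv p)"

definition maximal_tree ::
    "('g, 'm) monoid_scheme \<Rightarrow> 'g set \<Rightarrow> ('g, 'g \<times> 'g) pre_digraph \<Rightarrow> bool" where
  "maximal_tree G X T \<longleftrightarrow>
     pre_digraph.max_subgraph (cayley_graph G X) (undirected_tree (cayley_rev G)) T"

section \<open>Flow functions and stackability\<close>

definition flow_less ::
    "('v, 'e) pre_digraph \<Rightarrow> ('v, 'e) pre_digraph \<Rightarrow> ('e \<Rightarrow> 'e list) \<Rightarrow> ('e \<times> 'e) set" where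
  "flow_less \<Gamma> T \<Phi> =
     {(e', e). e \<in> arcs \<Gamma> \<and> e' \<in> arcs \<Gamma> \<and> e' \<in> set (\<Phi> e) \<and> e \<notin> arcs T \<and> e' \<notin> arcs T}"

definition flow_function ::
    "('v, 'e) pre_digraph \<Rightarrow> ('v, 'e) pre_digraph \<Rightarrow> ('e \<Rightarrow> 'e list) \<Rightarrow> bool" where
  "flow_function \<Gamma> T \<Phi> \<longleftrightarrow>
     (\<forall>e\<in>arcs \<Gamma>. pre_digraph.awalk \<Gamma> (tail \<Gamma> e) (\<Phi> e) (head \<Gamma> e)) \<and>
     (\<forall>e\<in>arcs T. \<Phi> e = [e]) \<and>
     trans ((flow_less \<Gamma> T \<Phi>)\<^sup>+) \<and> irrefl ((flow_less \<Gamma> T \<Phi>)\<^sup>+) \<and> wf ((flow_less \<Gamma> T \<Phi>)\<^sup>+)"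

definition bounded_flow :: "('v, 'e) pre_digraph \<Rightarrow> ('e \<Rightarrow> 'e list) \<Rightarrow> bool" where
  "bounded_flow \<Gamma> \<Phi> \<longleftrightarrow> (\<exists>k. \<forall>e\<in>arcs \<Gamma>. length (\<Phi> e) \<le> k)"

definition tree_nf ::
    "('g, 'm) monoid_scheme \<Rightarrow> ('g, 'g \<times> 'g) pre_digraph \<Rightarrow> 'g \<Rightarrow> 'g list" where
  "tree_nf G T g =
     path_label (THE p. pre_digraph.awalk T \<one>\<^bsub>G\<^esub> p g \<and> no_backtracking (cayley_rev G) p)"

text \<open>The graph of the stacking map; each triple is the list of its three components, the middle
  one being a one-letter word.\<close>

definition stacking_graph ::
    "('g, 'm) monoid_scheme \<Rightarrow> 'g set \<Rightarrow> ('g, 'g \<times> 'g) pre_digraph \<Rightarrow>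
     ('g \<times> 'g \<Rightarrow> ('g \<times> 'g) list) \<Rightarrow> 'g list list set" where
  "stacking_graph G X T \<Phi> =
     {[tree_nf G T g, [a], path_label (\<Phi> (g, a))] | g a. g \<in> carrier G \<and> a \<in> X}"

definition algorithmically_stackable_over :: "('g, 'm) monoid_scheme \<Rightarrow> 'g set \<Rightarrow> bool" where
  "algorithmically_stackable_over G X \<longleftrightarrow>
     (\<exists>T \<Phi>. maximal_tree G X T \<and> flow_function (cayley_graph G X) T \<Phi> \<and>
        bounded_flow (cayley_graph G X) \<Phi> \<and> decidable_rel 3 X (stacking_graph G X T \<Phi>))"

definition algorithmically_stackable :: "('g, 'm) monoid_scheme \<Rightarrow> bool" where
  "algorithmically_stackable G \<longleftrightarrow>
     group G \<and>
     (\<exists>X. fin_inv_closed_gen_set G X \<and> \<one>\<^bsub>G\<^esub> \<notin> X \<and> algorithmically_stackable_over G X)"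

section \<open>Group presentations and HNN extensions\<close>

text \<open>Group words over a set S: (x, True) stands for the generator x and (x, False) for its formal
  inverse. \<open>pres_eq S R\<close> is the congruence on such words generated by free cancellation and by the
  relations u = v with (u, v) in R.\<close>

type_synonym 'x gword = "('x \<times> bool) list"

definition gwords :: "'x set \<Rightarrow> 'x gword set" where
  "gwords S = lists (S \<times> UNIV)"

inductive pres_eq :: "'x set \<Rightarrow> ('x gword \<times> 'x gword) set \<Rightarrow> 'x gword \<Rightarrow> 'x gword \<Rightarrow> bool"
  for S :: "'x set" and R :: "('x gword \<times> 'x gword) set" where
  refl: "w \<in> gwords S \<Longrightarrow> pres_eq S R w w"
| sym: "pres_eq S R u v \<Longrightarrow> pres_eq S R v u"
| trans: "\<lbrakk>pres_eq S R u v; pres_eq S R v w\<rbrakk> \<Longrightarrow> pres_eq S R u w"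
| append: "\<lbrakk>pres_eq S R u u'; pres_eq S R v v'\<rbrakk> \<Longrightarrow> pres_eq S R (u @ v) (u' @ v')"
| cancel: "x \<in> S \<Longrightarrow> pres_eq S R [(x, b), (x, \<not> b)] []"
| relation: "\<lbrakk>(u, v) \<in> R; u \<in> gwords S; v \<in> gwords S\<rbrakk> \<Longrightarrow> pres_eq S R u v"

definition pres_class :: "'x set \<Rightarrow> ('x gword \<times> 'x gword) set \<Rightarrow> 'x gword \<Rightarrow> 'x gword set" where
  "pres_class S R w = {v. pres_eq S R w v}"

definition presented_group ::
    "'x set \<Rightarrow> ('x gword \<times> 'x gword) set \<Rightarrow> 'x gword set monoid" where
  "presented_group S R =
     \<lparr>carrier = pres_class S R ` gwords S,
      monoid.mult = (\<lambda>P Q. \<Union>u\<in>P. \<Union>v\<in>Q. pres_class S R (u @ v)),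
      one = pres_class S R []\<rparr>"

datatype 'h hnn_gen = Base 'h | Stable

text \<open>In a presentation beginning with "H, s" the group H contributes all its elements as
  generators and its multiplication table as relations.\<close>

definition hnn_relations ::
    "('h, 'm) monoid_scheme \<Rightarrow> 'h set \<Rightarrow> ('h \<Rightarrow> 'h) \<Rightarrow> ('h hnn_gen gword \<times> 'h hnn_gen gword) set" where
  "hnn_relations H A \<psi> =
     {([(Base h, True), (Base k, True)], [(Base (h \<otimes>\<^bsub>H\<^esub> k), True)]) | h k.
         h \<in> carrier H \<and> k \<in> carrier H} \<union>
     {([(Stable, True), (Base a, True), (Stable, False)], [(Base (\<psi> a), True)]) | a. a \<in> A}"

definition hnn_extension ::
    "('h, 'm) monoid_scheme \<Rightarrow> 'h set \<Rightarrow> ('h \<Rightarrow> 'h) \<Rightarrow> 'h hnn_gen gword set monoid" where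
  "hnn_extension H A \<psi> =
     presented_group (insert Stable (Base ` carrier H)) (hnn_relations H A \<psi>)"

lemma pres_eq_gwords: "pres_eq S R u v \<Longrightarrow> u \<in> gwords S \<and> v \<in> gwords S"
  by (induction rule: pres_eq.induct) (auto simp: gwords_def)

lemma pres_class_eq_iff:
  "u \<in> gwords S \<Longrightarrow> pres_class S R u = pres_class S R v \<longleftrightarrow> pres_eq S R u v"
  unfolding pres_class_def
  by (auto intro: pres_eq.intros)

lemma presented_group_mult:
  assumes "u \<in> gwords S" "v \<in> gwords S"
  shows "pres_class S R u \<otimes>\<^bsub>presented_group S R\<^esub> pres_class S R v = pres_class S R (u @ v)"
  using assms unfolding presented_group_def pres_class_def
  by (auto intro: pres_eq.intros)

lemma pres_eq_inverse:
  "w \<in> gwords S \<Longrightarrow> pres_eq S R (rev (map (\<lambda>(x, b). (x, \<not> b)) w) @ w) []"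
proof (induction w)
  case Nil
  then show ?case by (simp add: gwords_def pres_eq.refl)
next
  case (Cons a w)
  obtain x b where a: "a = (x, b)" by fastforce
  let ?i = "rev (map (\<lambda>(x, b). (x, \<not> b)) w)"
  have x: "x \<in> S" and w: "w \<in> gwords S" and i: "?i \<in> gwords S"
    using Cons.prems a by (auto simp: gwords_def)
  have "pres_eq S R [(x, \<not> b), (x, b)] []"
    using pres_eq.cancel[OF x, of R "\<not> b"] by simp
  then have "pres_eq S R (?i @ [(x, \<not> b), (x, b)] @ w) (?i @ [] @ w)"
    by (intro pres_eq.append pres_eq.refl i w)
  then show ?case using Cons.IH[OF w] a by (auto intro: pres_eq.trans)
qed

lemma group_presented_group: "group (presented_group S R)"
proof (rule groupI)
  fix P Q U
  assume "P \<in> carrier (presented_group S R)" "Q \<in> carrier (presented_group S R)"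
    "U \<in> carrier (presented_group S R)"
  then obtain u v w where uvw: "P = pres_class S R u" "Q = pres_class S R v" "U = pres_class S R w"
    "u \<in> gwords S" "v \<in> gwords S" "w \<in> gwords S"
    by (auto simp: presented_group_def)
  moreover have "u @ v \<in> gwords S" "v @ w \<in> gwords S"
    using uvw by (auto simp: gwords_def)
  ultimately show "P \<otimes>\<^bsub>presented_group S R\<^esub> Q \<otimes>\<^bsub>presented_group S R\<^esub> U =
      P \<otimes>\<^bsub>presented_group S R\<^esub> (Q \<otimes>\<^bsub>presented_group S R\<^esub> U)"
    by (simp add: presented_group_mult)
next
  fix P Q
  assume "P \<in> carrier (presented_group S R)" "Q \<in> carrier (presented_group S R)"
  then obtain u v where uv: "P = pres_class S R u" "Q = pres_class S R v"
    "u \<in> gwords S" "v \<in> gwords S"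
    by (auto simp: presented_group_def)
  moreover have "u @ v \<in> gwords S" using uv by (auto simp: gwords_def)
  ultimately show "P \<otimes>\<^bsub>presented_group S R\<^esub> Q \<in> carrier (presented_group S R)"
    by (simp add: presented_group_mult) (simp add: presented_group_def)
next
  show "\<one>\<^bsub>presented_group S R\<^esub> \<in> carrier (presented_group S R)"
    by (simp add: presented_group_def gwords_def)
next
  fix P assume "P \<in> carrier (presented_group S R)"
  then obtain u where u: "P = pres_class S R u" "u \<in> gwords S"
    by (auto simp: presented_group_def)
  have one: "\<one>\<^bsub>presented_group S R\<^esub> = pres_class S R []" and nil: "[] \<in> gwords S"
    by (simp_all add: presented_group_def gwords_def)
  show "\<one>\<^bsub>presented_group S R\<^esub> \<otimes>\<^bsub>presented_group S R\<^esub> P = P"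
    using presented_group_mult[OF nil u(2), of R] by (simp add: one u)
  let ?i = "rev (map (\<lambda>(x, b). (x, \<not> b)) u)"
  have i: "?i \<in> gwords S" and iu: "?i @ u \<in> gwords S" using u(2) by (auto simp: gwords_def)
  have "pres_class S R ?i \<otimes>\<^bsub>presented_group S R\<^esub> P = \<one>\<^bsub>presented_group S R\<^esub>"
    using presented_group_mult[OF i u(2), of R] pres_eq_inverse[OF u(2), of R]
      pres_class_eq_iff[OF iu, of R "[]"] by (simp add: one u)
  moreover have "pres_class S R ?i \<in> carrier (presented_group S R)"
    using i by (simp add: presented_group_def)
  ultimately show "\<exists>Q\<in>carrier (presented_group S R).
      Q \<otimes>\<^bsub>presented_group S R\<^esub> P = \<one>\<^bsub>presented_group S R\<^esub>" by blast
qed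

lemma group_hnn_extension: "group (hnn_extension H A \<psi>)"
  by (simp add: hnn_extension_def group_presented_group)

lemma wf_digraph_cayley_graph:
  assumes "group G" "X \<subseteq> carrier G"
  shows "wf_digraph (cayley_graph G X)"
proof -
  interpret group G by fact
  show ?thesis using assms(2) by unfold_locales (auto simp: cayley_graph_def)
qed

end

theory Submission
  imports Defs
begin

text \<open>Normal forms of the HNN extension are words \<open>nf(t\<^sub>1) s\<^bsup>e\<^sub>1\<^esup> \<dots> nf(t\<^sub>n) s\<^bsup>e\<^sub>n\<^esup> nf(h)\<close> where each \<open>t\<^sub>i\<close>
  is a chosen representative of a left coset of \<open>B\<close> (before \<open>s\<close>) or \<open>A\<close> (before \<open>s\<^sup>-\<^sup>1\<close>). As the
  coset representatives stand on the left and \<open>h \<in> H\<close> is arbitrary, every coset \<open>pH\<close> carries a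
  translate of the given tree and flow of \<open>H\<close>, so nothing has to be assumed about the position of \<open>A\<close>
  and \<open>B\<close> in that tree. An \<open>s\<close>-edge starting at \<open>ptb\<close> with \<open>b \<in> B\<close> lies in the tree iff \<open>b = 1\<close>.
  Otherwise write \<open>b = b'\<beta>\<close> with a generator \<open>\<beta>\<close> of \<open>B\<close> and \<open>b'\<close> shorter than \<open>b\<close>; the edge
  flows to \<open>\<beta>\<^sup>-\<^sup>1 s \<psi>\<^sup>-\<^sup>1(\<beta>)\<close>, whose only \<open>s\<close>-edge starts at \<open>ptb'\<close>, while its other edges lie in
  translates of the Cayley graph of \<open>H\<close>. For the algorithm, the bounded flow of \<open>H\<close> yields a solution
  of its word problem, whence representatives and factorizations can be found by
  unbounded search using the membership algorithms.\<close>

section \<open>Computable functions on encodable types\<close>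

text \<open>A presentation does not show that different normal forms are different elements. This
  comes from van der Waerden's method: the generators act on the set of normal forms, the defining
  relations hold for this action, and the image of the empty form recovers the normal form of an
  element. The same action, transcribed to codes of words, is later the program that brings a word
  into normal form.

  The flow on an \<open>s\<close>-edge has to terminate and to be computable. One choice achieves
  both: elements of the associated subgroups are factored by the list of generators with least code,
  and that code serves as the length. Likewise a coset is represented through the least code of a
  word for any of its members. The searches use the same criteria as these abstract choices, so they
  return exactly the same words; this makes the graph of the flow decidable.

  On the side of graphs the obstacle is that trees are maximal with respect to inclusion and normal
  forms are definite descriptions of paths. Both are exchanged for prefix-closed systems of words,
  in the hypothesis as well as in the conclusion.\<close>

text \<open>Agreement on lists of length \<open>n\<close> only, since \<open>recursive_fn\<close> is not closed under changing the
  values on lists of other lengths.\<close>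

definition rec_on :: "nat \<Rightarrow> (nat list \<Rightarrow> nat) \<Rightarrow> bool" where
  "rec_on n F \<longleftrightarrow> (\<exists>f. recursive_fn n f \<and> (\<forall>xs. length xs = n \<longrightarrow> f xs = F xs))"

lemma rec_on_cong:
  assumes "rec_on n F" "\<And>xs. length xs = n \<Longrightarrow> F xs = F' xs"
  shows "rec_on n F'"
  using assms unfolding rec_on_def by metis

lemma rec_on_proj: "i < n \<Longrightarrow> rec_on n (\<lambda>xs. xs ! i)"
  unfolding rec_on_def using recursive_fn.proj by blast

lemma rec_on_comp:
  assumes F: "rec_on (length gs) F" and gs: "\<forall>g\<in>set gs. rec_on n g"
  shows "rec_on n (\<lambda>xs. F (map (\<lambda>g. g xs) gs))"
proof -
  obtain f where f: "recursive_fn (length gs) f" "\<And>xs. length xs = length gs \<Longrightarrow> f xs = F xs"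
    using F unfolding rec_on_def by blast
  obtain h where h: "\<forall>g\<in>set gs. recursive_fn n (h g) \<and> (\<forall>xs. length xs = n \<longrightarrow> h g xs = g xs)"
    using gs unfolding rec_on_def by metis
  have "recursive_fn n (\<lambda>xs. f (map (\<lambda>g. g xs) (map h gs)))"
    by (rule recursive_fn.comp[OF f(1)]) (use h in auto)
  moreover have "f (map (\<lambda>g. g xs) (map h gs)) = F (map (\<lambda>g. g xs) gs)" if "length xs = n" for xs
  proof -
    have "map (\<lambda>g. g xs) (map h gs) = map (\<lambda>g. g xs) gs"
      using h that by auto
    then show ?thesis using f(2)[of "map (\<lambda>g. g xs) gs"] by (metis length_map)
  qed
  ultimately show ?thesis unfolding rec_on_def by blast
qed

lemma rec_on_prim_rec:
  assumes "rec_on n F" and "rec_on (Suc (Suc n)) G"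
  shows "rec_on (Suc n) (\<lambda>xs. rec_nat (F (tl xs)) (\<lambda>y r. G (y # r # tl xs)) (hd xs))"
proof -
  obtain f where f: "recursive_fn n f" "\<And>xs. length xs = n \<Longrightarrow> f xs = F xs"
    using assms(1) unfolding rec_on_def by blast
  obtain g where g: "recursive_fn (Suc (Suc n)) g" "\<And>xs. length xs = Suc (Suc n) \<Longrightarrow> g xs = G xs"
    using assms(2) unfolding rec_on_def by blast
  show ?thesis
    unfolding rec_on_def
    by (intro exI[of _ "\<lambda>xs. rec_nat (f (tl xs)) (\<lambda>y r. g (y # r # tl xs)) (hd xs)"] conjI
        recursive_fn.prim_rec f(1) g(1)) (simp add: f(2) g(2))
qed

lemma rec_on_minimize:
  assumes "rec_on (Suc n) F" and "\<And>xs. length xs = n \<Longrightarrow> \<exists>y. F (y # xs) = 0"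
  shows "rec_on n (\<lambda>xs. LEAST y. F (y # xs) = 0)"
proof -
  obtain f where f: "recursive_fn (Suc n) f" "\<And>xs. length xs = Suc n \<Longrightarrow> f xs = F xs"
    using assms(1) unfolding rec_on_def by blast
  show ?thesis
    unfolding rec_on_def
    by (intro exI[of _ "\<lambda>xs. LEAST y. f (y # xs) = 0"] conjI recursive_fn.minimize f(1))
      (use f(2) assms(2) in auto)
qed

lemma rec_on_Suc: "rec_on n g \<Longrightarrow> rec_on n (\<lambda>xs. Suc (g xs))"
  using rec_on_comp[of "[g]" "\<lambda>xs. Suc (xs ! 0)" n] recursive_fn.succ
  by (auto simp: rec_on_def[of 1] rec_on_def[of "Suc 0"])

lemma rec_on_const: "rec_on n (\<lambda>_. c)"
proof (induction c)
  case 0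
  then show ?case unfolding rec_on_def using recursive_fn.zero by blast
next
  case (Suc c)
  then show ?case by (rule rec_on_Suc)
qed

lemma rec_on_comp1: "rec_on 1 (\<lambda>xs. f (xs ! 0)) \<Longrightarrow> rec_on n g \<Longrightarrow> rec_on n (\<lambda>xs. f (g xs))"
  using rec_on_comp[of "[g]" "\<lambda>xs. f (xs ! 0)" n] by simp

lemma rec_on_comp2:
  "rec_on 2 (\<lambda>xs. f (xs ! 0) (xs ! 1)) \<Longrightarrow> rec_on n g \<Longrightarrow> rec_on n h
    \<Longrightarrow> rec_on n (\<lambda>xs. f (g xs) (h xs))"
  using rec_on_comp[of "[g, h]" "\<lambda>xs. f (xs ! 0) (xs ! 1)" n] by (simp add: numeral_2_eq_2)

text \<open>One parameter besides the recursion variable is enough, since several can be packed into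
  one by pairing; \<open>computable_rec_nat\<close> relies on this.\<close>

lemma rec_on_rec2:
  assumes "rec_on 1 (\<lambda>xs. f (xs ! 0))"
    and "rec_on 3 (\<lambda>xs. g (xs ! 0) (xs ! 1) (xs ! 2))"
  shows "rec_on 2 (\<lambda>xs. rec_nat (f (xs ! 1)) (\<lambda>y r. g y r (xs ! 1)) (xs ! 0))"
proof -
  have "rec_on (Suc 1) (\<lambda>xs. rec_nat (f (tl xs ! 0))
      (\<lambda>y r. g ((y # r # tl xs) ! 0) ((y # r # tl xs) ! 1) ((y # r # tl xs) ! 2)) (hd xs))"
    by (rule rec_on_prim_rec[OF assms(1)]) (use assms(2) in \<open>simp add: numeral_3_eq_3\<close>)
  then have "rec_on 2 (\<lambda>xs. rec_nat (f (tl xs ! 0))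
      (\<lambda>y r. g ((y # r # tl xs) ! 0) ((y # r # tl xs) ! 1) ((y # r # tl xs) ! 2)) (hd xs))"
    by (simp add: numeral_2_eq_2)
  then show ?thesis
    by (rule rec_on_cong) (auto simp: length_Suc_conv numeral_2_eq_2)
qed

lemma rec_on_add: assumes "rec_on n g" "rec_on n h" shows "rec_on n (\<lambda>xs. g xs + h xs)"
proof -
  have *: "rec_on 2 (\<lambda>xs. rec_nat (xs ! 1) (\<lambda>y r. Suc r) (xs ! 0))"
    by (rule rec_on_rec2[of "\<lambda>x. x" "\<lambda>y r p. Suc r"])
      (auto intro!: rec_on_proj rec_on_Suc)
  have "rec_nat b (\<lambda>y r. Suc r) a = a + b" for a b :: nat
    by (induction a) auto
  with * have "rec_on 2 (\<lambda>xs. xs ! 0 + xs ! 1)" by simp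
  then show ?thesis using assms by (rule rec_on_comp2)
qed

lemma rec_on_mult: assumes "rec_on n g" "rec_on n h" shows "rec_on n (\<lambda>xs. g xs * h xs)"
proof -
  have *: "rec_on 2 (\<lambda>xs. rec_nat 0 (\<lambda>y r. r + xs ! 1) (xs ! 0))"
    by (rule rec_on_rec2[of "\<lambda>x. 0" "\<lambda>y r p. r + p"])
      (auto intro!: rec_on_proj rec_on_add rec_on_const)
  have "rec_nat 0 (\<lambda>y r. r + b) a = a * b" for a b :: nat
    by (induction a) auto
  with * have "rec_on 2 (\<lambda>xs. xs ! 0 * xs ! 1)" by simp
  then show ?thesis using assms by (rule rec_on_comp2)
qed

lemma rec_on_rec1:
  assumes "rec_on 2 (\<lambda>xs. g (xs ! 0) (xs ! 1))" "rec_on n h"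
  shows "rec_on n (\<lambda>xs. rec_nat c g (h xs))"
proof -
  have "rec_on 3 (\<lambda>xs. g (xs ! 0) (xs ! 1))"
    by (rule rec_on_comp2[OF assms(1)]) (auto intro: rec_on_proj)
  then have *: "rec_on 2 (\<lambda>xs. rec_nat c (\<lambda>y r. g y r) (xs ! 0))"
    by (intro rec_on_rec2[of "\<lambda>x. c" "\<lambda>y r p. g y r"] rec_on_const)
  show ?thesis
    by (rule rec_on_comp2[of "\<lambda>a b. rec_nat c g a", OF * assms(2) assms(2)])
qed

lemma rec_on_pred: "rec_on n g \<Longrightarrow> rec_on n (\<lambda>xs. g xs - 1)"
proof -
  assume "rec_on n g"
  then have "rec_on n (\<lambda>xs. rec_nat 0 (\<lambda>y r. y) (g xs))"
    by (intro rec_on_rec1 rec_on_proj) auto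
  moreover have "rec_nat 0 (\<lambda>y r. y) a = a - 1" for a :: nat
    by (cases a) auto
  ultimately show ?thesis by simp
qed

lemma rec_on_diff: "rec_on n g \<Longrightarrow> rec_on n h \<Longrightarrow> rec_on n (\<lambda>xs. g xs - h xs)"
proof -
  \<comment> \<open>The recursion runs over the subtrahend, so the arguments come out
    swapped.\<close>
  have *: "rec_on 2 (\<lambda>xs. rec_nat (xs ! 1) (\<lambda>y r. r - 1) (xs ! 0))"
    by (rule rec_on_rec2[of "\<lambda>x. x" "\<lambda>y r p. r - 1"])
      (intro rec_on_proj rec_on_pred; simp)+
  have "rec_nat b (\<lambda>y r. r - 1) a = b - a" for a b :: nat
    by (induction a) auto
  with * have "rec_on 2 (\<lambda>xs. xs ! 1 - xs ! 0)" by simp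
  then show "rec_on n g \<Longrightarrow> rec_on n h \<Longrightarrow> rec_on n (\<lambda>xs. g xs - h xs)"
    by (rule rec_on_comp2[of "\<lambda>a b. b - a"])
qed

lemma rec_on_triangle: "rec_on n g \<Longrightarrow> rec_on n (\<lambda>xs. triangle (g xs))"
proof -
  assume "rec_on n g"
  then have "rec_on n (\<lambda>xs. rec_nat 0 (\<lambda>y r. r + Suc y) (g xs))"
    by (intro rec_on_rec1 rec_on_proj rec_on_add rec_on_Suc) auto
  moreover have "rec_nat 0 (\<lambda>y r. r + Suc y) a = triangle a" for a :: nat
    by (induction a) auto
  ultimately show ?thesis by simp
qed

lemma rec_on_prod_encode:
  "rec_on n g \<Longrightarrow> rec_on n h \<Longrightarrow> rec_on n (\<lambda>xs. prod_encode (g xs, h xs))"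
  by (simp add: prod_encode_def rec_on_add rec_on_triangle)

text \<open>A pair \<open>(a, b)\<close> coded by \<open>z\<close> lies on the antidiagonal
  \<open>a + b = d\<close>, and \<open>d\<close> is the first \<open>s\<close> with
  \<open>z < triangle (Suc s)\<close>. The inequality is phrased as a vanishing truncated difference
  because minimization searches for zeros.\<close>

lemma prod_decode_diagonal:
  fixes z :: nat
  defines "d \<equiv> LEAST s. Suc z - triangle (Suc s) = 0"
  shows "prod_decode z = (z - triangle d, d - (z - triangle d))"
proof -
  obtain a b where ab: "prod_decode z = (a, b)" by fastforce
  have z: "z = triangle (a + b) + a"
    using prod_decode_inverse[of z] ab by (simp add: prod_encode_def)
  have mono: "triangle i \<le> triangle j" if "i \<le> j" for i j
    using that by (induction rule: dec_induct) auto
  have "d = a + b"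
    unfolding d_def
  proof (rule Least_equality)
    show "Suc z - triangle (Suc (a + b)) = 0" using z by simp
  next
    fix s assume s: "Suc z - triangle (Suc s) = 0"
    show "a + b \<le> s"
    proof (rule ccontr)
      assume "\<not> a + b \<le> s"
      then have "triangle (Suc s) \<le> triangle (a + b)" by (intro mono) simp
      then show False using s z by simp
    qed
  qed
  then show ?thesis using ab z by simp
qed

lemma rec_on_prod_decode:
  assumes "rec_on n g"
  shows "rec_on n (\<lambda>xs. fst (prod_decode (g xs)))" "rec_on n (\<lambda>xs. snd (prod_decode (g xs)))"
proof -
  let ?d = "\<lambda>z. LEAST s. Suc z - triangle (Suc s) = 0"
  have ex: "\<exists>y. Suc z \<le> triangle (Suc y)" for z
    by (rule exI[of _ z]) simp
  have "rec_on 1 (\<lambda>xs. LEAST y. Suc ((y # xs) ! 1) - triangle (Suc ((y # xs) ! 0)) = 0)"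
  proof (rule rec_on_minimize)
    show "rec_on (Suc 1) (\<lambda>xs. Suc (xs ! 1) - triangle (Suc (xs ! 0)))"
      by (intro rec_on_diff rec_on_Suc rec_on_proj rec_on_triangle) auto
  qed (simp add: ex del: triangle_Suc)
  then have d1: "rec_on 1 (\<lambda>xs. ?d (xs ! 0))" by simp
  have d: "rec_on n (\<lambda>xs. ?d (g xs))"
    by (rule rec_on_comp1[OF d1 assms])
  have "rec_on n (\<lambda>xs. g xs - triangle (?d (g xs)))"
    using d by (intro rec_on_diff assms rec_on_triangle)
  then show "rec_on n (\<lambda>xs. fst (prod_decode (g xs)))" unfolding prod_decode_diagonal by simp
  have "rec_on n (\<lambda>xs. ?d (g xs) - (g xs - triangle (?d (g xs))))"
    using d by (intro rec_on_diff assms rec_on_triangle)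
  then show "rec_on n (\<lambda>xs. snd (prod_decode (g xs)))" unfolding prod_decode_diagonal by simp
qed

text \<open>As \<open>enc\<close> is onto, every number decodes, and unbounded search over a type is
  search over the numbers. Only infinite types qualify, so truth values are passed on as numbers by
  \<open>of_bool\<close>.\<close>

class enc =
  fixes enc :: "'a \<Rightarrow> nat"
  assumes bij_enc: "bij enc"

instantiation nat :: enc
begin
definition enc_nat :: "nat \<Rightarrow> nat" where "enc_nat = id"
instance by standard (simp add: enc_nat_def)
end

instantiation prod :: (enc, enc) enc
begin
definition enc_prod :: "'a \<times> 'b \<Rightarrow> nat" where "enc_prod = (\<lambda>(a, b). prod_encode (enc a, enc b))"
instance
proof
  have "(enc :: 'a \<times> 'b \<Rightarrow> nat) = prod_encode \<circ> map_prod enc enc"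
    by (auto simp: enc_prod_def)
  moreover have "bij (map_prod (enc :: 'a \<Rightarrow> nat) (enc :: 'b \<Rightarrow> nat))"
    using bij_betw_map_prod[OF bij_enc bij_enc] by simp
  ultimately show "bij (enc :: 'a \<times> 'b \<Rightarrow> nat)"
    using bij_comp bij_prod_encode by metis
qed
end

instantiation list :: (enc) enc
begin
text \<open>Chosen to agree with \<open>word_code\<close>: the code of a word is \<open>enc\<close>
  of the list of its letter numbers.\<close>

definition enc_list :: "'a list \<Rightarrow> nat" where "enc_list l = list_encode (map enc l)"
instance
proof
  have "(enc :: 'a list \<Rightarrow> nat) = list_encode \<circ> map enc"
    by (auto simp: enc_list_def)
  moreover have "bij (map (enc :: 'a \<Rightarrow> nat))"
    using bij_enc[where 'a = 'a] by (simp add: bij_def surj_def) (metis ex_map_conv)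
  ultimately show "bij (enc :: 'a list \<Rightarrow> nat)"
    using bij_comp bij_list_encode by metis
qed
end

abbreviation unenc :: "nat \<Rightarrow> 'a::enc" where "unenc \<equiv> inv_into UNIV enc"

lemma unenc_enc [simp]: "unenc (enc x) = x"
  using bij_enc bij_is_inj inv_f_f by metis

lemma enc_unenc [simp]: "enc (unenc n) = n"
  using bij_enc bij_is_surj surj_f_inv_f by metis

lemma enc_eq_iff [simp]: "enc x = enc y \<longleftrightarrow> x = y"
  by (metis unenc_enc)

lemma enc_simps [simp]:
  "enc (n :: nat) = n"
  "enc (a, b) = prod_encode (enc a, enc b)"
  "enc ([] :: 'c::enc list) = 0"
  "enc (x # xs) = Suc (prod_encode (enc x, enc xs))"
  by (simp_all add: enc_nat_def enc_prod_def enc_list_def)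

section \<open>Closure rules for computable functions\<close>

definition computable :: "('a::enc \<Rightarrow> 'b::enc) \<Rightarrow> bool" where
  "computable f \<longleftrightarrow> rec_on 1 (\<lambda>xs. enc (f (unenc (xs ! 0))))"

lemma computableI:
  assumes "rec_on 1 (\<lambda>xs. F (xs ! 0))" "\<And>x. F (enc x) = enc (f x)"
  shows "computable f"
  unfolding computable_def by (rule rec_on_cong[OF assms(1)]) (metis assms(2) enc_unenc)

lemma rec_on_computable: "computable f \<Longrightarrow> rec_on n g \<Longrightarrow> rec_on n (\<lambda>xs. enc (f (unenc (g xs))))"
  unfolding computable_def by (rule rec_on_comp1)

named_theorems computable_intros

lemma computable_id [computable_intros]: "computable (\<lambda>x. x)"
  by (rule computableI[of "\<lambda>n. n"]) (simp_all add: rec_on_proj)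

lemma computable_const [computable_intros]: "computable (\<lambda>x. c)"
  by (rule computableI[of "\<lambda>n. enc c"]) (simp_all add: rec_on_const)

lemma computable_comp: "computable f \<Longrightarrow> computable g \<Longrightarrow> computable (\<lambda>x. f (g x))"
  unfolding computable_def[of g] computable_def[of "\<lambda>x. f (g x)"]
  by (drule (1) rec_on_computable) simp

lemma computable_Pair [computable_intros]:
  "computable f \<Longrightarrow> computable g \<Longrightarrow> computable (\<lambda>x. (f x, g x))"
  unfolding computable_def by (simp add: rec_on_prod_encode)

lemma computable_comp2:
  "computable (\<lambda>p. f (fst p) (snd p)) \<Longrightarrow> computable g \<Longrightarrow> computable h \<Longrightarrow> computable (\<lambda>x. f (g x) (h x))"
  using computable_comp[of "\<lambda>p. f (fst p) (snd p)" "\<lambda>x. (g x, h x)"] computable_Pair by auto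

lemma computable_fst [computable_intros]:
  fixes f :: "'a::enc \<Rightarrow> 'b::enc \<times> 'c::enc"
  assumes "computable f" shows "computable (\<lambda>x. fst (f x))"
proof -
  have "computable (fst :: 'b \<times> 'c \<Rightarrow> 'b)"
    by (rule computableI[of "\<lambda>n. fst (prod_decode n)"]) (auto intro: rec_on_prod_decode rec_on_proj)
  then show ?thesis using assms by (rule computable_comp)
qed

lemma computable_snd [computable_intros]:
  fixes f :: "'a::enc \<Rightarrow> 'b::enc \<times> 'c::enc"
  assumes "computable f" shows "computable (\<lambda>x. snd (f x))"
proof -
  have "computable (snd :: 'b \<times> 'c \<Rightarrow> 'c)"
    by (rule computableI[of "\<lambda>n. snd (prod_decode n)"]) (auto intro: rec_on_prod_decode rec_on_proj)
  then show ?thesis using assms by (rule computable_comp)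
qed

lemma computable_enc [computable_intros]: "computable f \<Longrightarrow> computable (\<lambda>x. enc (f x))"
  by (rule computable_comp[of enc]) (rule computableI[of "\<lambda>n. n"], simp_all add: rec_on_proj)

lemma computable_unenc [computable_intros]: "computable f \<Longrightarrow> computable (\<lambda>x. unenc (f x))"
  by (rule computable_comp[of unenc]) (rule computableI[of "\<lambda>n. n"], simp_all add: rec_on_proj)

lemma computable_nat2:
  assumes "rec_on 1 (\<lambda>xs. f (fst (prod_decode (xs ! 0))) (snd (prod_decode (xs ! 0))))"
    "computable g" "computable h"
  shows "computable (\<lambda>x. f (g x) (h x) :: nat)"
  by (rule computable_comp2[OF computableI[OF assms(1)] assms(2,3)]) auto

lemma computable_add [computable_intros]:
  "computable g \<Longrightarrow> computable h \<Longrightarrow> computable (\<lambda>x. g x + h x :: nat)"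
  by (rule computable_nat2; (intro rec_on_add rec_on_prod_decode rec_on_proj)?; simp)

lemma computable_diff [computable_intros]:
  "computable g \<Longrightarrow> computable h \<Longrightarrow> computable (\<lambda>x. g x - h x :: nat)"
  by (rule computable_nat2; (intro rec_on_diff rec_on_prod_decode rec_on_proj)?; simp)

lemma computable_mult [computable_intros]:
  "computable g \<Longrightarrow> computable h \<Longrightarrow> computable (\<lambda>x. g x * h x :: nat)"
  by (rule computable_nat2; (intro rec_on_mult rec_on_prod_decode rec_on_proj)?; simp)

lemma computable_rec_nat [computable_intros]:
  fixes f :: "'a::enc \<Rightarrow> 's::enc" and g :: "'a \<Rightarrow> nat \<Rightarrow> 's \<Rightarrow> 's"
  assumes f: "computable f" and g: "computable (\<lambda>p. g (fst p) (fst (snd p)) (snd (snd p)))"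
    and n: "computable n"
  shows "computable (\<lambda>x. rec_nat (f x) (g x) (n x))"
proof -
  let ?F = "\<lambda>a. enc (f (unenc a))"
  let ?G = "\<lambda>y r a. enc ((\<lambda>p. g (fst p) (fst (snd p)) (snd (snd p))) (unenc (prod_encode (a, prod_encode (y, r)))))"
  have "rec_on 2 (\<lambda>xs. rec_nat (?F (xs ! 1)) (\<lambda>y r. ?G y r (xs ! 1)) (xs ! 0))"
    by (rule rec_on_rec2[of ?F ?G])
      (auto intro!: rec_on_computable[OF f] rec_on_computable[OF g] rec_on_prod_encode rec_on_proj)
  then have "rec_on 1 (\<lambda>xs. rec_nat (?F (xs ! 0)) (\<lambda>y r. ?G y r (xs ! 0)) (enc (n (unenc (xs ! 0)))))"
    by (rule rec_on_comp2[of "\<lambda>a b. rec_nat (?F b) (\<lambda>y r. ?G y r b) a"])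
      (auto intro: n[unfolded computable_def, simplified] rec_on_proj)
  then show ?thesis
  proof (rule computableI[of "\<lambda>a. rec_nat (?F a) (\<lambda>y r. ?G y r a) (enc (n (unenc a)))"])
    fix x :: 'a
    have "(unenc (prod_encode (enc x, prod_encode (y, enc r))) :: 'a \<times> nat \<times> 's) = (x, y, r)" for y and r :: 's
      using unenc_enc[of "(x, y, r)"] by simp
    then have "rec_nat (enc (f x)) (\<lambda>y r. ?G y r (enc x)) k = enc (rec_nat (f x) (g x) k)" for k
      by (induction k) simp_all
    then show "rec_nat (?F (enc x)) (\<lambda>y r. ?G y r (enc x)) (enc (n (unenc (enc x)))) = enc (rec_nat (f x) (g x) (n x))"
      by simp
  qed
qed

lemma computable_case_nat [computable_intros]:
  assumes "computable f" "computable (\<lambda>p. g (fst p) (snd p))" "computable n"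
  shows "computable (\<lambda>x. case_nat (f x) (g x) (n x))"
proof -
  have "computable (\<lambda>p. g (fst p) (fst (snd p)))"
    by (rule computable_comp2[OF assms(2)]; intro computable_intros)
  then have "computable (\<lambda>x. rec_nat (f x) (\<lambda>i s. g x i) (n x))"
    by (intro computable_rec_nat assms)
  moreover have "rec_nat (f x) (\<lambda>i s. g x i) k = case_nat (f x) (g x) k" for x k
    by (cases k) auto
  ultimately show ?thesis by simp
qed

lemma computable_Cons [computable_intros]:
  "computable f \<Longrightarrow> computable g \<Longrightarrow> computable (\<lambda>x. f x # g x)"
  unfolding computable_def by (simp add: rec_on_prod_encode rec_on_Suc)

text \<open>The code of a nonempty list is the successor of a code of head and tail, so the case
  distinction is one on numbers.\<close>

lemma computable_case_list [computable_intros]: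
  fixes l :: "'a::enc \<Rightarrow> 'b::enc list"
  assumes f: "computable f" and g: "computable (\<lambda>p. g (fst p) (fst (snd p)) (snd (snd p)))"
    and l: "computable l"
  shows "computable (\<lambda>x. case_list (f x) (g x) (l x))"
proof -
  let ?u = "unenc :: nat \<Rightarrow> 'b \<times> 'b list"
  have "computable (\<lambda>x. case enc (l x) of 0 \<Rightarrow> f x | Suc m \<Rightarrow> g x (fst (?u m)) (snd (?u m)))"
  proof (intro computable_case_nat f computable_enc l)
    have "computable (\<lambda>p. (fst p, ?u (snd p)))" by (intro computable_intros)
    from computable_comp[OF g this]
    show "computable (\<lambda>p. g (fst p) (fst (?u (snd p))) (snd (?u (snd p))))" by simp
  qed
  moreover have "(case enc (l x) of 0 \<Rightarrow> f x | Suc m \<Rightarrow> g x (fst (?u m)) (snd (?u m))) = case_list (f x) (g x) (l x)" for x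
  proof (cases "l x")
    case (Cons y ys)
    have "?u (prod_encode (enc y, enc ys)) = (y, ys)"
      using unenc_enc[of "(y, ys)"] by simp
    then show ?thesis using Cons by simp
  qed simp
  ultimately show ?thesis by simp
qed

lemma length_le_enc: "length l \<le> enc l"
proof (induction l)
  case (Cons a l)
  then show ?case using le_prod_encode_2[of "enc l" "enc a"] by simp
qed simp

lemma computable_comp3:
  assumes "computable (\<lambda>p. f (fst p) (fst (snd p)) (snd (snd p)))"
    "computable a" "computable b" "computable c"
  shows "computable (\<lambda>x. f (a x) (b x) (c x))"
  using computable_comp[OF assms(1), of "\<lambda>x. (a x, b x, c x)"] computable_Pair[OF assms(2) computable_Pair[OF assms(3,4)]]
  by simp

text \<open>A one-step function on pairs of remaining list and accumulator is iterated
  \<open>enc l\<close> times. By \<open>length_le_enc\<close> this is often enough, and surplus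
  steps leave an exhausted list unchanged.\<close>

lemma computable_foldl [computable_intros]:
  fixes h :: "'a::enc \<Rightarrow> 's::enc \<Rightarrow> 'b::enc \<Rightarrow> 's"
  assumes s: "computable s" and h: "computable (\<lambda>p. h (fst p) (fst (snd p)) (snd (snd p)))"
    and l: "computable l"
  shows "computable (\<lambda>x. foldl (h x) (s x) (l x))"
proof -
  define st where "st = (\<lambda>x (q :: 'b list \<times> 's). case fst q of [] \<Rightarrow> q | y # ys \<Rightarrow> (ys, h x (snd q) y))"
  have "computable (\<lambda>p. st (fst p) (snd (snd p)))" for st' :: "'a \<times> nat \<times> 'b list \<times> 's"
    unfolding st_def by (intro computable_intros computable_comp3[OF h])
  then have "computable (\<lambda>x. snd (rec_nat (l x, s x) (\<lambda>_. st x) (enc (l x))))"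
    by (intro computable_intros l s) simp
  moreover have "snd (rec_nat (ys, s') (\<lambda>_. st x) n) = foldl (h x) s' ys" if "length ys \<le> n" for x ys s' n
    using that
  proof (induction ys arbitrary: s' n)
    case Nil
    have "rec_nat ([], s') (\<lambda>_. st x) n = ([], s')" by (induction n) (auto simp: st_def)
    then show ?case by simp
  next
    case (Cons y ys)
    then obtain m where n: "n = Suc m" by (cases n) auto
    have "rec_nat q (\<lambda>_. st x) (Suc m) = rec_nat (st x q) (\<lambda>_. st x) m" for q
      by (induction m) auto
    then show ?case using Cons n by (simp add: st_def)
  qed
  ultimately show ?thesis by (simp add: length_le_enc)
qed

lemma computable_append [computable_intros]:
  assumes "computable f" "computable g" shows "computable (\<lambda>x. f x @ g x)"
proof -
  have "computable (\<lambda>x. foldl (\<lambda>acc y. y # acc) (g x) (foldl (\<lambda>acc y. y # acc) [] (f x)))"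
    by (intro computable_intros assms)
  moreover have "foldl (\<lambda>acc y. y # acc) b a = rev a @ b" for a b :: "'b list"
    by (induction a arbitrary: b) auto
  ultimately show ?thesis by simp
qed

lemma computable_rev [computable_intros]:
  assumes "computable f" shows "computable (\<lambda>x. rev (f x))"
proof -
  have "computable (\<lambda>x. foldl (\<lambda>acc y. y # acc) [] (f x))"
    by (intro computable_intros assms)
  moreover have "foldl (\<lambda>acc y. y # acc) b a = rev a @ b" for a b :: "'b list"
    by (induction a arbitrary: b) auto
  ultimately show ?thesis by simp
qed

lemma computable_concat_map [computable_intros]:
  assumes f: "computable (\<lambda>p. f (fst p) (snd p))" and l: "computable l"
  shows "computable (\<lambda>x. concat (map (f x) (l x)))"
proof -
  have "computable (\<lambda>x. foldl (\<lambda>acc y. acc @ f x y) [] (l x))"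
    by (intro computable_intros l computable_comp2[OF f])
  moreover have "foldl (\<lambda>acc y. acc @ f x y) b a = b @ concat (map (f x) a)" for a b x
    by (induction a arbitrary: b) auto
  ultimately show ?thesis by simp
qed

lemma computable_map [computable_intros]:
  assumes f: "computable (\<lambda>p. f (fst p) (snd p))" and l: "computable l"
  shows "computable (\<lambda>x. map (f x) (l x))"
proof -
  have "computable (\<lambda>x. concat (map (\<lambda>y. [f x y]) (l x)))"
    by (intro computable_intros l f)
  moreover have "concat (map (\<lambda>y. [f x y]) a) = map (f x) a" for a x
    by (induction a) auto
  ultimately show ?thesis by simp
qed

section \<open>Decidable predicates\<close>

definition decidable :: "('a::enc \<Rightarrow> bool) \<Rightarrow> bool" where
  "decidable P \<longleftrightarrow> computable (\<lambda>x. of_bool (P x) :: nat)"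

lemma decidable_comp: "decidable P \<Longrightarrow> computable f \<Longrightarrow> decidable (\<lambda>x. P (f x))"
  unfolding decidable_def by (rule computable_comp)

lemma decidable_comp2:
  "decidable (\<lambda>p. P (fst p) (snd p)) \<Longrightarrow> computable f \<Longrightarrow> computable g \<Longrightarrow> decidable (\<lambda>x. P (f x) (g x))"
  unfolding decidable_def by (rule computable_comp2)

lemma computable_If [computable_intros]:
  assumes "decidable P" "computable f" "computable g"
  shows "computable (\<lambda>x. if P x then f x else g x)"
proof -
  have "computable (\<lambda>x. case of_bool (P x) of 0 \<Rightarrow> g x | Suc _ \<Rightarrow> f x)"
    using assms(1) unfolding decidable_def
    by (intro computable_case_nat computable_comp[OF assms(2)] assms(3)) (intro computable_intros)
  moreover have "(case of_bool (P x) of 0 \<Rightarrow> g x | Suc _ \<Rightarrow> f x) = (if P x then f x else g x)" for x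
    by simp
  ultimately show ?thesis by simp
qed

lemma decidable_not [computable_intros]: "decidable P \<Longrightarrow> decidable (\<lambda>x. \<not> P x)"
proof -
  assume "decidable P"
  then have "computable (\<lambda>x. 1 - of_bool (P x) :: nat)"
    unfolding decidable_def by (intro computable_intros)
  moreover have "1 - of_bool (P x) = (of_bool (\<not> P x) :: nat)" for x by simp
  ultimately show ?thesis unfolding decidable_def by simp
qed

lemma decidable_const [computable_intros]: "decidable (\<lambda>x. c)"
  unfolding decidable_def by (intro computable_intros)

lemma decidable_conj [computable_intros]:
  "decidable P \<Longrightarrow> decidable Q \<Longrightarrow> decidable (\<lambda>x. P x \<and> Q x)"
  unfolding decidable_def of_bool_conj by (intro computable_intros)

lemma decidable_disj [computable_intros]:
  "decidable P \<Longrightarrow> decidable Q \<Longrightarrow> decidable (\<lambda>x. P x \<or> Q x)"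
  using decidable_not[OF decidable_conj[OF decidable_not decidable_not], of P Q] by simp

lemma decidable_imp [computable_intros]:
  "decidable P \<Longrightarrow> decidable Q \<Longrightarrow> decidable (\<lambda>x. P x \<longrightarrow> Q x)"
  using decidable_disj[OF decidable_not, of P Q] by simp

lemma decidable_If [computable_intros]:
  "decidable P \<Longrightarrow> decidable Q \<Longrightarrow> decidable R \<Longrightarrow> decidable (\<lambda>x. if P x then Q x else R x)"
  unfolding if_bool_eq_conj by (intro computable_intros)

lemma decidable_eq [computable_intros]:
  assumes "computable f" "computable g" shows "decidable (\<lambda>x. f x = g x)"
proof -
  have "computable (\<lambda>x. 1 - ((enc (f x) - enc (g x)) + (enc (g x) - enc (f x))))"
    by (intro computable_intros assms)
  moreover have "1 - ((enc a - enc b) + (enc b - enc a)) = of_bool (a = b)" for a b :: 'b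
    using enc_eq_iff[of a b] by (cases "enc a" "enc b" rule: linorder_cases) auto
  ultimately show ?thesis unfolding decidable_def by simp
qed

lemma decidable_less [computable_intros]:
  assumes "computable f" "computable g" shows "decidable (\<lambda>x. (f x :: nat) < g x)"
proof -
  have "decidable (\<lambda>x. g x - f x \<noteq> 0)"
    by (intro computable_intros assms)
  moreover have "g x - f x \<noteq> 0 \<longleftrightarrow> f x < g x" for x by auto
  ultimately show ?thesis by simp
qed

lemma decidable_list_all [computable_intros]:
  assumes P: "decidable (\<lambda>p. P (fst p) (snd p))" and l: "computable l"
  shows "decidable (\<lambda>x. \<forall>y\<in>set (l x). P x y)"
proof -
  have "computable (\<lambda>x. foldl (\<lambda>b y. b * of_bool (P x y)) 1 (l x) :: nat)"
    by (intro computable_intros l decidable_comp2[OF P, unfolded decidable_def])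
  moreover have "foldl (\<lambda>b y. b * of_bool (P x y)) c ys = c * of_bool (\<forall>y\<in>set ys. P x y)" for x ys and c :: nat
    by (induction ys arbitrary: c) auto
  ultimately show ?thesis unfolding decidable_def by simp
qed

text \<open>\<open>f\<close> is arbitrary: its finitely many relevant values are hard-wired. In this
  way words obtained by mere choice enter the programs.\<close>

lemma computable_finite_table:
  fixes n :: nat
  assumes "computable g" shows "computable (\<lambda>x. if g x < n then f (g x) else d)"
proof (induction n)
  case 0
  then show ?case by (simp add: computable_const)
next
  case (Suc n)
  have "computable (\<lambda>x. if g x = n then f n else if g x < n then f (g x) else d)"
    by (intro computable_intros assms Suc)
  moreover have "(if g x = n then f n else if g x < n then f (g x) else d)
      = (if g x < Suc n then f (g x) else d)" for x
    by auto
  ultimately show ?case by simp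
qed

lemma decidable_finite_set:
  assumes "finite S" "computable g" shows "decidable (\<lambda>x. g x \<in> S)"
  using assms(1)
proof (induction S rule: finite_induct)
  case (insert a S)
  then show ?case by (simp add: computable_intros assms)
qed (simp add: computable_intros)

section \<open>Unbounded search\<close>

definition enc_least :: "('a::enc \<Rightarrow> bool) \<Rightarrow> 'a" where
  "enc_least P = unenc (LEAST n. P (unenc n))"

lemma enc_least:
  assumes "P x" shows "P (enc_least P)" "enc (enc_least P) \<le> enc x"
proof -
  have "P (unenc (enc x))" using assms by simp
  from LeastI[of "\<lambda>n. P (unenc n)", OF this] Least_le[of "\<lambda>n. P (unenc n)", OF this]
  show "P (enc_least P)" "enc (enc_least P) \<le> enc x"
    unfolding enc_least_def by auto
qed

text \<open>\<open>minimize\<close> admits only searches that always succeed, so a witness is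
  demanded for every \<open>x\<close>. Later search predicates are therefore made vacuous on
  meaningless input.\<close>

lemma computable_enc_least:
  fixes P :: "'a::enc \<Rightarrow> 'b::enc \<Rightarrow> bool"
  assumes P: "decidable (\<lambda>p. P (fst p) (snd p))" and ex: "\<And>x. \<exists>y. P x y"
  shows "computable (\<lambda>x. enc_least (P x))"
proof -
  define F where "F y x = (1 - of_bool (P (unenc x) (unenc y)) :: nat)" for x y
  have "computable (\<lambda>p. 1 - of_bool (P (fst p) (snd p)) :: nat)"
    using P unfolding decidable_def by (intro computable_intros)
  then have "rec_on 2 (\<lambda>xs. enc ((\<lambda>p. 1 - of_bool (P (fst p) (snd p)) :: nat) (unenc (prod_encode (xs ! 1, xs ! 0)))))"
    by (rule rec_on_computable) (intro rec_on_prod_encode rec_on_proj; simp)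
  moreover have "(unenc (prod_encode (b, a)) :: 'a \<times> 'b) = (unenc b, unenc a)" for a b
    using unenc_enc[of "(unenc b :: 'a, unenc a :: 'b)"] by simp
  ultimately have F: "rec_on (Suc 1) (\<lambda>xs. F (xs ! 0) (xs ! 1))"
    by (simp add: F_def numeral_2_eq_2)
  have "rec_on 1 (\<lambda>xs. LEAST y. F ((y # xs) ! 0) ((y # xs) ! 1) = 0)"
    using F by (rule rec_on_minimize) (use ex in \<open>simp add: F_def, metis unenc_enc\<close>)
  then show ?thesis
    unfolding computable_def enc_least_def by (simp add: F_def Suc_le_eq)
qed

lemma computable_recursive_fn3:
  assumes "recursive_fn 3 f" "computable a" "computable b" "computable c"
  shows "computable (\<lambda>x. f [enc (a x), enc (b x), enc (c x)])"
proof -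
  have "rec_on 3 f" using assms(1) unfolding rec_on_def by blast
  then have "rec_on 1 (\<lambda>xs. f (map (\<lambda>g. g xs) [\<lambda>xs. enc (a (unenc (xs ! 0))),
      \<lambda>xs. enc (b (unenc (xs ! 0))), \<lambda>xs. enc (c (unenc (xs ! 0)))]))"
    using assms(2-4) by (intro rec_on_comp) (auto simp: computable_def numeral_3_eq_3)
  then show ?thesis unfolding computable_def by simp
qed

lemma computable_recursive_fn1:
  assumes "recursive_fn 1 f" "computable a"
  shows "computable (\<lambda>x. f [enc (a x)])"
proof -
  have "rec_on 1 f" using assms(1) unfolding rec_on_def by blast
  then have "rec_on 1 (\<lambda>xs. f (map (\<lambda>g. g xs) [\<lambda>xs. enc (a (unenc (xs ! 0)))]))"
    using assms(2) by (intro rec_on_comp) (auto simp: computable_def)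
  then show ?thesis unfolding computable_def by simp
qed

lemma recursive_fn3_computable:
  fixes F :: "'a::enc \<times> 'b::enc \<times> 'c::enc \<Rightarrow> nat"
  assumes "computable F"
  obtains f where "recursive_fn 3 f" "\<And>x y z. f [enc x, enc y, enc z] = F (x, y, z)"
proof -
  have "rec_on 3 (\<lambda>xs. enc (F (unenc (prod_encode (xs ! 0, prod_encode (xs ! 1, xs ! 2))))))"
    by (intro rec_on_computable[OF assms] rec_on_prod_encode rec_on_proj) auto
  moreover have "(unenc (prod_encode (enc x, prod_encode (enc y, enc z))) :: 'a \<times> 'b \<times> 'c) = (x, y, z)" for x y z
    using unenc_enc[of "(x, y, z)"] by simp
  ultimately show ?thesis using that unfolding rec_on_def by fastforce
qed

section \<open>Maximal trees of Cayley graphs and prefix-closed normal forms\<close>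

declare in_lists_conv_set [simp del] in_listsD [rule del] in_listsI [rule del]

text \<open>A path in a Cayley graph is determined by its initial vertex and its label.\<close>

fun walk :: "('g, 'm) monoid_scheme \<Rightarrow> 'g \<Rightarrow> 'g list \<Rightarrow> ('g \<times> 'g) list" where
  "walk G g [] = []"
| "walk G g (a # w) = (g, a) # walk G (g \<otimes>\<^bsub>G\<^esub> a) w"

lemma path_label_walk [simp]: "path_label (walk G g w) = w"
  by (induction w arbitrary: g) (auto simp: path_label_def)

lemma length_walk [simp]: "length (walk G g w) = length w"
  by (induction w arbitrary: g) auto

lemma word_value_simps [simp]:
  "word_value G [] = \<one>\<^bsub>G\<^esub>" "word_value G (a # w) = a \<otimes>\<^bsub>G\<^esub> word_value G w"
  by (simp_all add: word_value_def)

definition inverse_word :: "('g, 'm) monoid_scheme \<Rightarrow> 'g list \<Rightarrow> 'g list" where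
  "inverse_word G w = rev (map (\<lambda>a. inv\<^bsub>G\<^esub> a) w)"

definition reduced :: "('g, 'm) monoid_scheme \<Rightarrow> 'g list \<Rightarrow> bool" where
  "reduced G w \<longleftrightarrow> successively (\<lambda>a b. b \<noteq> inv\<^bsub>G\<^esub> a) w"

lemma not_successively_split:
  "\<not> successively P w \<Longrightarrow> \<exists>p a b q. w = p @ [a, b] @ q \<and> \<not> P a b"
proof (induction w rule: induct_list012)
  case (3 x y zs)
  show ?case
  proof (cases "P x y")
    case True
    then obtain p a b q where "y # zs = p @ [a, b] @ q" "\<not> P a b" using 3 by auto
    then show ?thesis by (metis append_Cons)
  next
    case False
    then show ?thesis by (metis append_Cons append_Nil)
  qed
qed auto

context group begin

lemma inv_cancel_right [simp]: "g \<in> carrier G \<Longrightarrow> a \<in> carrier G \<Longrightarrow> g \<otimes> a \<otimes> inv a = g"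
  "g \<in> carrier G \<Longrightarrow> a \<in> carrier G \<Longrightarrow> g \<otimes> inv a \<otimes> a = g"
  by (simp_all add: m_assoc)

lemma word_value_closed [simp]: "w \<in> lists (carrier G) \<Longrightarrow> word_value G w \<in> carrier G"
  by (induction w) auto

lemma word_value_append [simp]:
  "u \<in> lists (carrier G) \<Longrightarrow> v \<in> lists (carrier G) \<Longrightarrow>
    word_value G (u @ v) = word_value G u \<otimes> word_value G v"
  by (induction u) (auto simp: m_assoc)

lemma inverse_word_simps [simp]:
  "inverse_word G [] = []" "inverse_word G (a # w) = inverse_word G w @ [inv a]"
  "inverse_word G (u @ v) = inverse_word G v @ inverse_word G u"
  by (simp_all add: inverse_word_def)

lemma inverse_word_closed [simp]: "w \<in> lists (carrier G) \<Longrightarrow> inverse_word G w \<in> lists (carrier G)"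
  by (induction w) auto

lemma word_value_inverse_word [simp]:
  "w \<in> lists (carrier G) \<Longrightarrow> word_value G (inverse_word G w) = inv (word_value G w)"
  by (induction w) (auto simp: inv_mult_group)

lemma reduced_inverse_word:
  assumes "w \<in> lists (carrier G)" "reduced G w" shows "reduced G (inverse_word G w)"
  using assms unfolding reduced_def inverse_word_def
  by (auto simp: successively_map in_lists_conv_set elim!: successively_mono) 

end

locale gen_group = group G for G (structure) and X +
  assumes gen_set: "fin_inv_closed_gen_set G X"
begin

lemma X_closed [simp]: "x \<in> X \<Longrightarrow> x \<in> carrier G"
  and inv_X [simp]: "x \<in> X \<Longrightarrow> inv x \<in> X"
  and finite_X: "finite X"
  and generate_X: "generate G X = carrier G"
  using gen_set unfolding fin_inv_closed_gen_set_def by auto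

lemma lists_X_carrier [simp]: "w \<in> lists X \<Longrightarrow> w \<in> lists (carrier G)"
  by (auto simp: in_lists_conv_set)

lemma inverse_word_X [simp]: "w \<in> lists X \<Longrightarrow> inverse_word G w \<in> lists X"
  by (induction w) auto

lemma ex_word: "g \<in> carrier G \<Longrightarrow> \<exists>w\<in>lists X. word_value G w = g"
proof -
  assume "g \<in> carrier G"
  then have "g \<in> generate G X" using generate_X by simp
  then show ?thesis
  proof induction
    case one
    then show ?case by (intro bexI[of _ "[]"]) auto
  next
    case (incl h)
    then show ?case by (intro bexI[of _ "[h]"]) auto
  next
    case (inv h)
    then show ?case by (intro bexI[of _ "[m_inv G h]"]) auto
  next
    case (eng g h)
    then obtain u v where "u \<in> lists X" "v \<in> lists X" "word_value G u = g" "word_value G v = h" by auto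
    then show ?case by (intro bexI[of _ "u @ v"]) auto
  qed
qed

abbreviation "\<Gamma> \<equiv> cayley_graph G X"

lemma cayley_simps [simp]:
  "verts \<Gamma> = carrier G" "arcs \<Gamma> = carrier G \<times> X" "tail \<Gamma> = fst" "head \<Gamma> e = fst e \<otimes> snd e"
  by (auto simp: cayley_graph_def split: prod.splits)

lemma wf_cayley: "wf_digraph \<Gamma>"
  by (intro wf_digraph_cayley_graph) (auto intro: is_group)

text \<open>The condition on \<open>u\<close> matters for the empty word only; for other words it
  follows in a subgraph.\<close>

definition walk_in :: "('a, 'a \<times> 'a) pre_digraph \<Rightarrow> 'a \<Rightarrow> 'a list \<Rightarrow> bool" where
  "walk_in T u w \<longleftrightarrow> u \<in> verts T \<and> set (walk G u w) \<subseteq> arcs T"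

lemma no_backtracking_walk: "no_backtracking (cayley_rev G) (walk G u w) \<longleftrightarrow> reduced G w"
proof (induction w arbitrary: u rule: induct_list012)
  case (3 x y zs)
  have split0: "(\<forall>i. P i) \<longleftrightarrow> P 0 \<and> (\<forall>i. P (Suc i))" for P :: "nat \<Rightarrow> bool"
    by (metis not0_implies_Suc)
  have "no_backtracking r (d # e # p) \<longleftrightarrow> e \<noteq> r d \<and> no_backtracking r (e # p)" for r and d e :: "'a \<times> 'a" and p
    unfolding no_backtracking_def
    by (subst split0[of "\<lambda>i. Suc i < length (d # e # p) \<longrightarrow> (d # e # p) ! Suc i \<noteq> r ((d # e # p) ! i)"]) simp
  then show ?case using 3(2)[of "u \<otimes> x"] by (auto simp: cayley_rev_def reduced_def)
qed (auto simp: no_backtracking_def reduced_def)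

end

section \<open>Walks in subgraphs of a Cayley graph\<close>

locale cayley_subgraph = gen_group +
  fixes T :: "('a, 'a \<times> 'a) pre_digraph"
  assumes subgraph: "subgraph T \<Gamma>"
begin

lemma T_simps [simp]: "tail T = fst" "head T e = fst e \<otimes> snd e"
  using subgraph cayley_simps unfolding subgraph_def compatible_def by metis+

lemma T_subset: "verts T \<subseteq> carrier G" "arcs T \<subseteq> carrier G \<times> X"
  using subgraph cayley_simps unfolding subgraph_def by auto

lemma T_closed: "v \<in> verts T \<Longrightarrow> v \<in> carrier G" "(g, a) \<in> arcs T \<Longrightarrow> g \<in> carrier G" "(g, a) \<in> arcs T \<Longrightarrow> a \<in> X"
  using T_subset by auto

lemma wf_T: "wf_digraph T"
  using subgraph unfolding subgraph_def by simp

lemma arc_verts: "(g, a) \<in> arcs T \<Longrightarrow> g \<in> verts T" "(g, a) \<in> arcs T \<Longrightarrow> g \<otimes> a \<in> verts T"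
  using wf_digraph.tail_in_verts[OF wf_T, of "(g, a)"] wf_digraph.head_in_verts[OF wf_T, of "(g, a)"]
  by auto

lemma walk_in_Nil [simp]: "walk_in T u [] \<longleftrightarrow> u \<in> verts T"
  by (simp add: walk_in_def)

lemma walk_in_Cons [simp]: "walk_in T u (a # w) \<longleftrightarrow> (u, a) \<in> arcs T \<and> walk_in T (u \<otimes> a) w"
  using arc_verts by (auto simp: walk_in_def)

lemma walk_in_closed: "walk_in T u w \<Longrightarrow> u \<in> carrier G \<and> w \<in> lists X"
  by (induction w arbitrary: u) (use T_closed in auto)

lemma walk_in_append:
  "walk_in T u (v @ w) \<longleftrightarrow> walk_in T u v \<and> walk_in T (u \<otimes> word_value G v) w"
proof (induction v arbitrary: u)
  case Nil
  show ?case
    by (cases w) (use T_closed arc_verts in \<open>auto simp: walk_in_def\<close>)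
next
  case (Cons a v)
  then show ?case
    using walk_in_closed[of "u \<otimes> a" v] T_closed(2,3)[of u a]
    by (cases "(u, a) \<in> arcs T \<and> walk_in T (u \<otimes> a) v") (auto simp: m_assoc)
qed

lemma awalk_iff:
  "pre_digraph.awalk T u p v \<longleftrightarrow> (\<exists>w. walk_in T u w \<and> p = walk G u w \<and> v = u \<otimes> word_value G w)"
proof -
  interpret wf_digraph T by (rule wf_T)
  show ?thesis
  proof (induction p arbitrary: u)
    case Nil
    show ?case
    proof
      assume "awalk u [] v"
      then show "\<exists>w. walk_in T u w \<and> [] = walk G u w \<and> v = u \<otimes> word_value G w"
        by (intro exI[of _ "[]"]) (auto simp: awalk_Nil_iff T_closed)
    next
      assume "\<exists>w. walk_in T u w \<and> [] = walk G u w \<and> v = u \<otimes> word_value G w"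
      then obtain w where "walk_in T u w" "[] = walk G u w" "v = u \<otimes> word_value G w" by blast
      then show "awalk u [] v" by (cases w) (auto simp: awalk_Nil_iff T_closed)
    qed
  next
    case (Cons e p)
    obtain g a where e: "e = (g, a)" by fastforce
    show ?case
    proof
      assume "awalk u (e # p) v"
      then have "(u, a) \<in> arcs T" "g = u" "awalk (u \<otimes> a) p v" by (auto simp: awalk_Cons_iff e)
      moreover then obtain w where w: "walk_in T (u \<otimes> a) w" "p = walk G (u \<otimes> a) w" "v = u \<otimes> a \<otimes> word_value G w"
        using Cons by auto
      ultimately show "\<exists>w. walk_in T u w \<and> e # p = walk G u w \<and> v = u \<otimes> word_value G w"
        using T_closed walk_in_closed[OF w(1)]
        by (intro exI[of _ "a # w"]) (auto simp: e m_assoc)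
    next
      assume "\<exists>w. walk_in T u w \<and> e # p = walk G u w \<and> v = u \<otimes> word_value G w"
      then obtain w where w: "walk_in T u w" "e # p = walk G u w" "v = u \<otimes> word_value G w" by blast
      then obtain w' where w': "w = a # w'" by (cases w) (auto simp: e)
      with w have "v = u \<otimes> a \<otimes> word_value G w'"
        using walk_in_closed[OF w(1)] by (auto simp: m_assoc)
      then have "awalk (u \<otimes> a) p v" using w w' Cons by auto
      then show "awalk u (e # p) v" using w w' by (auto simp: awalk_Cons_iff)
    qed
  qed
qed

lemma walk_in_inverse:
  assumes rv: "\<And>g a. (g, a) \<in> arcs T \<Longrightarrow> (g \<otimes> a, inv a) \<in> arcs T" and "walk_in T u w"
  shows "walk_in T (u \<otimes> word_value G w) (inverse_word G w)"
  using assms(2)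
proof (induction w arbitrary: u)
  case Nil
  then show ?case by (simp add: T_closed)
next
  case (Cons a w)
  then have c: "u \<in> carrier G" "a \<in> X" "w \<in> lists X" "(u, a) \<in> arcs T"
    using walk_in_closed[of u "a # w"] by auto
  then have w: "w \<in> lists (carrier G)" by auto
  have e: "u \<otimes> a \<otimes> word_value G w \<otimes> inv (word_value G w) = u \<otimes> a"
    using c w by (simp add: m_assoc)
  have "walk_in T (u \<otimes> a \<otimes> word_value G w) (inverse_word G w @ [inv a])"
    using Cons c w e rv[OF c(4)] arc_verts[OF c(4)] arc_verts(2)[OF rv[OF c(4)]]
    by (simp add: walk_in_append m_assoc[symmetric])
  then show ?case using c w by (simp add: m_assoc)
qed

lemma walk_via_root:
  assumes rv: "\<And>g a. (g, a) \<in> arcs T \<Longrightarrow> (g \<otimes> a, inv a) \<in> arcs T"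
    and w: "walk_in T r v" "walk_in T r w"
  shows "\<exists>z. walk_in T (r \<otimes> word_value G v) z \<and> r \<otimes> word_value G w = r \<otimes> word_value G v \<otimes> word_value G z"
proof -
  have c: "r \<in> carrier G" "v \<in> lists X" "w \<in> lists X"
    using walk_in_closed w by auto
  have e: "r \<otimes> word_value G v \<otimes> word_value G (inverse_word G v) = r" using c by simp
  have "walk_in T (r \<otimes> word_value G v) (inverse_word G v @ w)"
    unfolding walk_in_append e using walk_in_inverse[OF rv w(1)] w(2) by simp
  moreover have "r \<otimes> word_value G w = r \<otimes> word_value G v \<otimes> word_value G (inverse_word G v @ w)"
    using e c by (simp add: m_assoc[symmetric])
  ultimately show ?thesis by blast
qed

text \<open>Connectedness is defined through the symmetric closure. A subgraph closed under reversal
  of edges is symmetric, so directed walks decide reachability, and walks from a single root suffice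
  by \<open>walk_via_root\<close>.\<close>

lemma connected_iff:
  assumes rv: "\<And>g a. (g, a) \<in> arcs T \<Longrightarrow> (g \<otimes> a, inv a) \<in> arcs T"
  shows "connected T \<longleftrightarrow> (\<exists>r\<in>verts T. \<forall>v\<in>verts T. \<exists>w. walk_in T r w \<and> v = r \<otimes> word_value G w)"
proof -
  interpret wf_digraph T by (rule wf_T)
  have sym: "symmetric T"
  proof -
    have "(g \<otimes> a, g) \<in> arcs_ends T" if "(g, a) \<in> arcs T" for g a
      unfolding arcs_ends_def arc_to_ends_def
      by (rule image_eqI[OF _ rv[OF that]]) (use T_closed(2,3)[OF that] in \<open>simp add: m_assoc\<close>)
    then show ?thesis unfolding symmetric_def sym_def
      by (auto simp: arcs_ends_def arc_to_ends_def)
  qed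
  have reach: "u \<rightarrow>\<^sup>*\<^bsub>with_proj (mk_symmetric T)\<^esub> v \<longleftrightarrow> (\<exists>w. walk_in T u w \<and> v = u \<otimes> word_value G w)" for u v
    unfolding reachable_mk_symmetric_eq[OF sym] reachable_awalk awalk_iff by blast
  show ?thesis
  proof
    assume "connected T"
    then show "\<exists>r\<in>verts T. \<forall>v\<in>verts T. \<exists>w. walk_in T r w \<and> v = r \<otimes> word_value G w"
      unfolding connected_def strongly_connected_def reach by auto
  next
    assume "\<exists>r\<in>verts T. \<forall>v\<in>verts T. \<exists>w. walk_in T r w \<and> v = r \<otimes> word_value G w"
    then obtain r where r: "r \<in> verts T" "\<And>v. v \<in> verts T \<Longrightarrow> \<exists>w. walk_in T r w \<and> v = r \<otimes> word_value G w"
      by blast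
    have "\<exists>w. walk_in T u w \<and> v = u \<otimes> word_value G w" if "u \<in> verts T" "v \<in> verts T" for u v
      using that r(2) walk_via_root[OF rv] by metis
    then show "connected T"
      unfolding connected_def strongly_connected_def reach using r by auto
  qed
qed

end

section \<open>Reduced walks in trees\<close>

locale cayley_tree = cayley_subgraph +
  assumes tree: "undirected_tree (cayley_rev G) T"
begin

lemma arc_rev: "(g, a) \<in> arcs T \<Longrightarrow> (g \<otimes> a, inv a) \<in> arcs T"
  using tree unfolding undirected_tree_def cayley_rev_def by force

lemma acyclic: "walk_in T u w \<Longrightarrow> reduced G w \<Longrightarrow> u \<otimes> word_value G w = u \<Longrightarrow> w = []"
  using tree walk.simps(1)[of G u] unfolding undirected_tree_def awalk_iff
  by (metis no_backtracking_walk length_0_conv length_walk)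

text \<open>A shortest walk is reduced, as deleting a pair \<open>a, inv a\<close> from its label
  would give a shorter one.\<close>

lemma ex_reduced_walk:
  assumes "u \<in> verts T" "v \<in> verts T"
  shows "\<exists>w. walk_in T u w \<and> reduced G w \<and> u \<otimes> word_value G w = v"
proof -
  obtain r where r: "r \<in> verts T" "\<And>v. v \<in> verts T \<Longrightarrow> \<exists>w. walk_in T r w \<and> v = r \<otimes> word_value G w"
    using tree connected_iff[OF arc_rev] unfolding undirected_tree_def by metis
  then have ex: "\<exists>w. walk_in T u w \<and> u \<otimes> word_value G w = v"
    using assms walk_via_root[OF arc_rev] by metis
  define P where "P = (\<lambda>w. walk_in T u w \<and> u \<otimes> word_value G w = v)"
  obtain w0 where "P w0" using ex unfolding P_def by blast
  from ex_has_least_nat[of P, OF this, of length]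
  obtain w where w: "P w" "\<And>w'. P w' \<Longrightarrow> length w \<le> length w'"
    by blast
  have "reduced G w"
  proof (rule ccontr)
    assume "\<not> reduced G w"
    then obtain p a q where pq: "w = p @ [a, inv a] @ q"
      unfolding reduced_def using not_successively_split[of "\<lambda>a b. b \<noteq> inv a" w] by auto
    have c: "p \<in> lists X" "a \<in> X" "q \<in> lists X" "u \<in> carrier G"
      using w(1) walk_in_closed unfolding P_def pq by fastforce+
    have "P (p @ q)"
      using w(1) c unfolding P_def pq
      by (auto simp: walk_in_append m_assoc[symmetric])
    then show False using w(2) pq by fastforce
  qed
  then show ?thesis using w(1) unfolding P_def by blast
qed

text \<open>Equal last letters are removed. If they differ, the first walk followed by the reverse
  of the second is a nonempty reduced closed walk, which a tree forbids.\<close>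

lemma reduced_walk_unique:
  assumes "walk_in T u v" "walk_in T u w" "reduced G v" "reduced G w"
    "u \<otimes> word_value G v = u \<otimes> word_value G w"
  shows "v = w"
  using assms
proof (induction v arbitrary: w rule: rev_induct)
  case Nil
  then show ?case using acyclic[of u w] walk_in_closed[of u w] by simp
next
  case (snoc a p)
  have c: "u \<in> carrier G" "p \<in> lists X" "a \<in> X" "w \<in> lists X"
    using walk_in_closed snoc.prems by fastforce+
  show ?case
  proof (cases w rule: rev_cases)
    case Nil
    then show ?thesis using acyclic[of u "p @ [a]"] snoc.prems c by simp
  next
    case w: (snoc q b)
    have c': "q \<in> lists X" "b \<in> X" using c w by auto
    show ?thesis
    proof (cases "a = b")
      case True
      then have "u \<otimes> word_value G p = u \<otimes> word_value G q"
        using snoc.prems(5) w c c' by (simp add: m_assoc[symmetric])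
      then have "p = q"
        using snoc.prems(1-4) w by (intro snoc.IH) (auto simp: walk_in_append reduced_def successively_append_iff)
      then show ?thesis using w True by simp
    next
      case False
      let ?z = "(p @ [a]) @ inverse_word G w"
      have "walk_in T (u \<otimes> word_value G (p @ [a])) (inverse_word G w)"
        using walk_in_inverse[OF arc_rev snoc.prems(2)] snoc.prems(5) by simp
      then have 1: "walk_in T u ?z" using snoc.prems(1) by (simp only: walk_in_append)
      have "inv b \<noteq> inv a" using False c c' by (metis X_closed inv_inv)
      then have 2: "reduced G ?z"
        using snoc.prems(3) reduced_inverse_word[OF _ snoc.prems(4)] c c' w
        by (auto simp: reduced_def successively_append_iff)
      have "u \<otimes> word_value G ?z = (u \<otimes> word_value G (p @ [a])) \<otimes> inv (word_value G w)"
        using c by (simp add: m_assoc)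
      also have "\<dots> = u" using snoc.prems(5) c by (simp add: m_assoc)
      finally have "?z = []" using acyclic[OF 1 2] by simp
      then show ?thesis by simp
    qed
  qed
qed

end

section \<open>Trees from prefix-closed normal forms\<close>

definition nf_system :: "('g, 'm) monoid_scheme \<Rightarrow> 'g set \<Rightarrow> ('g \<Rightarrow> 'g list) \<Rightarrow> bool" where
  "nf_system G X nf \<longleftrightarrow>
     (\<forall>g\<in>carrier G. nf g \<in> lists X \<and> word_value G (nf g) = g \<and>
        (\<forall>u a. nf g = u @ [a] \<longrightarrow> nf (word_value G u) = u))"

text \<open>The two clauses are the two orientations of an edge: away from the identity and towards
  it.\<close>

definition nf_arcs :: "('g, 'm) monoid_scheme \<Rightarrow> 'g set \<Rightarrow> ('g \<Rightarrow> 'g list) \<Rightarrow> ('g \<times> 'g) set" where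
  "nf_arcs G X nf =
     {(g, a). g \<in> carrier G \<and> a \<in> X \<and>
        (nf (g \<otimes>\<^bsub>G\<^esub> a) = nf g @ [a] \<or> nf g = nf (g \<otimes>\<^bsub>G\<^esub> a) @ [inv\<^bsub>G\<^esub> a])}"

definition nf_tree :: "('g, 'm) monoid_scheme \<Rightarrow> 'g set \<Rightarrow> ('g \<Rightarrow> 'g list) \<Rightarrow> ('g, 'g \<times> 'g) pre_digraph" where
  "nf_tree G X nf = \<lparr>verts = carrier G, arcs = nf_arcs G X nf, tail = fst, head = (\<lambda>(g, a). g \<otimes>\<^bsub>G\<^esub> a)\<rparr>"

lemma nf_systemD:
  assumes "nf_system G X nf" "g \<in> carrier G"
  shows "nf g \<in> lists X" "word_value G (nf g) = g" "nf g = u @ [a] \<Longrightarrow> nf (word_value G u) = u"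
  using assms unfolding nf_system_def by auto

lemma nf_tree_simps [simp]: "verts (nf_tree G X nf) = carrier G" "arcs (nf_tree G X nf) = nf_arcs G X nf"
  by (simp_all add: nf_tree_def)

context gen_group begin

text \<open>The empty word is a prefix of \<open>nf \<one>\<close>, hence a normal form itself, and
  it represents \<open>\<one>\<close>.\<close>

lemma nf_one: assumes "nf_system G X nf" shows "nf \<one> = []"
proof -
  have *: "nf (word_value G u) = u" if "g \<in> carrier G" "nf g = u @ v" for u v g
    using that
  proof (induction v arbitrary: g rule: rev_induct)
    case Nil
    then show ?case using nf_systemD(2)[OF assms] by fastforce
  next
    case (snoc a v)
    have "u @ v \<in> lists X" using nf_systemD(1)[OF assms, of g] snoc.prems by simp
    then have "word_value G (u @ v) \<in> carrier G" by (intro word_value_closed) simp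
    moreover have "nf (word_value G (u @ v)) = u @ v"
      using nf_systemD(3)[OF assms, of g "u @ v" a] snoc.prems by simp
    ultimately show ?case using snoc.IH by blast
  qed
  show ?thesis using *[of \<one> "[]" "nf \<one>"] by simp
qed

lemma cayley_subgraph_nf_tree: "cayley_subgraph G X (nf_tree G X nf)"
proof unfold_locales
  have "wf_digraph (nf_tree G X nf)"
    by unfold_locales (auto simp: nf_tree_def nf_arcs_def)
  then show "subgraph (nf_tree G X nf) \<Gamma>"
    using wf_cayley unfolding subgraph_def compatible_def
    by (auto simp: nf_tree_def nf_arcs_def fun_eq_iff)
qed

end

text \<open>Along a tree edge \<open>(g, a)\<close> either \<open>nf g @ [a]\<close> is reduced, and
  uniqueness makes it the normal form of \<open>g \<otimes> a\<close>, or \<open>nf g\<close> ends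
  in \<open>inv a\<close> and the remaining prefix is the normal form of
  \<open>g \<otimes> a\<close>. This serves for a given maximal tree and, in
  \<open>maximal_nf_tree\<close>, for a hypothetical larger tree.\<close>

lemma (in cayley_tree) arcs_subset_nf_arcs:
  assumes nf: "nf_system G X nf"
    and walk: "\<And>g. g \<in> carrier G \<Longrightarrow> walk_in T \<one> (nf g) \<and> reduced G (nf g)"
  shows "arcs T \<subseteq> nf_arcs G X nf"
proof safe
  fix g a assume ga: "(g, a) \<in> arcs T"
  have c: "g \<in> carrier G" "a \<in> X" using T_closed(2,3)[OF ga] by auto
  note g = nf_systemD[OF nf c(1)]
  show "(g, a) \<in> nf_arcs G X nf"
  proof (cases "reduced G (nf g @ [a])")
    case True
    have "nf (g \<otimes> a) = nf g @ [a]"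
      using c walk[OF c(1)] walk[of "g \<otimes> a"] ga g nf_systemD[OF nf, of "g \<otimes> a"] arc_verts(2)[OF ga] True
      by (intro reduced_walk_unique[of \<one>]) (auto simp: walk_in_append)
    then show ?thesis using c by (simp add: nf_arcs_def)
  next
    case False
    then obtain u where u: "nf g = u @ [inv a]"
      using walk[OF c(1)] g(1) by (cases "nf g" rule: rev_cases) (auto simp: reduced_def successively_append_iff)
    then have uX: "u \<in> lists X" using g(1) by simp
    have "word_value G u \<otimes> inv a = g" using g(2) u uX c by simp
    then have "word_value G u = g \<otimes> a" using uX c by auto
    then show ?thesis using g(3)[OF u] u c by (simp add: nf_arcs_def)
  qed
qed

locale nf_group = gen_group + fixes nf assumes nf: "nf_system G X nf"
begin

sublocale T: cayley_subgraph G X "nf_tree G X nf"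
  by (rule cayley_subgraph_nf_tree)

lemma nf_arc_rev: "(g, a) \<in> nf_arcs G X nf \<Longrightarrow> (g \<otimes> a, inv a) \<in> nf_arcs G X nf"
  by (auto simp: nf_arcs_def)

lemma nf_induct [consumes 1, case_names one snoc]:
  assumes "g \<in> carrier G" and "P \<one>"
    and step: "\<And>h a. h \<in> carrier G \<Longrightarrow> a \<in> X \<Longrightarrow> nf (h \<otimes> a) = nf h @ [a] \<Longrightarrow> P h \<Longrightarrow> P (h \<otimes> a)"
  shows "P g"
  using assms(1)
proof (induction "length (nf g)" arbitrary: g)
  case 0
  then show ?case using nf_systemD(2)[OF nf] assms(2) by fastforce
next
  case (Suc n)
  then obtain u a where ua: "nf g = u @ [a]" by (metis length_Suc_conv_rev)
  have c: "u \<in> lists X" "a \<in> X" using nf_systemD(1)[OF nf Suc.prems] ua by auto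
  have u: "nf (word_value G u) = u" using nf_systemD(3)[OF nf Suc.prems ua] .
  have g: "word_value G u \<otimes> a = g" using nf_systemD(2)[OF nf Suc.prems] ua c by simp
  have "P (word_value G u)" using Suc.hyps(1)[of "word_value G u"] Suc.hyps(2) ua u c by simp
  then show ?case using step[of "word_value G u" a] g u ua c by simp
qed

lemma nf_prefix_walk: "g \<in> carrier G \<Longrightarrow> walk_in (nf_tree G X nf) \<one> (nf g)"
  by (induction g rule: nf_induct)
    (simp_all add: nf_one[OF nf] T.walk_in_append nf_systemD(2)[OF nf] nf_arcs_def)

text \<open>The first edge cannot lead back towards the identity, since \<open>nf g\<close> would
  then end in the inverse of its label. So normal forms only grow along the walk.\<close>

lemma nf_continue:
  assumes "walk_in (nf_tree G X nf) g w" "reduced G (nf g @ w)"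
  shows "nf (g \<otimes> word_value G w) = nf g @ w"
  using assms
proof (induction w arbitrary: g)
  case Nil
  then show ?case by simp
next
  case (Cons a w)
  have c: "g \<in> carrier G" "a \<in> X" "w \<in> lists X" using T.walk_in_closed[OF Cons.prems(1)] by auto
  have "nf (g \<otimes> a) = nf g @ [a]"
  proof (rule ccontr)
    assume "nf (g \<otimes> a) \<noteq> nf g @ [a]"
    then have "nf g = nf (g \<otimes> a) @ [inv a]" using Cons.prems(1) by (auto simp: nf_arcs_def)
    then show False using Cons.prems(2) c by (simp add: reduced_def successively_append_iff)
  qed
  then show ?case using Cons.IH[of "g \<otimes> a"] Cons.prems c by (simp add: m_assoc)
qed

text \<open>Reducedness comes from prefix-closure: if \<open>nf h\<close> ended in \<open>b\<close>
  and \<open>a = inv b\<close>, then \<open>h \<otimes> a\<close> would have a proper prefix of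
  \<open>nf h\<close> as its normal form instead of an extension.\<close>

lemma nf_reduced: "g \<in> carrier G \<Longrightarrow> reduced G (nf g)"
proof (induction g rule: nf_induct)
  case (snoc h a)
  have "a \<noteq> inv b" if vb: "nf h = v @ [b]" for v b
  proof
    assume a: "a = inv b"
    have c: "v \<in> lists X" "b \<in> X" using nf_systemD(1)[OF nf snoc.hyps(1)] vb by auto
    have "word_value G v = h \<otimes> a" using nf_systemD(2)[OF nf snoc.hyps(1)] vb c a by auto
    then show False using nf_systemD(3)[OF nf snoc.hyps(1) vb] snoc.hyps(3) vb by simp
  qed
  then show ?case using snoc by (cases "nf h" rule: rev_cases) (auto simp: reduced_def successively_append_iff)
qed (simp add: nf_one[OF nf] reduced_def)

text \<open>A nonempty reduced closed walk cannot continue the normal form of its base point, so its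
  first letter cancels the last letter of that normal form. The same holds for the reversed walk.
  Hence the first and last letters are mutually inverse, and removing both leaves a shorter closed
  walk.\<close>

lemma nf_tree_acyclic:
  "walk_in (nf_tree G X nf) u w \<Longrightarrow> reduced G w \<Longrightarrow> u \<otimes> word_value G w = u \<Longrightarrow> w = []"
proof (induction "length w" arbitrary: u w rule: less_induct)
  case less
  let ?T = "nf_tree G X nf"
  have c: "u \<in> carrier G" "w \<in> lists X" using T.walk_in_closed[OF less.prems(1)] by auto
  show ?case
  proof (rule ccontr)
    assume ne: "w \<noteq> []"
    have up: "\<exists>v. nf u = v @ [inv (hd z)]" if z: "walk_in ?T u z" "reduced G z" "u \<otimes> word_value G z = u" "z \<noteq> []" for z
    proof -
      have cz: "z \<in> lists X" using T.walk_in_closed[OF z(1)] by auto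
      obtain a z' where az: "z = a # z'" using z(4) by (cases z) auto
      have "\<not> reduced G (nf u @ z)" using nf_continue[OF z(1)] z(3,4) by auto
      then have "nf u \<noteq> []" "a = inv (last (nf u))"
        using nf_reduced[OF c(1)] z(2) by (auto simp: reduced_def successively_append_iff az)
      then show ?thesis
        using nf_systemD(1)[OF nf c(1)] by (intro exI[of _ "butlast (nf u)"]) (auto simp: az in_lists_conv_set)
    qed
    have e: "u \<otimes> inv (word_value G w) = u" using less.prems(3) c by (metis inv_cancel_right(1) lists_X_carrier word_value_closed)
    have "walk_in ?T u (inverse_word G w)" "reduced G (inverse_word G w)" "inverse_word G w \<noteq> []"
      using T.walk_in_inverse[OF _ less.prems(1)] nf_arc_rev less.prems reduced_inverse_word[OF _ less.prems(2)] c ne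
      by (auto simp: inverse_word_def)
    then obtain v' where v': "nf u = v' @ [inv (hd (inverse_word G w))]" using up[of "inverse_word G w"] e c(2) by auto
    obtain v where v: "nf u = v @ [inv (hd w)]" using up less.prems ne by blast
    have "hd (inverse_word G w) = inv (last w)"
      using ne by (simp add: inverse_word_def hd_rev last_map)
    then have l: "last w = inv (hd w)"
      using v v' ne c by (auto simp: in_lists_conv_set)
    obtain a w1 where aw: "w = a # w1" using ne by (cases w) auto
    have a: "a \<in> X" "w1 \<in> lists X" using c aw by auto
    \<comment> \<open>Otherwise the walk consists of one loop, and no loop satisfies
      \<open>nf_arcs\<close>.\<close>
    have "w1 \<noteq> []"
    proof
      assume "w1 = []"
      then have "a = inv a" "(u, a) \<in> nf_arcs G X nf" "u \<otimes> a = u"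
        using l less.prems aw a by auto
      then show False by (auto simp: nf_arcs_def)
    qed
    then obtain w2 where w: "w = a # w2 @ [inv a]" using l aw by (metis append_butlast_last_id last_ConsR list.sel(1))
    have w2: "w2 \<in> lists X" using c w by auto
    have "walk_in ?T (u \<otimes> a) w2" using less.prems(1) w by (simp add: T.walk_in_append)
    moreover have "reduced G w2" using less.prems(2) w
      by (cases w2) (auto simp: reduced_def successively_append_iff successively_Cons)
    moreover have "u \<otimes> a \<otimes> word_value G w2 = u \<otimes> a"
    proof -
      have "u \<otimes> a \<otimes> word_value G w2 \<otimes> inv a = u" using less.prems(3) w w2 a c by (simp add: m_assoc)
      then have "u \<otimes> a \<otimes> word_value G w2 \<otimes> inv a \<otimes> a = u \<otimes> a" by simp
      then show ?thesis using w2 a c by (simp del: inv_cancel_right(1))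
    qed
    ultimately have "w2 = []" using less.hyps[of w2 "u \<otimes> a"] w by simp
    then show False using less.prems(2) w by (simp add: reduced_def)
  qed
qed

sublocale T: cayley_tree G X "nf_tree G X nf"
proof unfold_locales
  let ?T = "nf_tree G X nf"
  have "connected ?T"
  proof (subst T.connected_iff)
    have "walk_in ?T \<one> (nf v) \<and> v = \<one> \<otimes> word_value G (nf v)" if "v \<in> carrier G" for v
      using nf_prefix_walk nf_systemD(2)[OF nf] that by simp
    then show "\<exists>r\<in>verts ?T. \<forall>v\<in>verts ?T. \<exists>w. walk_in ?T r w \<and> v = r \<otimes> word_value G w"
      by (intro bexI[of _ \<one>]) auto
  qed (simp add: nf_arc_rev)
  moreover have "\<not> (\<exists>u p. pre_digraph.awalk ?T u p u \<and> p \<noteq> [] \<and> no_backtracking (cayley_rev G) p)"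
    using nf_tree_acyclic unfolding T.awalk_iff
    by (metis no_backtracking_walk walk.simps(1))
  ultimately show "undirected_tree (cayley_rev G) ?T"
    unfolding undirected_tree_def by (auto simp: nf_arc_rev cayley_rev_def)
qed

text \<open>A larger tree has the same vertices and still contains the walks \<open>nf g\<close>, so
  its edges satisfy \<open>nf_arcs\<close> as well.\<close>

lemma maximal_nf_tree: "maximal_tree G X (nf_tree G X nf)"
proof -
  let ?T = "nf_tree G X nf"
  have "T' = ?T" if T': "subgraph ?T T'" "subgraph T' \<Gamma>" "undirected_tree (cayley_rev G) T'" for T' :: "('a, 'a \<times> 'a) pre_digraph"
  proof -
    interpret T': cayley_tree G X T' using T' by unfold_locales
    have v: "verts T' = carrier G" using T'(1) T'.T_subset by (auto simp: subgraph_def)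
    have sub: "arcs ?T \<subseteq> arcs T'" using T'(1) by (simp add: subgraph_def)
    have w: "walk_in T' \<one> (nf g)" if "g \<in> carrier G" for g
      using nf_prefix_walk[OF that] sub v unfolding walk_in_def by auto
    have "arcs T' \<subseteq> nf_arcs G X nf"
      using w nf_reduced by (intro T'.arcs_subset_nf_arcs nf) auto
    then have "arcs T' = arcs ?T" using sub by auto
    moreover have "head T' = head ?T" by (auto simp: nf_tree_def fun_eq_iff)
    ultimately show ?thesis using v by (intro pre_digraph.equality) (auto simp: nf_tree_def)
  qed
  then show ?thesis
    unfolding maximal_tree_def pre_digraph.max_subgraph_def using T.subgraph T.tree by blast
qed

end

section \<open>Normal forms from maximal trees\<close>

locale maximal_cayley_tree = gen_group +
  fixes T :: "('a, 'a \<times> 'a) pre_digraph"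
  assumes maximal: "maximal_tree G X T"
begin

sublocale cayley_tree
  using maximal unfolding maximal_tree_def pre_digraph.max_subgraph_def by unfold_locales auto

text \<open>A vertex outside of a maximal tree but adjacent to it could be attached as a leaf.\<close>

lemma leaf_not_addable:
  assumes h: "h \<in> verts T" and a: "a \<in> X"
  shows "h \<otimes> a \<in> verts T"
proof (rule ccontr)
  let ?k = "h \<otimes> a"
  assume k: "?k \<notin> verts T"
  define T' where "T' = \<lparr>verts = insert ?k (verts T), arcs = insert (h, a) (insert (?k, inv a) (arcs T)),
    tail = tail T, head = head T\<rparr>"
  have hc: "h \<in> carrier G" "a \<in> carrier G" using h a T_closed by auto
  have "wf_digraph T'"
    by unfold_locales (use h hc arc_verts in \<open>auto simp: T'_def\<close>)
  then have sub: "subgraph T T'" "subgraph T' \<Gamma>"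
    using subgraph h a hc wf_T T_closed by (auto simp: subgraph_def compatible_def T'_def)
  interpret T': cayley_subgraph G X T' by unfold_locales (rule sub)
  have arcs_k: "c = inv a" if "(?k, c) \<in> arcs T'" for c
    using that k arc_verts(1) h by (auto simp: T'_def)
  have arcs_T: "(u, c) \<in> arcs T \<or> (u = h \<and> c = a)" if "(u, c) \<in> arcs T'" "u \<in> verts T" for u c
    using that k by (auto simp: T'_def)
  \<comment> \<open>A reduced walk between old vertices stays in \<open>T\<close>: the new leaf can
    be left only along the edge on which it was entered.\<close>
  have inside: "walk_in T u w"
    if "walk_in T' u w" "reduced G w" "u \<in> verts T" "u \<otimes> word_value G w \<in> verts T" for u w
    using that
  proof (induction w arbitrary: u)
    case Nil
    then show ?case by simp
  next
    case (Cons b w)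
    have c: "u \<in> carrier G" "b \<in> X" "w \<in> lists X" using T'.walk_in_closed[OF Cons.prems(1)] by auto
    have "(u, b) \<in> arcs T"
    proof (rule ccontr)
      assume "(u, b) \<notin> arcs T"
      then have ub: "u = h" "b = a" using arcs_T[of u b] Cons.prems by auto
      then obtain d w' where w: "w = d # w'" using Cons.prems(4) k hc by (cases w) auto
      then have "d = inv a" using Cons.prems(1) ub arcs_k by auto
      then show False using Cons.prems(2) w ub by (simp add: reduced_def)
    qed
    moreover have "walk_in T (u \<otimes> b) w"
      using Cons.prems c arc_verts(2)[OF calculation]
      by (intro Cons.IH) (auto simp: reduced_def successively_Cons m_assoc)
    ultimately show ?case by simp
  qed
  have rv: "(g \<otimes> c, inv c) \<in> arcs T'" if "(g, c) \<in> arcs T'" for g c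
    using that arc_rev hc by (auto simp: T'_def)
  have "\<not> (\<exists>u p. pre_digraph.awalk T' u p u \<and> p \<noteq> [] \<and> no_backtracking (cayley_rev G) p)"
  proof
    assume "\<exists>u p. pre_digraph.awalk T' u p u \<and> p \<noteq> [] \<and> no_backtracking (cayley_rev G) p"
    then obtain u w where w: "walk_in T' u w" "w \<noteq> []" "reduced G w" "u = u \<otimes> word_value G w"
      unfolding T'.awalk_iff by (metis no_backtracking_walk walk.simps(1))
    have c: "u \<in> carrier G" "w \<in> lists X" using T'.walk_in_closed[OF w(1)] by auto
    show False
    proof (cases "u \<in> verts T")
      case True
      then show False using inside[OF w(1,3)] w acyclic by auto
    next
      \<comment> \<open>A closed walk based at the new leaf starts with \<open>inv a\<close> and has
        to end with \<open>a\<close>. Between them lies a reduced closed walk at \<open>h\<close>,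
        which is empty, and \<open>[inv a, a]\<close> is not reduced.\<close>
      case False
      then have u: "u = ?k" using w(1) by (auto simp: walk_in_def T'_def)
      obtain b w1 where bw: "w = b # w1" using w(2) by (cases w) auto
      have b: "b = inv a" using w(1) bw u arcs_k by auto
      have w1c: "w1 \<in> lists X" "walk_in T' h w1" using w(1) bw u b c hc by auto
      have hw1: "h \<otimes> word_value G w1 = ?k"
        using w(4) u b bw hc w1c by (simp add: m_assoc[symmetric])
      obtain v d where vd: "w1 = v @ [d]"
        using hw1 hc k h by (cases w1 rule: rev_cases) auto
      have vc: "v \<in> lists X" "d \<in> X" using w1c vd by auto
      have arc: "(h \<otimes> word_value G v, d) \<in> arcs T'" "walk_in T' h v"
        using w1c(2) vd by (auto simp: T'.walk_in_append)
      have "h \<otimes> word_value G v \<otimes> d = ?k" using hw1 vd vc hc by (simp add: m_assoc)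
      then have d: "h \<otimes> word_value G v = h" "d = a"
        using arc(1) k arc_verts(2)[of "h \<otimes> word_value G v" d] h hc by (auto simp: T'_def)
      have "reduced G v" using w(3) bw vd
        by (cases v) (auto simp: reduced_def successively_append_iff successively_Cons)
      then have "v = []" using inside[OF arc(2)] h d acyclic by auto
      then show False using w(3) bw vd b d hc by (simp add: reduced_def)
    qed
  qed
  moreover have "connected T'"
  proof (subst T'.connected_iff)
    have "\<exists>w. walk_in T' h w \<and> v = h \<otimes> word_value G w" if "v \<in> verts T'" for v
    proof (cases "v = ?k")
      case True
      moreover have "walk_in T' h [a]" using h hc by (simp add: walk_in_def T'_def)
      ultimately show ?thesis using hc by (intro exI[of _ "[a]"]) simp
    next
      case False
      then have "v \<in> verts T" using that by (simp add: T'_def)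
      then obtain w where "walk_in T h w" "h \<otimes> word_value G w = v" using ex_reduced_walk h by blast
      then show ?thesis by (intro exI[of _ w]) (auto simp: walk_in_def T'_def)
    qed
    then show "\<exists>r\<in>verts T'. \<forall>v\<in>verts T'. \<exists>w. walk_in T' r w \<and> v = r \<otimes> word_value G w"
      by (intro bexI[of _ h]) (use h in \<open>auto simp: T'_def\<close>)
  qed (rule rv)
  ultimately have "undirected_tree (cayley_rev G) T'"
    unfolding undirected_tree_def using rv by (auto simp: cayley_rev_def)
  moreover have "verts T' \<noteq> verts T" using k by (auto simp: T'_def)
  then have "T' \<noteq> T" by blast
  ultimately show False
    using maximal sub unfolding maximal_tree_def pre_digraph.max_subgraph_def by blast
qed

text \<open>By \<open>leaf_not_addable\<close> a vertex of the tree can be multiplied by generators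
  without leaving the tree.\<close>

lemma spanning: "verts T = carrier G"
proof
  show "verts T \<subseteq> carrier G" using T_subset by simp
  obtain r where r: "r \<in> verts T"
    using tree connected_iff[OF arc_rev] unfolding undirected_tree_def by blast
  have in_T: "r \<otimes> word_value G w \<in> verts T" if "w \<in> lists X" for w
    using that
  proof (induction w rule: rev_induct)
    case (snoc a w)
    then show ?case using leaf_not_addable[of "r \<otimes> word_value G w" a] r T_closed(1)
      by (simp add: m_assoc)
  qed (use r T_closed in simp)
  show "carrier G \<subseteq> verts T"
  proof
    fix g assume g: "g \<in> carrier G"
    have rc: "r \<in> carrier G" using r T_closed by simp
    obtain w where "w \<in> lists X" "word_value G w = inv r \<otimes> g" using ex_word[of "inv r \<otimes> g"] rc g by auto
    then show "g \<in> verts T" using in_T[of w] rc g by (simp add: m_assoc[symmetric])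
  qed
qed

lemma tree_nf_eqI:
  assumes "walk_in T \<one> w" "reduced G w" shows "tree_nf G T (word_value G w) = w"
proof -
  have "(THE p. pre_digraph.awalk T \<one> p (word_value G w) \<and> no_backtracking (cayley_rev G) p) = walk G \<one> w"
    unfolding awalk_iff
  proof (rule the_equality)
    show "(\<exists>v. walk_in T \<one> v \<and> walk G \<one> w = walk G \<one> v \<and> word_value G w = \<one> \<otimes> word_value G v) \<and>
        no_backtracking (cayley_rev G) (walk G \<one> w)"
      using assms walk_in_closed[OF assms(1)] by (auto simp: no_backtracking_walk intro!: exI[of _ w])
  next
    fix p assume "(\<exists>v. walk_in T \<one> v \<and> p = walk G \<one> v \<and> word_value G w = \<one> \<otimes> word_value G v) \<and>
        no_backtracking (cayley_rev G) p"
    then obtain v where v: "walk_in T \<one> v" "p = walk G \<one> v" "word_value G w = \<one> \<otimes> word_value G v" "reduced G v"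
      by (auto simp: no_backtracking_walk)
    have "v = w"
      using v assms walk_in_closed[OF v(1)] by (intro reduced_walk_unique[of \<one>]) simp_all
    then show "p = walk G \<one> w" using v by simp
  qed
  then show ?thesis by (simp add: tree_nf_def)
qed

lemma tree_nf_walk:
  assumes "g \<in> carrier G"
  shows "walk_in T \<one> (tree_nf G T g)" "reduced G (tree_nf G T g)" "word_value G (tree_nf G T g) = g"
    "tree_nf G T g \<in> lists X"
proof -
  obtain w where w: "walk_in T \<one> w" "reduced G w" "\<one> \<otimes> word_value G w = g"
    using ex_reduced_walk[of \<one> g] spanning assms by auto
  then have "word_value G w = g" using walk_in_closed[OF w(1)] by simp
  with tree_nf_eqI[OF w(1,2)] have "tree_nf G T g = w" by simp
  then show "walk_in T \<one> (tree_nf G T g)" "reduced G (tree_nf G T g)" "word_value G (tree_nf G T g) = g"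
    "tree_nf G T g \<in> lists X"
    using w \<open>word_value G w = g\<close> walk_in_closed[OF w(1)] by auto
qed

lemma nf_system_tree_nf: "nf_system G X (tree_nf G T)"
  unfolding nf_system_def
proof (intro ballI conjI allI impI)
  fix g u a assume g: "g \<in> carrier G" "tree_nf G T g = u @ [a]"
  show "tree_nf G T (word_value G u) = u"
    using tree_nf_walk[OF g(1)] g(2)
    by (intro tree_nf_eqI) (auto simp: walk_in_append reduced_def successively_append_iff)
qed (use tree_nf_walk in auto)

lemma arcs_eq_nf_arcs: "arcs T = nf_arcs G X (tree_nf G T)"
proof
  show "nf_arcs G X (tree_nf G T) \<subseteq> arcs T"
  proof safe
    fix g a assume "(g, a) \<in> nf_arcs G X (tree_nf G T)"
    then have ga: "g \<in> carrier G" "a \<in> X"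
      "tree_nf G T (g \<otimes> a) = tree_nf G T g @ [a] \<or> tree_nf G T g = tree_nf G T (g \<otimes> a) @ [inv a]"
      by (auto simp: nf_arcs_def)
    from ga(3) show "(g, a) \<in> arcs T"
    proof
      assume "tree_nf G T (g \<otimes> a) = tree_nf G T g @ [a]"
      then show ?thesis using tree_nf_walk[OF ga(1)] tree_nf_walk(1)[of "g \<otimes> a"] ga
        by (simp add: walk_in_append)
    next
      assume "tree_nf G T g = tree_nf G T (g \<otimes> a) @ [inv a]"
      then have "(g \<otimes> a, inv a) \<in> arcs T"
        using tree_nf_walk(1)[OF ga(1)] tree_nf_walk(3)[of "g \<otimes> a"] ga
        by (simp add: walk_in_append)
      then show ?thesis using arc_rev[of "g \<otimes> a" "inv a"] ga by simp
    qed
  qed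
  show "arcs T \<subseteq> nf_arcs G X (tree_nf G T)"
    using tree_nf_walk nf_system_tree_nf by (intro arcs_subset_nf_arcs) auto
qed

end

lemma (in nf_group) tree_nf_nf_tree:
  assumes "g \<in> carrier G" shows "tree_nf G (nf_tree G X nf) g = nf g"
proof -
  interpret maximal_cayley_tree G X "nf_tree G X nf" by unfold_locales (rule maximal_nf_tree)
  show ?thesis
    using tree_nf_eqI[OF nf_prefix_walk nf_reduced, OF assms assms] nf_systemD(2)[OF nf assms] by simp
qed

section \<open>Flow functions as systems of words\<close>

definition word_flow_less ::
    "('g, 'm) monoid_scheme \<Rightarrow> 'g set \<Rightarrow> ('g \<Rightarrow> 'g list) \<Rightarrow> ('g \<Rightarrow> 'g \<Rightarrow> 'g list) \<Rightarrow> (('g \<times> 'g) \<times> 'g \<times> 'g) set" where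
  "word_flow_less G X nf \<phi> =
     {(e', (g, a)). g \<in> carrier G \<and> a \<in> X \<and> e' \<in> set (walk G g (\<phi> g a)) \<and>
        (g, a) \<notin> nf_arcs G X nf \<and> e' \<notin> nf_arcs G X nf}"

text \<open>The clause on \<open>word_value\<close> is (F1): the walk from \<open>g\<close> labelled
  \<open>\<phi> g a\<close> ends in \<open>g \<otimes> a\<close>. Well-foundedness of the one-step
  relation passes to its transitive closure, which is then irreflexive.\<close>

definition word_flow :: "('g, 'm) monoid_scheme \<Rightarrow> 'g set \<Rightarrow> ('g \<Rightarrow> 'g list) \<Rightarrow> ('g \<Rightarrow> 'g \<Rightarrow> 'g list) \<Rightarrow> bool" where
  "word_flow G X nf \<phi> \<longleftrightarrow> nf_system G X nf \<and>
     (\<forall>g\<in>carrier G. \<forall>a\<in>X. \<phi> g a \<in> lists X \<and> word_value G (\<phi> g a) = a \<and>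
        ((g, a) \<in> nf_arcs G X nf \<longrightarrow> \<phi> g a = [a])) \<and>
     wf (word_flow_less G X nf \<phi>) \<and> (\<exists>k. \<forall>g\<in>carrier G. \<forall>a\<in>X. length (\<phi> g a) \<le> k)"

context gen_group begin

lemma cayley_subgraph_refl: "cayley_subgraph G X \<Gamma>"
  by unfold_locales (rule wf_digraph.subgraph_refl[OF wf_cayley])

lemma walk_in_cayley: "walk_in \<Gamma> u w \<longleftrightarrow> u \<in> carrier G \<and> w \<in> lists X"
proof (induction w arbitrary: u)
  case (Cons a w)
  have "u \<in> carrier G \<Longrightarrow> a \<in> X \<Longrightarrow> u \<otimes> a \<in> carrier G" by simp
  then show ?case using Cons.IH[of "u \<otimes> a"]
    unfolding walk_in_def by (cases "u \<in> carrier G \<and> a \<in> X") auto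
next
  case Nil
  show ?case by (simp add: walk_in_def)
qed

lemma set_walk: "u \<in> carrier G \<Longrightarrow> w \<in> lists X \<Longrightarrow> set (walk G u w) \<subseteq> carrier G \<times> X"
  using walk_in_cayley[of u w] by (simp add: walk_in_def)

text \<open>From here on trees and paths are replaced by words. One direction uses that a maximal
  tree spans, so that every element has a normal form; the other that the tree of a system of normal
  forms is maximal and returns these normal forms.\<close>

lemma algorithmically_stackable_over_iff:
  "algorithmically_stackable_over G X \<longleftrightarrow>
     (\<exists>nf \<phi>. word_flow G X nf \<phi> \<and> decidable_rel 3 X {[nf g, [a], \<phi> g a] | g a. g \<in> carrier G \<and> a \<in> X})"
  (is "_ \<longleftrightarrow> ?R")
proof -
  interpret C: cayley_subgraph G X \<Gamma> by (rule cayley_subgraph_refl)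
  have awalk: "pre_digraph.awalk \<Gamma> g p (g \<otimes> a) \<longleftrightarrow>
      (\<exists>w\<in>lists X. p = walk G g w \<and> word_value G w = a)" if "g \<in> carrier G" "a \<in> X" for g p a
    unfolding C.awalk_iff walk_in_cayley using that by auto
  show ?thesis
  proof
    assume "algorithmically_stackable_over G X"
    then obtain T \<Phi> where T: "maximal_tree G X T" and F: "flow_function \<Gamma> T \<Phi>"
      and b: "bounded_flow \<Gamma> \<Phi>" and d: "decidable_rel 3 X (stacking_graph G X T \<Phi>)"
      unfolding algorithmically_stackable_over_def by blast
    interpret maximal_cayley_tree G X T by unfold_locales (rule T)
    define nf where "nf = tree_nf G T"
    define \<phi> where "\<phi> g a = path_label (\<Phi> (g, a))" for g a
    have aT: "arcs T = nf_arcs G X nf" unfolding nf_def by (rule arcs_eq_nf_arcs)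
    have \<Phi>: "\<phi> g a \<in> lists X \<and> word_value G (\<phi> g a) = a \<and> \<Phi> (g, a) = walk G g (\<phi> g a)"
      if "g \<in> carrier G" "a \<in> X" for g a
    proof -
      have "pre_digraph.awalk \<Gamma> g (\<Phi> (g, a)) (g \<otimes> a)"
        using F that unfolding flow_function_def by fastforce
      then show ?thesis unfolding awalk[OF that] \<phi>_def by auto
    qed
    have tree: "\<phi> g a = [a]" if "(g, a) \<in> nf_arcs G X nf" for g a
      using F that aT unfolding flow_function_def by (auto simp: \<phi>_def path_label_def)
    have "word_flow_less G X nf \<phi> \<subseteq> (flow_less \<Gamma> T \<Phi>)\<^sup>+"
      using \<Phi> aT set_walk unfolding word_flow_less_def flow_less_def by (fastforce intro!: r_into_trancl)
    then have "wf (word_flow_less G X nf \<phi>)"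
      using F unfolding flow_function_def by (metis wf_subset)
    moreover have "\<exists>k. \<forall>g\<in>carrier G. \<forall>a\<in>X. length (\<phi> g a) \<le> k"
      using b unfolding bounded_flow_def \<phi>_def path_label_def by auto
    ultimately have "word_flow G X nf \<phi>"
      unfolding word_flow_def using nf_system_tree_nf \<Phi> tree by (auto simp: nf_def)
    then show ?R using d unfolding stacking_graph_def nf_def \<phi>_def by blast
  next
    assume ?R
    then obtain nf \<phi> where wf: "word_flow G X nf \<phi>"
      and d: "decidable_rel 3 X {[nf g, [a], \<phi> g a] | g a. g \<in> carrier G \<and> a \<in> X}" by blast
    interpret nf_group G X nf using wf unfolding word_flow_def by unfold_locales simp
    define \<Phi> where "\<Phi> e = walk G (fst e) (\<phi> (fst e) (snd e))" for e
    have \<phi>: "\<phi> g a \<in> lists X" "word_value G (\<phi> g a) = a" "(g, a) \<in> nf_arcs G X nf \<Longrightarrow> \<phi> g a = [a]"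
      if "g \<in> carrier G" "a \<in> X" for g a
      using wf that unfolding word_flow_def by auto
    have less: "flow_less \<Gamma> (nf_tree G X nf) \<Phi> = word_flow_less G X nf \<phi>"
      using set_walk[OF _ \<phi>(1)] unfolding flow_less_def word_flow_less_def \<Phi>_def by auto
    have "wf ((word_flow_less G X nf \<phi>)\<^sup>+)" using wf wf_trancl unfolding word_flow_def by blast
    then have "flow_function \<Gamma> (nf_tree G X nf) \<Phi>"
      unfolding flow_function_def less using \<phi> awalk wf_irrefl
      by (auto simp: \<Phi>_def nf_arcs_def irrefl_def intro: trans_trancl)
    moreover have "bounded_flow \<Gamma> \<Phi>"
      using wf unfolding bounded_flow_def word_flow_def \<Phi>_def by auto
    moreover have "stacking_graph G X (nf_tree G X nf) \<Phi> = {[nf g, [a], \<phi> g a] | g a. g \<in> carrier G \<and> a \<in> X}"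
      unfolding stacking_graph_def \<Phi>_def using tree_nf_nf_tree by (auto; metis)
    ultimately show "algorithmically_stackable_over G X"
      unfolding algorithmically_stackable_over_def using maximal_nf_tree d by metis
  qed
qed

end

section \<open>Normal forms in HNN extensions\<close>

lemma gwords_simps [simp]: "[] \<in> gwords S" "l # w \<in> gwords S \<longleftrightarrow> fst l \<in> S \<and> w \<in> gwords S"
  "u @ v \<in> gwords S \<longleftrightarrow> u \<in> gwords S \<and> v \<in> gwords S"
  by (auto simp: gwords_def mem_Times_iff)

text \<open>The two letters \<open>s\<close> and \<open>s\<^sup>-\<^sup>1\<close> are indexed by \<open>True\<close> and \<open>False\<close>. Both satisfy
  \<open>c s\<^sup>e = s\<^sup>e \<theta>\<^sub>e(c)\<close> for \<open>c \<in> C\<^sub>e\<close>, where \<open>C\<^sub>F = A\<close>, \<open>C\<^sub>T = B\<close>, \<open>\<theta>\<^sub>F = \<psi>\<close> and \<open>\<theta>\<^sub>T = \<psi>\<^sup>-\<^sup>1\<close>;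
  \<open>tr e\<close> chooses representatives of the left cosets of \<open>C\<^sub>e\<close>.\<close>

type_synonym 'h hnn_state = "('h \<times> bool) list \<times> 'h"
type_synonym 'h hnn_elem = "'h hnn_gen gword set"

section \<open>Coset decompositions and reduced sequences\<close>

locale hnn_data = group H for H (structure) +
  fixes C :: "bool \<Rightarrow> 'a set" and \<theta> :: "bool \<Rightarrow> 'a \<Rightarrow> 'a" and tr :: "bool \<Rightarrow> 'a \<Rightarrow> 'a"
  assumes subgroup_C: "subgroup (C e) H"
    and \<theta>_mult: "x \<in> C e \<Longrightarrow> y \<in> C e \<Longrightarrow> \<theta> e (x \<otimes> y) = \<theta> e x \<otimes> \<theta> e y"
    and \<theta>_closed: "x \<in> C e \<Longrightarrow> \<theta> e x \<in> C (\<not> e)"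
    and \<theta>_\<theta>: "x \<in> C e \<Longrightarrow> \<theta> (\<not> e) (\<theta> e x) = x"
    and tr_closed [simp]: "h \<in> carrier H \<Longrightarrow> tr e h \<in> carrier H"
    and tr_in: "h \<in> carrier H \<Longrightarrow> inv (tr e h) \<otimes> h \<in> C e"
    and tr_mult: "h \<in> carrier H \<Longrightarrow> c \<in> C e \<Longrightarrow> tr e (h \<otimes> c) = tr e h"
    and tr_one [simp]: "tr e \<one> = \<one>"
begin

lemma C_carrier: "x \<in> C e \<Longrightarrow> x \<in> carrier H"
  using subgroup.mem_carrier[OF subgroup_C] .

lemma \<theta>_carrier [simp]: "x \<in> C e \<Longrightarrow> \<theta> e x \<in> carrier H"
  using \<theta>_closed C_carrier by blast

lemma C_one [simp]: "\<one> \<in> C e" and C_mult: "x \<in> C e \<Longrightarrow> y \<in> C e \<Longrightarrow> x \<otimes> y \<in> C e"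
  and C_inv: "x \<in> C e \<Longrightarrow> inv x \<in> C e"
  using subgroup.one_closed[OF subgroup_C] subgroup.m_closed[OF subgroup_C]
    subgroup.m_inv_closed[OF subgroup_C] by auto

lemma \<theta>_one [simp]: "\<theta> e \<one> = \<one>"
  using \<theta>_mult[of \<one> e \<one>] by simp

lemma tr_C: "c \<in> C e \<Longrightarrow> tr e c = \<one>"
  using tr_mult[of \<one> c e] C_carrier by simp

text \<open>The right factor of \<open>h\<close>, the part that can be moved across the letter
  \<open>s^e\<close>.\<close>

definition rem :: "bool \<Rightarrow> 'a \<Rightarrow> 'a" where
  "rem e h = inv (tr e h) \<otimes> h"

lemma rem_in: "h \<in> carrier H \<Longrightarrow> rem e h \<in> C e"
  by (simp add: rem_def tr_in)

lemma rem_carrier [simp]: "h \<in> carrier H \<Longrightarrow> rem e h \<in> carrier H"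
  by (simp add: rem_def)

lemma tr_rem: "h \<in> carrier H \<Longrightarrow> tr e h \<otimes> rem e h = h"
  by (simp add: rem_def m_assoc[symmetric])

lemma tr_tr [simp]: "h \<in> carrier H \<Longrightarrow> tr e (tr e h) = tr e h"
  using tr_mult[of "tr e h" "rem e h" e] rem_in tr_rem by simp

lemma rem_mult: "h \<in> carrier H \<Longrightarrow> c \<in> C e \<Longrightarrow> rem e (h \<otimes> c) = rem e h \<otimes> c"
  by (simp add: rem_def tr_mult C_carrier m_assoc)

lemma rem_tr [simp]: "h \<in> carrier H \<Longrightarrow> rem e (tr e h) = \<one>"
  by (simp add: rem_def)

lemma rem_C: "c \<in> C e \<Longrightarrow> rem e c = c"
  by (simp add: rem_def tr_C C_carrier)

text \<open>Reduced sequences as in Britton's lemma: the last clause excludes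
  \<open>s^(-e) t s^e\<close> with \<open>t \<in> C e\<close>, because a representative lies in
  \<open>C e\<close> only if it is \<open>\<one>\<close>. The head of the list is the syllable
  written last.\<close>

fun valid_stack :: "('a \<times> bool) list \<Rightarrow> bool" where
  "valid_stack [] \<longleftrightarrow> True"
| "valid_stack ((t, e) # st) \<longleftrightarrow> t \<in> carrier H \<and> tr e t = t \<and> valid_stack st \<and>
     (st \<noteq> [] \<longrightarrow> snd (hd st) = (\<not> e) \<longrightarrow> t \<noteq> \<one>)"

definition valid_state :: "'a hnn_state \<Rightarrow> bool" where
  "valid_state \<omega> \<longleftrightarrow> valid_stack (fst \<omega>) \<and> snd \<omega> \<in> carrier H"

text \<open>The state \<open>([(t\<^sub>n, e\<^sub>n), \<dots>, (t\<^sub>1, e\<^sub>1)], h)\<close> stands for \<open>t\<^sub>1 s\<^bsup>e\<^sub>1\<^esup> \<dots> t\<^sub>n s\<^bsup>e\<^sub>n\<^esup> h\<close>; the following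
  functions describe the multiplication on the right by an element of \<open>H\<close> and by \<open>s\<^sup>e\<close>.\<close>

definition base_act :: "'a \<Rightarrow> 'a hnn_state \<Rightarrow> 'a hnn_state" where
  "base_act k \<omega> = (fst \<omega>, snd \<omega> \<otimes> k)"

text \<open>The test \<open>tr e h = \<one>\<close> says that \<open>h\<close> lies in
  \<open>C e\<close>; such an \<open>h\<close> crosses the new letter, and two opposite stable
  letters meet.\<close>

definition cancels :: "bool \<Rightarrow> 'a hnn_state \<Rightarrow> bool" where
  "cancels e \<omega> \<longleftrightarrow> tr e (snd \<omega>) = \<one> \<and> fst \<omega> \<noteq> [] \<and> snd (hd (fst \<omega>)) = (\<not> e)"

definition stable_act :: "bool \<Rightarrow> 'a hnn_state \<Rightarrow> 'a hnn_state" where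
  "stable_act e \<omega> =
     (if cancels e \<omega> then (tl (fst \<omega>), fst (hd (fst \<omega>)) \<otimes> \<theta> e (rem e (snd \<omega>)))
      else ((tr e (snd \<omega>), e) # fst \<omega>, \<theta> e (rem e (snd \<omega>))))"

lemma valid_base_act: "valid_state \<omega> \<Longrightarrow> k \<in> carrier H \<Longrightarrow> valid_state (base_act k \<omega>)"
  by (auto simp: valid_state_def base_act_def)

lemma valid_stable_act: assumes "valid_state \<omega>" shows "valid_state (stable_act e \<omega>)"
proof -
  obtain st h where \<omega>: "\<omega> = (st, h)" by fastforce
  have v: "valid_stack st" "h \<in> carrier H" using assms by (auto simp: \<omega> valid_state_def)
  show ?thesis
    using v rem_in[OF v(2), of e]
    by (cases st; cases "hd st") (auto simp: \<omega> valid_state_def stable_act_def cancels_def)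
qed

lemma base_act_base_act:
  "valid_state \<omega> \<Longrightarrow> h \<in> carrier H \<Longrightarrow> k \<in> carrier H \<Longrightarrow> base_act k (base_act h \<omega>) = base_act (h \<otimes> k) \<omega>"
  by (simp add: valid_state_def base_act_def m_assoc)

text \<open>After a push the element of \<open>H\<close> lies in \<open>C (\<not> e)\<close>, so the
  opposite letter cancels. After a pop the last clause of \<open>valid_stack\<close> prevents a
  further cancellation, so the opposite letter pushes the old entry back.\<close>

lemma stable_act_inverse:
  assumes "valid_state \<omega>" shows "stable_act (\<not> e) (stable_act e \<omega>) = \<omega>"
proof -
  obtain st h where \<omega>: "\<omega> = (st, h)" by fastforce
  have v: "valid_stack st" "h \<in> carrier H" using assms by (auto simp: \<omega> valid_state_def)
  define b where "b = rem e h"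
  have b: "b \<in> C e" "tr e h \<otimes> b = h" using rem_in tr_rem v by (auto simp: b_def)
  have tb: "tr (\<not> e) (\<theta> e b) = \<one>" "rem (\<not> e) (\<theta> e b) = \<theta> e b" "\<theta> e b \<in> C (\<not> e)"
    using \<theta>_closed[OF b(1)] tr_C rem_C by auto
  show ?thesis
  proof (cases "cancels e \<omega>")
    case False
    then have "stable_act e \<omega> = ((tr e h, e) # st, \<theta> e b)" by (simp add: stable_act_def \<omega> b_def)
    then show ?thesis using tb \<theta>_\<theta>[OF b(1)] b(2) by (simp add: stable_act_def cancels_def \<omega>)
  next
    case True
    then obtain t st' where st: "st = (t, \<not> e) # st'" and h: "tr e h = \<one>"
      by (cases st) (auto simp: cancels_def \<omega>)
    have t: "t \<in> carrier H" "tr (\<not> e) t = t" "st' \<noteq> [] \<Longrightarrow> snd (hd st') = e \<Longrightarrow> t \<noteq> \<one>"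
      using v st by auto
    have "stable_act e \<omega> = (st', t \<otimes> \<theta> e b)" using True by (simp add: stable_act_def \<omega> st b_def)
    moreover have "tr (\<not> e) (t \<otimes> \<theta> e b) = t" using tr_mult[OF t(1) tb(3)] t(2) by simp
    moreover have "rem (\<not> e) (t \<otimes> \<theta> e b) = \<theta> e b"
      using rem_mult[OF t(1) tb(3)] rem_tr[OF t(1), of "\<not> e"] t(2) tb(3) C_carrier by simp
    moreover have "b = h" using b(2) h b(1) C_carrier by simp
    ultimately show ?thesis using t(3) \<theta>_\<theta>[OF b(1)] by (auto simp: stable_act_def cancels_def \<omega> st)
  qed
qed

lemma stable_act_base_act:
  assumes "valid_state \<omega>" "c \<in> C e"
  shows "stable_act e (base_act c \<omega>) = base_act (\<theta> e c) (stable_act e \<omega>)"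
proof -
  obtain st h where \<omega>: "\<omega> = (st, h)" by fastforce
  have v: "valid_stack st" "h \<in> carrier H" using assms by (auto simp: \<omega> valid_state_def)
  have "fst (hd st) \<in> carrier H" if "st \<noteq> []" using v(1) that by (cases st; cases "hd st") auto
  then show ?thesis
    using v assms(2) rem_in[OF v(2), of e]
    by (auto simp: stable_act_def base_act_def cancels_def \<omega> tr_mult rem_mult \<theta>_mult m_assoc)
qed

section \<open>The action of the extension on states\<close>

abbreviation "G \<equiv> hnn_extension H (C False) (\<theta> False)"
abbreviation mult_G :: "'a hnn_elem \<Rightarrow> 'a hnn_elem \<Rightarrow> 'a hnn_elem"  (infixl "\<cdot>" 70)
  where "g \<cdot> k \<equiv> g \<otimes>\<^bsub>G\<^esub> k"
abbreviation "gens \<equiv> insert Stable (Base ` carrier H)"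
abbreviation "rels \<equiv> hnn_relations H (C False) (\<theta> False)"

fun act :: "'a hnn_state \<Rightarrow> 'a hnn_gen \<times> bool \<Rightarrow> 'a hnn_state" where
  "act \<omega> (Base k, b) = base_act (if b then k else inv k) \<omega>"
| "act \<omega> (Stable, b) = stable_act b \<omega>"

lemma valid_act:
  assumes "valid_state \<omega>" "fst l \<in> gens" shows "valid_state (act \<omega> l)"
proof -
  obtain x b where "l = (x, b)" by fastforce
  then show ?thesis using assms valid_base_act[of \<omega>] valid_stable_act[of \<omega>] by (cases x) auto
qed

lemma valid_foldl_act:
  "w \<in> gwords gens \<Longrightarrow> valid_state \<omega> \<Longrightarrow> valid_state (foldl act \<omega> w)"
  by (induction w arbitrary: \<omega>) (simp_all add: valid_act)

text \<open>Both sides of every defining relation act alike on valid states, so the action descends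
  to the extension. This makes \<open>state\<close> independent of the word picked from a
  class.\<close>

lemma foldl_act_pres_eq:
  assumes "pres_eq gens rels u v" "valid_state \<omega>"
  shows "foldl act \<omega> u = foldl act \<omega> v"
  using assms
proof (induction arbitrary: \<omega> rule: pres_eq.induct)
  case (append u u' v v')
  then show ?case using valid_foldl_act pres_eq_gwords[OF append.hyps(1)] by auto
next
  case (cancel x b)
  then have x: "x = Stable \<or> (\<exists>k\<in>carrier H. x = Base k)" by auto
  show ?case
  proof (cases "x = Stable")
    case True
    then show ?thesis using stable_act_inverse[OF cancel.prems, of b] by simp
  next
    case False
    then show ?thesis using x cancel.prems by (auto simp: base_act_def valid_state_def m_assoc)
  qed
next
  case (relation u v)
  from relation.hyps(1) show ?case unfolding hnn_relations_def
  proof safe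
    fix h k assume "h \<in> carrier H" "k \<in> carrier H"
    then show "foldl act \<omega> [(Base h, True), (Base k, True)] = foldl act \<omega> [(Base (h \<otimes> k), True)]"
      using relation.prems by (simp add: base_act_base_act)
  next
    fix a assume a: "a \<in> C False"
    have "\<theta> True (\<theta> False a) = a" "\<theta> False a \<in> C True" using \<theta>_\<theta>[OF a] \<theta>_closed[OF a] by auto
    then have "base_act a (stable_act True \<omega>) = stable_act True (base_act (\<theta> False a) \<omega>)"
      using stable_act_base_act[OF relation.prems, of "\<theta> False a" True] by simp
    then show "foldl act \<omega> [(Stable, True), (Base a, True), (Stable, False)] = foldl act \<omega> [(Base (\<theta> False a), True)]"
      using stable_act_inverse[OF valid_base_act[OF relation.prems], of "\<theta> False a" True] \<theta>_carrier[OF a] by simp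
  qed
qed auto

abbreviation "cls \<equiv> pres_class gens rels"

definition \<iota> :: "'a \<Rightarrow> 'a hnn_elem" where "\<iota> h = cls [(Base h, True)]"
definition \<sigma> :: "bool \<Rightarrow> 'a hnn_elem" where "\<sigma> e = cls [(Stable, e)]"

definition state :: "'a hnn_elem \<Rightarrow> 'a hnn_state" where
  "state g = foldl act ([], \<one>) (SOME u. u \<in> g)"

sublocale G: group G by (rule group_hnn_extension)

lemma G_carrier: "carrier G = cls ` gwords gens" and G_one: "\<one>\<^bsub>G\<^esub> = cls []"
  by (simp_all add: hnn_extension_def presented_group_def)

lemma cls_mult: "u \<in> gwords gens \<Longrightarrow> v \<in> gwords gens \<Longrightarrow> cls u \<cdot> cls v = cls (u @ v)"
  unfolding hnn_extension_def by (rule presented_group_mult)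

lemma cls_eqI: "pres_eq gens rels u v \<Longrightarrow> cls u = cls v"
  using pres_class_eq_iff pres_eq_gwords by metis

lemma \<iota>_closed [simp]: "h \<in> carrier H \<Longrightarrow> \<iota> h \<in> carrier G" and \<sigma>_closed [simp]: "\<sigma> e \<in> carrier G"
  by (auto simp: \<iota>_def \<sigma>_def G_carrier)

lemma \<iota>_mult: assumes "h \<in> carrier H" "k \<in> carrier H" shows "\<iota> (h \<otimes> k) = \<iota> h \<cdot> \<iota> k"
proof -
  have "pres_eq gens rels [(Base h, True), (Base k, True)] [(Base (h \<otimes> k), True)]"
    using assms by (intro pres_eq.relation) (auto simp: hnn_relations_def)
  then show ?thesis using cls_eqI assms by (simp add: \<iota>_def cls_mult)
qed

lemma \<iota>_one [simp]: "\<iota> \<one> = \<one>\<^bsub>G\<^esub>"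
  using \<iota>_mult[of \<one> \<one>] by simp

lemma \<iota>_inv: "h \<in> carrier H \<Longrightarrow> \<iota> (inv h) = inv\<^bsub>G\<^esub> \<iota> h"
  using \<iota>_mult[of "inv h" h] by (intro G.inv_equality[symmetric]) simp_all

lemma cls_Base_False:
  assumes k: "k \<in> carrier H" shows "cls [(Base k, False)] = inv\<^bsub>G\<^esub> \<iota> k"
proof (rule G.inv_equality[symmetric])
  show "cls [(Base k, False)] \<cdot> \<iota> k = \<one>\<^bsub>G\<^esub>"
    using k cls_eqI[OF pres_eq.cancel[of "Base k" gens rels False]] by (simp add: \<iota>_def cls_mult G_one)
qed (use k in \<open>simp_all, simp add: G_carrier\<close>)

lemma \<sigma>_inv: "\<sigma> (\<not> e) = inv\<^bsub>G\<^esub> \<sigma> e"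
proof -
  have "\<sigma> (\<not> e) \<cdot> \<sigma> e = \<one>\<^bsub>G\<^esub>"
    using cls_eqI[OF pres_eq.cancel[of Stable gens rels "\<not> e"]] by (simp add: \<sigma>_def cls_mult G_one)
  then show ?thesis by (simp add: G.inv_equality)
qed

lemma \<sigma>_\<sigma> [simp]: "g \<in> carrier G \<Longrightarrow> g \<cdot> \<sigma> (\<not> e) \<cdot> \<sigma> e = g"
  by (simp add: \<sigma>_inv G.m_assoc)

lemma \<iota>_\<sigma>: assumes "c \<in> C e" shows "\<iota> c \<cdot> \<sigma> e = \<sigma> e \<cdot> \<iota> (\<theta> e c)"
proof -
  have F: "\<sigma> True \<cdot> \<iota> a \<cdot> \<sigma> False = \<iota> (\<theta> False a)" if "a \<in> C False" for a
  proof -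
    have "pres_eq gens rels [(Stable, True), (Base a, True), (Stable, False)] [(Base (\<theta> False a), True)]"
      using that C_carrier \<theta>_carrier by (intro pres_eq.relation) (auto simp: hnn_relations_def)
    then show ?thesis using cls_eqI C_carrier[OF that] by (simp add: \<iota>_def \<sigma>_def cls_mult)
  qed
  show ?thesis
  proof (cases e)
    case False
    have "\<sigma> False \<cdot> (\<sigma> True \<cdot> \<iota> c \<cdot> \<sigma> False) = \<iota> c \<cdot> \<sigma> False"
      using assms C_carrier \<sigma>_inv[of True] by (simp add: G.m_assoc[symmetric])
    then show ?thesis using F assms False by simp
  next
    \<comment> \<open>The presentation gives the relation for \<open>C False\<close> only. For
      \<open>c \<in> C True\<close> it is applied to \<open>\<theta> True c\<close> and multiplied
      by \<open>s\<close> on the right.\<close>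
    case True
    then have c: "\<theta> True c \<in> C False" "\<theta> False (\<theta> True c) = c" using \<theta>_closed[OF assms] \<theta>_\<theta>[OF assms] by auto
    then have "\<iota> c \<cdot> \<sigma> True = \<sigma> True \<cdot> \<iota> (\<theta> True c) \<cdot> \<sigma> False \<cdot> \<sigma> True" using F[OF c(1)] by simp
    then show ?thesis using C_carrier[OF c(1)] True \<sigma>_\<sigma>[of "\<sigma> True \<cdot> \<iota> (\<theta> True c)" True] by simp
  qed
qed

lemma state_cls: assumes "u \<in> gwords gens" shows "state (cls u) = foldl act ([], \<one>) u"
proof -
  have "u \<in> cls u" using pres_eq.refl[OF assms] by (simp add: pres_class_def)
  then have "(SOME v. v \<in> cls u) \<in> cls u" by (rule someI)
  then have "pres_eq gens rels u (SOME v. v \<in> cls u)" by (simp add: pres_class_def)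
  from foldl_act_pres_eq[OF this, of "([], \<one>)"] show ?thesis by (simp add: state_def valid_state_def)
qed

lemma state_one [simp]: "state \<one>\<^bsub>G\<^esub> = ([], \<one>)"
  by (simp add: G_one state_cls)

lemma valid_state_state: "g \<in> carrier G \<Longrightarrow> valid_state (state g)"
  using valid_foldl_act[of _ "([], \<one>)"] by (auto simp: G_carrier state_cls valid_state_def)

lemma state_\<iota>: "g \<in> carrier G \<Longrightarrow> h \<in> carrier H \<Longrightarrow> state (g \<cdot> \<iota> h) = base_act h (state g)"
  by (auto simp: G_carrier \<iota>_def cls_mult state_cls)

lemma state_\<sigma>: "g \<in> carrier G \<Longrightarrow> state (g \<cdot> \<sigma> e) = stable_act e (state g)"
  by (auto simp: G_carrier \<sigma>_def cls_mult state_cls)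

section \<open>The normal form theorem\<close>

primrec stack_value :: "('a \<times> bool) list \<Rightarrow> 'a hnn_elem" where
  "stack_value [] = \<one>\<^bsub>G\<^esub>"
| "stack_value (p # st) = stack_value st \<cdot> \<iota> (fst p) \<cdot> \<sigma> (snd p)"

definition state_value :: "'a hnn_state \<Rightarrow> 'a hnn_elem" where
  "state_value \<omega> = stack_value (fst \<omega>) \<cdot> \<iota> (snd \<omega>)"

lemma stack_value_closed [simp]: "valid_stack st \<Longrightarrow> stack_value st \<in> carrier G"
  by (induction st) auto

lemma state_value_closed [simp]: "valid_state \<omega> \<Longrightarrow> state_value \<omega> \<in> carrier G"
  by (auto simp: state_value_def valid_state_def)

lemma state_value_base_act:
  "valid_state \<omega> \<Longrightarrow> h \<in> carrier H \<Longrightarrow> state_value (base_act h \<omega>) = state_value \<omega> \<cdot> \<iota> h"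
  by (auto simp: state_value_def valid_state_def base_act_def \<iota>_mult G.m_assoc)

lemma state_value_stable_act:
  assumes "valid_state \<omega>" shows "state_value (stable_act e \<omega>) = state_value \<omega> \<cdot> \<sigma> e"
proof -
  obtain st h where \<omega>: "\<omega> = (st, h)" by fastforce
  have v: "valid_stack st" "h \<in> carrier H" using assms by (auto simp: \<omega> valid_state_def)
  define b where "b = rem e h"
  have b: "b \<in> C e" "tr e h \<otimes> b = h" "b \<in> carrier H" using rem_in tr_rem v by (auto simp: b_def)
  have bs: "\<sigma> e \<cdot> \<iota> (\<theta> e b) = \<iota> b \<cdot> \<sigma> e" using \<iota>_\<sigma>[OF b(1)] by simp
  show ?thesis
  proof (cases "cancels e \<omega>")
    case False
    then have "state_value (stable_act e \<omega>) = stack_value st \<cdot> \<iota> (tr e h) \<cdot> (\<sigma> e \<cdot> \<iota> (\<theta> e b))"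
      using b v by (simp add: stable_act_def \<omega> b_def state_value_def G.m_assoc)
    also have "\<dots> = stack_value st \<cdot> (\<iota> (tr e h) \<cdot> \<iota> b) \<cdot> \<sigma> e"
      unfolding bs using b v by (simp add: G.m_assoc)
    also have "\<iota> (tr e h) \<cdot> \<iota> b = \<iota> h"
      using \<iota>_mult[of "tr e h" b] b v by simp
    finally show ?thesis by (simp add: state_value_def \<omega>)
  next
    case True
    then obtain t st' where st: "st = (t, \<not> e) # st'" and h: "tr e h = \<one>"
      by (cases st) (auto simp: cancels_def \<omega>)
    have t: "t \<in> carrier H" "valid_stack st'" using v st by auto
    have "h = b" using b h v by simp
    have "state_value \<omega> \<cdot> \<sigma> e = stack_value st' \<cdot> \<iota> t \<cdot> \<sigma> (\<not> e) \<cdot> (\<iota> b \<cdot> \<sigma> e)"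
      using t b by (simp add: state_value_def \<omega> st \<open>h = b\<close> G.m_assoc)
    also have "\<dots> = stack_value st' \<cdot> \<iota> t \<cdot> \<sigma> (\<not> e) \<cdot> \<sigma> e \<cdot> \<iota> (\<theta> e b)"
      unfolding bs[symmetric] using t b by (simp add: G.m_assoc)
    also have "\<dots> = stack_value st' \<cdot> \<iota> (t \<otimes> \<theta> e b)"
      using t b by (simp add: \<iota>_mult G.m_assoc[symmetric])
    finally show ?thesis using True by (simp add: stable_act_def \<omega> st b_def state_value_def)
  qed
qed

lemma state_value_foldl_act:
  "w \<in> gwords gens \<Longrightarrow> valid_state \<omega> \<Longrightarrow> state_value (foldl act \<omega> w) = state_value \<omega> \<cdot> cls w"
proof (induction w arbitrary: \<omega>)
  case Nil
  then show ?case by (simp add: G_one[symmetric])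
next
  case (Cons l w)
  have l: "fst l \<in> gens" and w: "w \<in> gwords gens" using Cons.prems by auto
  have "state_value (act \<omega> l) = state_value \<omega> \<cdot> cls [l]"
  proof -
    obtain x b where lx: "l = (x, b)" by fastforce
    show ?thesis
    proof (cases x)
      case (Base k)
      then have k: "k \<in> carrier H" using l lx by auto
      then show ?thesis using k Cons.prems(2) lx Base cls_Base_False[OF k]
        by (cases b) (simp_all add: state_value_base_act \<iota>_inv \<iota>_def[symmetric])
    next
      case Stable
      then show ?thesis using lx state_value_stable_act[OF Cons.prems(2), of b] by (simp add: \<sigma>_def)
    qed
  qed
  moreover have "cls [l] \<cdot> cls w = cls (l # w)" "cls [l] \<in> carrier G" "cls w \<in> carrier G"
    using l w cls_mult[of "[l]" w] by (auto simp: G_carrier)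
  ultimately show ?case
    using Cons.IH[OF w valid_act[OF Cons.prems(2) l]] Cons.prems(2) by (simp add: G.m_assoc)
qed

text \<open>Evaluation commutes with the action, so the image of the empty state evaluates to the
  acting element. Together with \<open>state_state_value\<close> this makes elements and valid
  states correspond bijectively.\<close>

lemma state_value_state: assumes "g \<in> carrier G" shows "state_value (state g) = g"
proof -
  obtain w where w: "w \<in> gwords gens" "g = cls w" using assms by (auto simp: G_carrier)
  then show ?thesis using state_value_foldl_act[OF w(1), of "([], \<one>)"] assms
    by (simp add: state_cls valid_state_def state_value_def)
qed

lemma state_stack_value: "valid_stack st \<Longrightarrow> h \<in> carrier H \<Longrightarrow> state (stack_value st \<cdot> \<iota> h) = (st, h)"
proof (induction st arbitrary: h)
  case Nil
  then show ?case using state_\<iota>[of "\<one>\<^bsub>G\<^esub>" h] by (simp add: base_act_def)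
next
  case (Cons p st)
  obtain t e where p: "p = (t, e)" by fastforce
  have v: "valid_stack st" "t \<in> carrier H" "tr e t = t" "st \<noteq> [] \<Longrightarrow> snd (hd st) = (\<not> e) \<Longrightarrow> t \<noteq> \<one>"
    using Cons.prems p by auto
  have "rem e t = \<one>" using rem_tr[OF v(2), of e] v(3) by simp
  then have "stable_act e (st, t) = ((t, e) # st, \<one>)"
    using v by (auto simp: stable_act_def cancels_def)
  then show ?case
    using Cons.IH[OF v(1,2)] Cons.prems v by (simp add: p state_\<iota> state_\<sigma> base_act_def)
qed

lemma state_state_value: "valid_state \<omega> \<Longrightarrow> state (state_value \<omega>) = \<omega>"
  by (auto simp: valid_state_def state_value_def state_stack_value)

lemma \<iota>_inj: "h \<in> carrier H \<Longrightarrow> k \<in> carrier H \<Longrightarrow> \<iota> h = \<iota> k \<Longrightarrow> h = k"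
  using state_stack_value[of "[]" h] state_stack_value[of "[]" k] by simp

lemma state_\<sigma>_one: "state (\<sigma> e) = ([(\<one>, e)], \<one>)"
  using state_\<sigma>[of "\<one>\<^bsub>G\<^esub>" e] by (simp add: stable_act_def cancels_def rem_def)

lemma \<sigma>_neq_\<iota>: "h \<in> carrier H \<Longrightarrow> \<sigma> e \<noteq> \<iota> h" "h \<in> carrier H \<Longrightarrow> \<iota> h \<noteq> \<sigma> e"
  using state_stack_value[of "[]" h] state_\<sigma>_one[of e] by auto

lemma \<sigma>_inj: "\<sigma> e = \<sigma> e' \<longleftrightarrow> e = e'"
proof
  assume "\<sigma> e = \<sigma> e'"
  then have "([(\<one>, e)], \<one>) = ([(\<one>, e')], \<one>)" unfolding state_\<sigma>_one[symmetric] by simp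
  then show "e = e'" by simp
qed simp

end

section \<open>The flow function of an HNN extension\<close>

text \<open>An element \<open>b \<noteq> \<one>\<close> of \<open>C\<^sub>e\<close> is shortened, with respect to the measure \<open>\<mu> e\<close>, by one of finitely many
  elements of \<open>C\<^sub>e\<close>, given by the words \<open>wL e j\<close>; the word \<open>wR e j\<close> represents its compensation on
  the other side of the letter \<open>s\<^sup>e\<close>.\<close>

locale hnn_flow = hnn_data H C \<theta> tr + gen_group H X
  for H (structure) and C \<theta> tr X +
  fixes nf :: "'a \<Rightarrow> 'a list" and \<phi> :: "'a \<Rightarrow> 'a \<Rightarrow> 'a list"
    and wL wR :: "bool \<Rightarrow> nat \<Rightarrow> 'a list" and ch \<mu> :: "bool \<Rightarrow> 'a \<Rightarrow> nat" and m :: "bool \<Rightarrow> nat"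
  assumes one_X: "\<one> \<notin> X"
    and flow: "word_flow H X nf \<phi>"
    and ch_less: "b \<in> C e \<Longrightarrow> b \<noteq> \<one> \<Longrightarrow> ch e b < m e"
    and wL_X: "j < m e \<Longrightarrow> wL e j \<in> lists X" and wR_X: "j < m e \<Longrightarrow> wR e j \<in> lists X"
    and wL_C: "j < m e \<Longrightarrow> word_value H (wL e j) \<in> C e"
    and wR_value: "j < m e \<Longrightarrow> word_value H (wR e j) = \<theta> e (inv (word_value H (wL e j)))"
    and \<mu>_less: "b \<in> C e \<Longrightarrow> b \<noteq> \<one> \<Longrightarrow> \<mu> e (b \<otimes> word_value H (wL e (ch e b))) < \<mu> e b"
begin

section \<open>Generators and tree of the extension\<close>

definition XG :: "'a hnn_elem set" where
  "XG = \<iota> ` X \<union> range \<sigma>"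

lemma nf_system_nf: "nf_system H X nf"
  using flow by (simp add: word_flow_def)

lemmas nf_X = nf_systemD(1)[OF nf_system_nf] and nf_value = nf_systemD(2)[OF nf_system_nf]
  and nf_prefix = nf_systemD(3)[OF nf_system_nf]

lemma nf_one_eq [simp]: "nf \<one> = []"
  using nf_one[OF nf_system_nf] .

lemma nf_Nil_iff: "h \<in> carrier H \<Longrightarrow> nf h = [] \<longleftrightarrow> h = \<one>"
  using nf_value[of h] by auto

lemma \<phi>_X: "h \<in> carrier H \<Longrightarrow> x \<in> X \<Longrightarrow> \<phi> h x \<in> lists X"
  and \<phi>_value: "h \<in> carrier H \<Longrightarrow> x \<in> X \<Longrightarrow> word_value H (\<phi> h x) = x"
  and \<phi>_tree: "h \<in> carrier H \<Longrightarrow> x \<in> X \<Longrightarrow> (h, x) \<in> nf_arcs H X nf \<Longrightarrow> \<phi> h x = [x]"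
  using flow by (auto simp: word_flow_def)

lemma XG_closed: "a \<in> XG \<Longrightarrow> a \<in> carrier G"
  by (auto simp: XG_def)

lemma map_\<iota>_XG: "w \<in> lists X \<Longrightarrow> map \<iota> w \<in> lists XG"
  by (induction w) (auto simp: XG_def)

lemma \<sigma>_XG [simp]: "\<sigma> e \<in> XG"
  by (simp add: XG_def)

lemma \<iota>_XG: "x \<in> X \<Longrightarrow> \<iota> x \<in> XG"
  by (simp add: XG_def)

lemma word_value_map_\<iota>: "w \<in> lists (carrier H) \<Longrightarrow> word_value G (map \<iota> w) = \<iota> (word_value H w)"
  by (induction w) (auto simp: \<iota>_mult)

lemma fin_inv_closed_gen_set_XG: "fin_inv_closed_gen_set G XG"
  unfolding fin_inv_closed_gen_set_def
proof (intro conjI ballI)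
  show "finite XG" using finite_X by (simp add: XG_def)
  show "XG \<subseteq> carrier G" using XG_closed by blast
  show "inv\<^bsub>G\<^esub> x \<in> XG" if "x \<in> XG" for x
    using that unfolding XG_def by (auto simp: \<iota>_inv[symmetric] \<sigma>_inv[symmetric])
  have "generate G XG \<subseteq> carrier G" using XG_closed by (intro G.generate_incl) blast
  moreover have sg: "subgroup (generate G XG) G" using XG_closed by (intro G.generate_is_subgroup) blast
  have in_gen: "word_value G w \<in> generate G XG" if "w \<in> lists XG" for w
    using that
  proof (induction w)
    case (Cons a w)
    then show ?case using generate.incl[of a XG G] subgroup.m_closed[OF sg] by auto
  qed (use subgroup.one_closed[OF sg] in simp)
  have \<iota>_gen: "\<iota> h \<in> generate G XG" if h: "h \<in> carrier H" for h
  proof -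
    obtain w where "w \<in> lists X" "word_value H w = h" using ex_word[OF h] by blast
    then show ?thesis using in_gen[OF map_\<iota>_XG, of w] word_value_map_\<iota>[of w] by simp
  qed
  have "cls w \<in> generate G XG" if "w \<in> gwords gens" for w
    using that
  proof (induction w)
    case Nil
    then show ?case using subgroup.one_closed[OF sg] by (simp add: G_one)
  next
    case (Cons l w)
    obtain x b where l: "l = (x, b)" by fastforce
    have w: "cls w \<in> generate G XG" and wg: "w \<in> gwords gens" using Cons by auto
    have "cls [l] \<in> generate G XG"
    proof (cases x)
      case (Base k)
      then have k: "k \<in> carrier H" using Cons.prems l by auto
      show ?thesis
      proof (cases b)
        case True
        then show ?thesis using \<iota>_gen[OF k] by (simp add: \<iota>_def l Base)
      next
        case False
        then show ?thesis using cls_Base_False[OF k] \<iota>_gen[OF k] subgroup.m_inv_closed[OF sg] by (simp add: l Base)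
      qed
    next
      case Stable
      then show ?thesis using generate.incl[OF \<sigma>_XG[of b], of G] by (simp add: l \<sigma>_def)
    qed
    then show ?case using subgroup.m_closed[OF sg _ w] cls_mult[of "[l]" w] wg Cons.prems by fastforce
  qed
  then have "carrier G \<subseteq> generate G XG" by (auto simp: G_carrier)
  ultimately show "generate G XG = carrier G" by blast
qed

sublocale GX: gen_group G XG
  by unfold_locales (rule fin_inv_closed_gen_set_XG)

lemma one_XG: "\<one>\<^bsub>G\<^esub> \<notin> XG"
proof
  assume "\<one>\<^bsub>G\<^esub> \<in> XG"
  then consider x where "x \<in> X" "\<iota> x = \<iota> \<one>" | e where "\<sigma> e = \<iota> \<one>" by (auto simp: XG_def)
  then show False
  proof cases
    case 1
    then show False using \<iota>_inj[of x \<one>] one_X by simp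
  next
    case 2
    then show False using \<sigma>_neq_\<iota>(1)[of \<one> e] by simp
  qed
qed

lemma state_closed: "g \<in> carrier G \<Longrightarrow> snd (state g) \<in> carrier H" "g \<in> carrier G \<Longrightarrow> valid_stack (fst (state g))"
  using valid_state_state[of g] by (auto simp: valid_state_def)

primrec stack_word :: "('a \<times> bool) list \<Rightarrow> 'a hnn_elem list" where
  "stack_word [] = []"
| "stack_word (p # st) = stack_word st @ map \<iota> (nf (fst p)) @ [\<sigma> (snd p)]"

definition state_word :: "'a hnn_state \<Rightarrow> 'a hnn_elem list" where
  "state_word \<omega> = stack_word (fst \<omega>) @ map \<iota> (nf (snd \<omega>))"

definition nfG :: "'a hnn_elem \<Rightarrow> 'a hnn_elem list" where
  "nfG g = state_word (state g)"

lemma stack_word_XG: "valid_stack st \<Longrightarrow> stack_word st \<in> lists XG \<and> word_value G (stack_word st) = stack_value st"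
proof (induction st)
  case (Cons p st)
  then have "fst p \<in> carrier H" "valid_stack st" by (cases p; simp)+
  then show ?case using Cons.IH map_\<iota>_XG[OF nf_X, of "fst p"] nf_X[of "fst p"]
    by (simp add: word_value_map_\<iota> nf_value G.m_assoc)
qed simp

lemma state_word_XG:
  assumes "valid_state \<omega>" shows "state_word \<omega> \<in> lists XG" "word_value G (state_word \<omega>) = state_value \<omega>"
proof -
  have v: "valid_stack (fst \<omega>)" "snd \<omega> \<in> carrier H" using assms by (auto simp: valid_state_def)
  show "state_word \<omega> \<in> lists XG" "word_value G (state_word \<omega>) = state_value \<omega>"
    using stack_word_XG[OF v(1)] map_\<iota>_XG[OF nf_X[OF v(2)]] nf_X[OF v(2)] v(2)
    by (simp_all add: state_word_def state_value_def word_value_map_\<iota> nf_value)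
qed

lemma map_\<iota>_eq_iff: "u \<in> lists X \<Longrightarrow> v \<in> lists X \<Longrightarrow> map \<iota> u = map \<iota> v \<longleftrightarrow> u = v"
  by (rule inj_on_map_eq_map) (auto simp: inj_on_def in_lists_conv_set intro: \<iota>_inj)

text \<open>Removing a final letter \<open>s^e\<close> from the word of
  \<open>((t, e) # st', \<one>)\<close> leaves the word of \<open>(st', t)\<close>, since
  \<open>t\<close> was written in its normal form over \<open>X\<close>. If the word ends in a
  letter of \<open>X\<close>, prefix-closure is inherited from \<open>nf\<close>.\<close>

lemma nf_system_nfG: "nf_system G XG nfG"
  unfolding nf_system_def
proof (intro ballI conjI allI impI)
  fix g assume g: "g \<in> carrier G"
  show "nfG g \<in> lists XG" "word_value G (nfG g) = g"
    using state_word_XG[OF valid_state_state[OF g]] state_value_state[OF g] by (auto simp: nfG_def)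
  fix u a assume ua: "nfG g = u @ [a]"
  obtain st h where s: "state g = (st, h)" by fastforce
  have v: "valid_stack st" "h \<in> carrier H" using state_closed[OF g] s by auto
  have *: "nfG (word_value G u) = u" if "u = state_word \<omega>" "valid_state \<omega>" for \<omega>
    using that state_word_XG[of \<omega>] state_state_value[of \<omega>] by (simp add: nfG_def)
  show "nfG (word_value G u) = u"
  proof (cases "nf h" rule: rev_cases)
    case Nil
    then have u: "stack_word st = u @ [a]" using ua by (simp add: nfG_def s state_word_def)
    then obtain p st' where st: "st = p # st'" by (cases st) auto
    then have "u = state_word (st', fst p)" using u by (simp add: state_word_def)
    moreover have "valid_state (st', fst p)" using v st by (cases p) (simp add: valid_state_def)
    ultimately show ?thesis using * by blast
  next
    case (snoc w x)
    then have "u = stack_word st @ map \<iota> w" using ua by (simp add: nfG_def s state_word_def)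
    moreover have "nf (word_value H w) = w" using nf_prefix[OF v(2) snoc] .
    moreover have "word_value H w \<in> carrier H" using nf_X[OF v(2)] snoc by simp
    ultimately show ?thesis using *[of "(st, word_value H w)"] v by (simp add: state_word_def valid_state_def)
  qed
qed

lemma state_\<iota>_eq: "g \<in> carrier G \<Longrightarrow> h \<in> carrier H \<Longrightarrow> state (g \<cdot> \<iota> h) = (fst (state g), snd (state g) \<otimes> h)"
  by (simp add: state_\<iota> base_act_def)

text \<open>Multiplication by \<open>\<iota> x\<close> does not touch the stack, so the two normal
  forms share the prefix \<open>stack_word\<close> and differ only in their
  \<open>H\<close>-parts.\<close>

lemma base_arc_iff:
  assumes g: "g \<in> carrier G" and x: "x \<in> X"
  shows "(g, \<iota> x) \<in> nf_arcs G XG nfG \<longleftrightarrow> (snd (state g), x) \<in> nf_arcs H X nf"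
proof -
  define h where "h = snd (state g)"
  have h: "h \<in> carrier H" "h \<otimes> x \<in> carrier H" using state_closed[OF g] x by (auto simp: h_def)
  have xs: "nf h \<in> lists X" "nf (h \<otimes> x) \<in> lists X" "nf h @ [x] \<in> lists X" "nf (h \<otimes> x) @ [inv x] \<in> lists X"
    using nf_X h x by auto
  have "(g, \<iota> x) \<in> nf_arcs G XG nfG \<longleftrightarrow>
      map \<iota> (nf (h \<otimes> x)) = map \<iota> (nf h @ [x]) \<or> map \<iota> (nf h) = map \<iota> (nf (h \<otimes> x) @ [inv x])"
    using g x state_\<iota>_eq[OF g, of x]
    by (simp add: nf_arcs_def nfG_def state_word_def \<iota>_XG \<iota>_inv h_def)
  also have "\<dots> \<longleftrightarrow> (h, x) \<in> nf_arcs H X nf"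
    unfolding map_\<iota>_eq_iff[OF xs(2,3)] map_\<iota>_eq_iff[OF xs(1,4)] using h x by (simp add: nf_arcs_def)
  finally show ?thesis by (simp add: h_def)
qed

lemma state_word_ends_stable:
  assumes "valid_state \<omega>" "state_word \<omega> = u @ [\<sigma> e]" shows "snd \<omega> = \<one>"
proof (rule ccontr)
  have h: "snd \<omega> \<in> carrier H" using assms(1) by (simp add: valid_state_def)
  assume "snd \<omega> \<noteq> \<one>"
  then obtain w x where wx: "nf (snd \<omega>) = w @ [x]" using nf_Nil_iff[OF h] by (metis rev_exhaust)
  then have "\<iota> x = \<sigma> e" "x \<in> carrier H" using assms(2) nf_X[OF h] by (auto simp: state_word_def)
  then show False using \<sigma>_neq_\<iota> by blast
qed

text \<open>After a push the new word continues with \<open>\<theta> e b\<close> after the stable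
  letter and extends the old word only if \<open>b = \<one>\<close>. After a pop
  \<open>h = b\<close>, and the old word ends in \<open>s^(-e)\<close> only if
  \<open>b = \<one>\<close>; the edge then runs along the tree towards the identity.\<close>

lemma stable_arc_iff:
  assumes g: "g \<in> carrier G"
  shows "(g, \<sigma> e) \<in> nf_arcs G XG nfG \<longleftrightarrow> rem e (snd (state g)) = \<one>"
proof -
  obtain st h where s: "state g = (st, h)" by fastforce
  have v: "valid_stack st" "h \<in> carrier H" "valid_state (st, h)" using state_closed[OF g] s by (auto simp: valid_state_def)
  define b where "b = rem e h"
  have b: "b \<in> C e" "tr e h \<otimes> b = h" "b \<in> carrier H" using rem_in tr_rem v by (auto simp: b_def)
  have sg: "state (g \<cdot> \<sigma> e) = stable_act e (st, h)" using state_\<sigma>[OF g] s by simp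
  have vg: "valid_state (stable_act e (st, h))" using valid_stable_act v(3) by blast
  have arc: "(g, \<sigma> e) \<in> nf_arcs G XG nfG \<longleftrightarrow>
      state_word (stable_act e (st, h)) = state_word (st, h) @ [\<sigma> e] \<or>
      state_word (st, h) = state_word (stable_act e (st, h)) @ [\<sigma> (\<not> e)]"
    using g by (simp add: nf_arcs_def nfG_def sg s \<sigma>_inv)
  have "(g, \<sigma> e) \<in> nf_arcs G XG nfG \<longleftrightarrow> b = \<one>"
  proof (cases "cancels e (st, h)")
    case False
    then have a: "stable_act e (st, h) = ((tr e h, e) # st, \<theta> e b)" by (simp add: stable_act_def b_def)
    have "b = \<one>" if "\<theta> e b = \<one>" using \<theta>_\<theta>[OF b(1)] that by simp
    then have "b = \<one>" if "(g, \<sigma> e) \<in> nf_arcs G XG nfG"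
      using that state_word_ends_stable[OF vg] state_word_ends_stable[OF v(3)] a tr_one
      unfolding arc by (auto simp: b_def rem_def)
    moreover have "(g, \<sigma> e) \<in> nf_arcs G XG nfG" if "b = \<one>"
    proof -
      have "tr e h = h" using b that v by simp
      then show ?thesis unfolding arc using that a by (simp add: state_word_def)
    qed
    ultimately show ?thesis by blast
  next
    case True
    then obtain t st' where st: "st = (t, \<not> e) # st'" and h: "tr e h = \<one>"
      by (cases st) (auto simp: cancels_def)
    have t: "t \<in> carrier H" using v st by auto
    have hb: "h = b" using b h by simp
    have a: "stable_act e (st, h) = (st', t \<otimes> \<theta> e b)" using True by (simp add: stable_act_def st b_def)
    show ?thesis
    proof
      assume "b = \<one>"
      then show "(g, \<sigma> e) \<in> nf_arcs G XG nfG" unfolding arc a using t hb by (simp add: state_word_def st)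
    next
      assume "(g, \<sigma> e) \<in> nf_arcs G XG nfG"
      then show "b = \<one>" unfolding arc
      proof
        assume eq: "state_word (stable_act e (st, h)) = state_word (st, h) @ [\<sigma> e]"
        then have "snd (stable_act e (st, h)) = \<one>" using state_word_ends_stable[OF vg] by blast
        then show ?thesis using eq unfolding a by (simp add: state_word_def st)
      next
        assume "state_word (st, h) = state_word (stable_act e (st, h)) @ [\<sigma> (\<not> e)]"
        then show ?thesis using state_word_ends_stable[OF v(3)] hb by fastforce
      qed
    qed
  qed
  then show ?thesis by (simp add: b_def s)
qed

text \<open>\<open>snd (state a)\<close> recovers \<open>x\<close> from \<open>\<iota> x\<close>,
  and comparison with \<open>\<sigma> True\<close> recovers the sign, so that group elements can be
  taken as arguments in place of tagged letters.\<close>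

definition \<phi>G :: "'a hnn_elem \<Rightarrow> 'a hnn_elem \<Rightarrow> 'a hnn_elem list" where
  "\<phi>G g a =
     (let h = snd (state g) in
      if a \<in> \<iota> ` X then map \<iota> (\<phi> h (snd (state a)))
      else let e = (a = \<sigma> True); b = rem e h in
        if b = \<one> then [a] else map \<iota> (wL e (ch e b)) @ [a] @ map \<iota> (wR e (ch e b)))"

lemma state_\<iota>_one: "h \<in> carrier H \<Longrightarrow> state (\<iota> h) = ([], h)"
  using state_stack_value[of "[]" h] by simp

lemma \<phi>G_\<iota>: "x \<in> X \<Longrightarrow> \<phi>G g (\<iota> x) = map \<iota> (\<phi> (snd (state g)) x)"
  by (simp add: \<phi>G_def state_\<iota>_one)

lemma \<sigma>_notin: "\<sigma> e \<notin> \<iota> ` X"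
  using \<sigma>_neq_\<iota>(1) by (metis X_closed imageE)

lemma \<phi>G_\<sigma>:
  "\<phi>G g (\<sigma> e) = (let b = rem e (snd (state g)) in
     if b = \<one> then [\<sigma> e] else map \<iota> (wL e (ch e b)) @ [\<sigma> e] @ map \<iota> (wR e (ch e b)))"
  using \<sigma>_notin[of e] by (simp add: \<phi>G_def Let_def \<sigma>_inj)

lemma walk_map_\<iota>:
  assumes "w \<in> lists X" "g \<in> carrier G" "(g', a') \<in> set (walk G g (map \<iota> w))"
  shows "\<exists>x\<in>X. g' \<in> carrier G \<and> a' = \<iota> x \<and> (snd (state g'), x) \<in> set (walk H (snd (state g)) w)"
  using assms
proof (induction w arbitrary: g)
  case (Cons x w)
  have x: "x \<in> X" using Cons.hyps(1) .
  have "(g', a') = (g, \<iota> x) \<or> (g', a') \<in> set (walk G (g \<cdot> \<iota> x) (map \<iota> w))" using Cons.prems by auto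
  then show ?case
  proof
    assume "(g', a') = (g, \<iota> x)"
    then show ?thesis using Cons.prems x by (intro bexI[of _ x]) auto
  next
    assume "(g', a') \<in> set (walk G (g \<cdot> \<iota> x) (map \<iota> w))"
    then show ?thesis using Cons.IH[of "g \<cdot> \<iota> x"] Cons.prems x by (auto simp: state_\<iota>_eq)
  qed
qed simp

lemma walk_append: "walk K g (u @ v) = walk K g u @ walk K (foldl (\<otimes>\<^bsub>K\<^esub>) g u) v"
  by (induction u arbitrary: g) auto

lemma foldl_map_\<iota>: "w \<in> lists X \<Longrightarrow> g \<in> carrier G \<Longrightarrow> foldl (\<cdot>) g (map \<iota> w) = g \<cdot> \<iota> (word_value H w)"
  by (induction w arbitrary: g) (auto simp: \<iota>_mult G.m_assoc)

lemma \<phi>G_value: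
  assumes g: "g \<in> carrier G" and a: "a \<in> XG"
  shows "\<phi>G g a \<in> lists XG" "word_value G (\<phi>G g a) = a" "(g, a) \<in> nf_arcs G XG nfG \<Longrightarrow> \<phi>G g a = [a]"
proof -
  define h where "h = snd (state g)"
  have h: "h \<in> carrier H" using state_closed[OF g] by (simp add: h_def)
  consider x where "x \<in> X" "a = \<iota> x" | e where "a = \<sigma> e" using a by (auto simp: XG_def)
  then have "\<phi>G g a \<in> lists XG \<and> word_value G (\<phi>G g a) = a \<and> ((g, a) \<in> nf_arcs G XG nfG \<longrightarrow> \<phi>G g a = [a])"
  proof cases
    case 1
    then show ?thesis using \<phi>_X[OF h, of x] \<phi>_value[OF h, of x] \<phi>_tree[OF h, of x] base_arc_iff[OF g, of x]
      by (auto simp: \<phi>G_\<iota> h_def[symmetric] map_\<iota>_XG word_value_map_\<iota>)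
  next
    case 2
    define b where "b = rem e h"
    show ?thesis
    proof (cases "b = \<one>")
      case True
      then show ?thesis using 2 by (simp add: \<phi>G_\<sigma> b_def h_def Let_def)
    next
      case False
      define j where "j = ch e b"
      define l where "l = word_value H (wL e j)"
      have j: "j < m e" using ch_less[OF _ False] rem_in[OF h] by (simp add: j_def b_def)
      have l: "l \<in> C e" "inv l \<in> C e" "l \<in> carrier H" using wL_C[OF j] C_inv C_carrier by (auto simp: l_def)
      \<comment> \<open>Moving \<open>l\<close> across the letter turns it into
        \<open>\<theta> e l\<close>, which meets its inverse.\<close>
      have "\<iota> l \<cdot> (\<sigma> e \<cdot> \<iota> (\<theta> e (inv l))) = \<sigma> e \<cdot> \<iota> (\<theta> e (l \<otimes> inv l))"
        unfolding \<theta>_mult[OF l(1,2)] using l \<iota>_\<sigma>[OF l(1)] by (simp add: \<iota>_mult G.m_assoc[symmetric])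
      then have "word_value G (map \<iota> (wL e j) @ [\<sigma> e] @ map \<iota> (wR e j)) = \<sigma> e"
        using l wL_X[OF j] wR_X[OF j] wR_value[OF j] map_\<iota>_XG
        by (simp add: word_value_map_\<iota> l_def[symmetric])
      moreover have "(g, \<sigma> e) \<notin> nf_arcs G XG nfG" using stable_arc_iff[OF g] False by (simp add: b_def h_def)
      ultimately show ?thesis using 2 False wL_X[OF j] wR_X[OF j] map_\<iota>_XG
        by (auto simp: \<phi>G_\<sigma> b_def[symmetric] h_def[symmetric] j_def[symmetric] Let_def)
    qed
  qed
  then show "\<phi>G g a \<in> lists XG" "word_value G (\<phi>G g a) = a" "(g, a) \<in> nf_arcs G XG nfG \<Longrightarrow> \<phi>G g a = [a]"
    by auto
qed

text \<open>Every \<open>H\<close>-edge ranks below every \<open>s\<close>-edge. Between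
  \<open>s\<close>-edges the measure of the remainder decides. Between \<open>H\<close>-edges the
  first component is constant, and the flow of \<open>H\<close> decides at the positions of the
  edges inside their cosets.\<close>

definition edge_rank :: "'a hnn_elem \<times> 'a hnn_elem \<Rightarrow> nat \<times> 'a \<times> 'a" where
  "edge_rank = (\<lambda>(g, a). let h = snd (state g); e = (a = \<sigma> True) in
     (if a \<in> \<iota> ` X then 0 else Suc (\<mu> e (rem e h)), h, snd (state a)))"

lemma edge_rank_simps:
  "x \<in> X \<Longrightarrow> edge_rank (g, \<iota> x) = (0, snd (state g), x)"
  "edge_rank (g, \<sigma> e) = (Suc (\<mu> e (rem e (snd (state g)))), snd (state g), \<one>)"
  using \<sigma>_notin[of e] by (simp_all add: edge_rank_def state_\<iota>_one state_\<sigma>_one \<sigma>_inj Let_def)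

lemma wf_word_flow_less_G: "wf (word_flow_less G XG nfG \<phi>G)"
proof (rule wf_subset)
  have "wf (word_flow_less H X nf \<phi>)" using flow by (simp add: word_flow_def)
  then show "wf (inv_image (less_than <*lex*> word_flow_less H X nf \<phi>) edge_rank)"
    by (intro wf_inv_image wf_lex_prod) auto
  show "word_flow_less G XG nfG \<phi>G \<subseteq> inv_image (less_than <*lex*> word_flow_less H X nf \<phi>) edge_rank"
  proof (rule subrelI)
    fix e' d assume "(e', d) \<in> word_flow_less G XG nfG \<phi>G"
    then obtain g a g' a' where ed: "e' = (g', a')" "d = (g, a)" and g: "g \<in> carrier G" and a: "a \<in> XG"
      and w: "(g', a') \<in> set (walk G g (\<phi>G g a))" and nt: "(g, a) \<notin> nf_arcs G XG nfG" "(g', a') \<notin> nf_arcs G XG nfG"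
      unfolding word_flow_less_def by (cases e') auto
    define h where "h = snd (state g)"
    have h: "h \<in> carrier H" using state_closed[OF g] by (simp add: h_def)
    consider x where "x \<in> X" "a = \<iota> x" | e where "a = \<sigma> e" using a by (auto simp: XG_def)
    then have "(edge_rank (g', a'), edge_rank (g, a)) \<in> less_than <*lex*> word_flow_less H X nf \<phi>"
    proof cases
      case 1
      have "(g', a') \<in> set (walk G g (map \<iota> (\<phi> h x)))" using w 1 by (simp add: \<phi>G_\<iota> h_def)
      then obtain x' where x': "x' \<in> X" "g' \<in> carrier G" "a' = \<iota> x'" "(snd (state g'), x') \<in> set (walk H h (\<phi> h x))"
        using walk_map_\<iota>[OF \<phi>_X[OF h 1(1)] g] by (auto simp: h_def)
      then have "((snd (state g'), x'), (h, x)) \<in> word_flow_less H X nf \<phi>"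
        using nt 1 h base_arc_iff[OF g 1(1)] base_arc_iff[OF x'(2,1)] by (auto simp: word_flow_less_def h_def)
      then show ?thesis using 1 x' by (simp add: edge_rank_simps h_def)
    next
      case 2
      define b where "b = rem e h"
      have b: "b \<noteq> \<one>" "b \<in> C e" using nt(1) 2 stable_arc_iff[OF g] rem_in[OF h] by (auto simp: b_def h_def)
      define j where "j = ch e b"
      define l where "l = word_value H (wL e j)"
      have j: "j < m e" using ch_less b by (simp add: j_def)
      have l: "l \<in> C e" "l \<in> carrier H" using wL_C[OF j] C_carrier by (auto simp: l_def)
      have gl: "g \<cdot> \<iota> l \<in> carrier G" using g l by simp
      have "\<phi>G g a = map \<iota> (wL e j) @ [\<sigma> e] @ map \<iota> (wR e j)"
        using 2 b by (simp add: \<phi>G_\<sigma> j_def b_def h_def Let_def)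
      then have cases: "(g', a') \<in> set (walk G g (map \<iota> (wL e j))) \<or> (g', a') = (g \<cdot> \<iota> l, \<sigma> e) \<or>
          (g', a') \<in> set (walk G (g \<cdot> \<iota> l \<cdot> \<sigma> e) (map \<iota> (wR e j)))"
        using w by (auto simp: walk_append foldl_map_\<iota>[OF wL_X[OF j] g] l_def)
      have "\<exists>x'\<in>X. a' = \<iota> x'" if "(g', a') \<in> set (walk G g (map \<iota> (wL e j)))"
        using walk_map_\<iota>[OF wL_X[OF j] g that] by blast
      moreover have "\<exists>x'\<in>X. a' = \<iota> x'" if "(g', a') \<in> set (walk G (g \<cdot> \<iota> l \<cdot> \<sigma> e) (map \<iota> (wR e j)))"
        using walk_map_\<iota>[OF wR_X[OF j] G.m_closed[OF gl \<sigma>_closed] that] by blast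
      ultimately have "(\<exists>x'\<in>X. a' = \<iota> x') \<or> (g', a') = (g \<cdot> \<iota> l, \<sigma> e)"
        using cases by blast
      then consider x' where "x' \<in> X" "a' = \<iota> x'" | "(g', a') = (g \<cdot> \<iota> l, \<sigma> e)"
        by blast
      then show ?thesis
      proof cases
        case 1
        then show ?thesis using 2 by (simp add: edge_rank_simps)
      next
        case stable: 2
        \<comment> \<open>The inner \<open>s\<close>-edge starts in the same coset of
          \<open>H\<close>, at \<open>h \<otimes> l\<close>, and \<open>l\<close> lies in
          \<open>C e\<close>, so it changes the remainder only.\<close>
        have "rem e (snd (state (g \<cdot> \<iota> l))) = b \<otimes> l"
          using state_\<iota>_eq[OF g l(2)] rem_mult[OF h l(1)] by (simp add: b_def h_def)
        then have "\<mu> e (rem e (snd (state (g \<cdot> \<iota> l)))) < \<mu> e (rem e (snd (state g)))"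
          using \<mu>_less[OF b(2,1)] by (simp add: l_def j_def b_def h_def)
        then show ?thesis using 2 stable by (simp add: edge_rank_simps)
      qed
    qed
    then show "(e', d) \<in> inv_image (less_than <*lex*> word_flow_less H X nf \<phi>) edge_rank" by (simp add: ed)
  qed
qed

lemma bounded_\<phi>G: "\<exists>k. \<forall>g\<in>carrier G. \<forall>a\<in>XG. length (\<phi>G g a) \<le> k"
proof -
  obtain k where k: "\<And>h x. h \<in> carrier H \<Longrightarrow> x \<in> X \<Longrightarrow> length (\<phi> h x) \<le> k"
    using flow unfolding word_flow_def by blast
  \<comment> \<open>The sum over all choices is a crude common bound for finitely many
    words.\<close>
  define n where "n e = (\<Sum>j<m e. length (wL e j) + length (wR e j))" for e
  have n: "length (wL e j) + length (wR e j) \<le> n e" if "j < m e" for e j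
    unfolding n_def using that by (intro member_le_sum) auto
  have "length (\<phi>G g a) \<le> k + Suc (n True) + n False" if g: "g \<in> carrier G" and a: "a \<in> XG" for g a
  proof -
    consider x where "x \<in> X" "a = \<iota> x" | e where "a = \<sigma> e" using a by (auto simp: XG_def)
    then show ?thesis
    proof cases
      case 1
      then show ?thesis using k[OF state_closed(1)[OF g], of x] by (simp add: \<phi>G_\<iota>)
    next
      case 2
      define b where "b = rem e (snd (state g))"
      have "length (wL e (ch e b)) + length (wR e (ch e b)) \<le> n e" if "b \<noteq> \<one>"
        using ch_less[OF _ that] rem_in[OF state_closed(1)[OF g]] by (intro n) (simp add: b_def)
      then have "length (\<phi>G g a) \<le> Suc (n e)" using 2 by (simp add: \<phi>G_\<sigma> b_def Let_def)
      then show ?thesis by (cases e) auto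
    qed
  qed
  then show ?thesis by blast
qed

lemma word_flow_G: "word_flow G XG nfG \<phi>G"
  unfolding word_flow_def
  using nf_system_nfG \<phi>G_value wf_word_flow_less_G bounded_\<phi>G by blast

lemma algorithmically_stackable_GI:
  assumes "decidable_rel 3 XG {[nfG g, [a], \<phi>G g a] | g a. g \<in> carrier G \<and> a \<in> XG}"
  shows "algorithmically_stackable G"
  unfolding algorithmically_stackable_def
  using assms word_flow_G one_XG fin_inv_closed_gen_set_XG GX.algorithmically_stackable_over_iff G.is_group
  by blast

end

section \<open>Computability of normal forms\<close>

locale coded_gen_group = gen_group H X for H (structure) and X +
  fixes c :: "'a \<Rightarrow> nat"
  assumes c_bij: "bij_betw c X {..<card X}"
begin

definition letter :: "nat \<Rightarrow> 'a" where "letter = inv_into X c"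

definition valid :: "nat list \<Rightarrow> bool" where "valid u \<longleftrightarrow> (\<forall>i\<in>set u. i < card X)"

definition cval :: "nat list \<Rightarrow> 'a" where "cval u = word_value H (map letter u)"

text \<open>Numbers that are not letters go to a default value, which turns the inversion of letters
  into a finite table.\<close>

definition inv_code :: "nat list \<Rightarrow> nat list" where
  "inv_code u = rev (map (\<lambda>i. if i < card X then c (inv (letter i)) else 0) u)"

lemma c_less: "x \<in> X \<Longrightarrow> c x < card X"
  using c_bij by (auto simp: bij_betw_def)

lemma letter_c [simp]: "x \<in> X \<Longrightarrow> letter (c x) = x"
  using c_bij by (simp add: letter_def bij_betw_def)

lemma letter_X [simp]: "i < card X \<Longrightarrow> letter i \<in> X" and c_letter [simp]: "i < card X \<Longrightarrow> c (letter i) = i"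
  using c_bij unfolding letter_def bij_betw_def by (metis inv_into_into lessThan_iff, metis f_inv_into_f lessThan_iff)

lemma valid_simps [simp]:
  "valid []" "valid (i # u) \<longleftrightarrow> i < card X \<and> valid u" "valid (u @ v) \<longleftrightarrow> valid u \<and> valid v"
  by (auto simp: valid_def)

lemma valid_map_c [simp]: "w \<in> lists X \<Longrightarrow> valid (map c w)"
  by (induction w) (auto simp: c_less)

lemma map_letter_c [simp]: "w \<in> lists X \<Longrightarrow> map letter (map c w) = w"
  by (induction w) auto

lemma map_letter_X [simp]: "valid u \<Longrightarrow> map letter u \<in> lists X"
  by (induction u) auto

lemma map_c_letter [simp]: "valid u \<Longrightarrow> map c (map letter u) = u"
  by (induction u) auto

lemma cval_map_c [simp]: "w \<in> lists X \<Longrightarrow> cval (map c w) = word_value H w"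
  unfolding cval_def by (simp only: map_letter_c)

lemma cval_Nil [simp]: "cval [] = \<one>"
  by (simp add: cval_def)

lemma cval_closed [simp]: "valid u \<Longrightarrow> cval u \<in> carrier H"
  by (simp add: cval_def)

lemma cval_append [simp]: "valid u \<Longrightarrow> valid v \<Longrightarrow> cval (u @ v) = cval u \<otimes> cval v"
  by (simp add: cval_def)

lemma cval_single [simp]: "i < card X \<Longrightarrow> cval [i] = letter i"
  by (simp add: cval_def)

lemma ex_code: "h \<in> carrier H \<Longrightarrow> \<exists>u. valid u \<and> cval u = h"
  using ex_word valid_map_c cval_map_c by metis

lemma inv_code_Cons: "inv_code (i # u) = inv_code u @ inv_code [i]"
  by (simp add: inv_code_def)

lemma valid_inv_code [simp]: "valid u \<Longrightarrow> valid (inv_code u)"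
  by (auto simp: valid_def inv_code_def c_less)

lemma cval_inv_code [simp]: "valid u \<Longrightarrow> cval (inv_code u) = inv (cval u)"
proof (induction u)
  case (Cons i u)
  have "cval (i # u) = cval [i] \<otimes> cval u" using cval_append[of "[i]" u] Cons.prems by simp
  moreover have "cval (inv_code [i]) = inv (letter i)"
    using Cons.prems cval_single[of "c (inv (letter i))"] by (simp add: inv_code_def c_less)
  ultimately show ?case using Cons inv_code_Cons[of i u] by (simp add: inv_mult_group)
qed (simp add: inv_code_def)

lemma decidable_valid [computable_intros]: "computable u \<Longrightarrow> decidable (\<lambda>x. valid (u x))"
  unfolding valid_def by (intro computable_intros)

lemma computable_inv_code [computable_intros]: "computable u \<Longrightarrow> computable (\<lambda>x. inv_code (u x))"
  unfolding inv_code_def by (intro computable_intros computable_finite_table)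

end

section \<open>The word problem of the base group\<close>

locale coded_flow = coded_gen_group +
  fixes nf :: "'a \<Rightarrow> 'a list" and \<phi> :: "'a \<Rightarrow> 'a \<Rightarrow> 'a list" and f :: "nat list \<Rightarrow> nat"
  assumes flow: "word_flow H X nf \<phi>"
    and f_recursive: "recursive_fn 3 f"
    and f_decides: "\<And>ws. length ws = 3 \<Longrightarrow> set ws \<subseteq> lists X \<Longrightarrow>
      f (map (word_code c) ws) = (if ws \<in> {[nf g, [a], \<phi> g a] | g a. g \<in> carrier H \<and> a \<in> X} then 1 else 0)"
begin

lemma nf_nf_system: "nf_system H X nf"
  using flow by (simp add: word_flow_def)

lemmas nf_in_X = nf_systemD(1)[OF nf_nf_system] and nf_word_value = nf_systemD(2)[OF nf_nf_system]

lemma flow_facts: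
  assumes "g \<in> carrier H" "x \<in> X"
  shows "\<phi> g x \<in> lists X" "word_value H (\<phi> g x) = x"
  using flow assms by (auto simp: word_flow_def)

lemma word_code_enc: "word_code c w = enc (map c w)"
  by (simp add: word_code_def enc_list_def enc_nat_def)

definition in_graph :: "nat list \<Rightarrow> nat list \<Rightarrow> nat list \<Rightarrow> bool" where
  "in_graph u v w \<longleftrightarrow> valid u \<and> valid v \<and> valid w \<and> f [enc u, enc v, enc w] = 1"

lemma in_graph_iff:
  "in_graph u v w \<longleftrightarrow> (\<exists>g\<in>carrier H. \<exists>a\<in>X. u = map c (nf g) \<and> v = [c a] \<and> w = map c (\<phi> g a))"
proof -
  have *: "f [enc u, enc v, enc w] = 1 \<longleftrightarrow>
      (\<exists>g a. [map letter u, map letter v, map letter w] = [nf g, [a], \<phi> g a] \<and> g \<in> carrier H \<and> a \<in> X)"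
    if v: "valid u" "valid v" "valid w"
    using f_decides[of "[map letter u, map letter v, map letter w]"] v
    by (simp add: word_code_enc del: map_map)
  show ?thesis
  proof
    assume g: "in_graph u v w"
    then obtain g a where ga: "map letter u = nf g" "map letter v = [a]" "map letter w = \<phi> g a" "g \<in> carrier H" "a \<in> X"
      using * by (auto simp: in_graph_def)
    have "valid u" "valid v" "valid w" using g by (auto simp: in_graph_def)
    then have "u = map c (map letter u)" "v = map c (map letter v)" "w = map c (map letter w)"
      by (simp_all del: map_map)
    then show "\<exists>g\<in>carrier H. \<exists>a\<in>X. u = map c (nf g) \<and> v = [c a] \<and> w = map c (\<phi> g a)"
      unfolding ga(1-3) using ga(4,5) by auto
  next
    assume "\<exists>g\<in>carrier H. \<exists>a\<in>X. u = map c (nf g) \<and> v = [c a] \<and> w = map c (\<phi> g a)"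
    then obtain g a where ga: "g \<in> carrier H" "a \<in> X" "u = map c (nf g)" "v = map c [a]" "w = map c (\<phi> g a)" by auto
    then have l: "map letter u = nf g" "map letter v = [a]" "map letter w = \<phi> g a"
      using nf_in_X flow_facts by (simp_all del: map_map)
    have "valid u" "valid v" "valid w" using ga nf_in_X flow_facts by (simp_all add: c_less)
    then show "in_graph u v w" unfolding in_graph_def using * l ga(1,2) by auto
  qed
qed

lemma decidable_in_graph [computable_intros]:
  assumes "computable u" "computable v" "computable w" shows "decidable (\<lambda>x. in_graph (u x) (v x) (w x))"
  unfolding in_graph_def
  by (intro computable_intros assms computable_recursive_fn3[OF f_recursive])

text \<open>The word problem of \<open>H\<close>: since the flow is bounded, the words \<open>x\<close> and \<open>\<phi> g x\<close> form finitely many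
  rewriting rules, and by well-founded induction along the flow every word can be rewritten to its
  normal form. The normal form is thus found by searching through all sequences of rewriting steps.\<close>

definition rules :: "(nat list \<times> nat list) set" where
  "rules = (\<Union>g\<in>carrier H. \<Union>x\<in>X. {([c x], map c (\<phi> g x))}) \<union> (\<Union>x\<in>X. {([c x, c (inv x)], [])})"

text \<open>A step names its context and its rule and is ignored when it does not apply. So every
  list of steps is meaningful, and the search can run through all lists.\<close>

definition rewrite :: "nat list \<Rightarrow> nat list \<times> (nat list \<times> nat list) \<times> nat list \<Rightarrow> nat list" where
  "rewrite z i = (if fst (snd i) \<in> rules \<and> z = fst i @ fst (fst (snd i)) @ snd (snd i)
     then fst i @ snd (fst (snd i)) @ snd (snd i) else z)"

definition reach :: "nat list \<Rightarrow> nat list \<Rightarrow> bool" where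
  "reach z z' \<longleftrightarrow> (\<exists>L. foldl rewrite z L = z')"

text \<open>There may be infinitely many \<open>g\<close>, but boundedness leaves finitely many
  words \<open>\<phi> g x\<close>. Hence membership in \<open>rules\<close> can be tested by a
  finite table.\<close>

lemma finite_rules: "finite rules"
proof -
  obtain k where k: "\<forall>g\<in>carrier H. \<forall>x\<in>X. length (\<phi> g x) \<le> k"
    using flow unfolding word_flow_def by blast
  have "finite {w. set w \<subseteq> X \<and> length w \<le> k}" by (rule finite_lists_length_le[OF finite_X])
  moreover have "(\<Union>g\<in>carrier H. \<Union>x\<in>X. {([c x], map c (\<phi> g x))}) \<subseteq>
      (\<lambda>(x, w). ([c x], map c w)) ` (X \<times> {w. set w \<subseteq> X \<and> length w \<le> k})"
  proof safe
    fix g x assume gx: "g \<in> carrier H" "x \<in> X"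
    then have "(x, \<phi> g x) \<in> X \<times> {w. set w \<subseteq> X \<and> length w \<le> k}"
      using k flow_facts(1)[OF gx] by (auto simp: in_lists_conv_set)
    then show "([c x], map c (\<phi> g x)) \<in> (\<lambda>(x, w). ([c x], map c w)) ` (X \<times> {w. set w \<subseteq> X \<and> length w \<le> k})"
      by (rule rev_image_eqI) simp
  qed
  ultimately have "finite (\<Union>g\<in>carrier H. \<Union>x\<in>X. {([c x], map c (\<phi> g x))})"
    using finite_X by (meson finite_SigmaI finite_imageI finite_subset)
  then show ?thesis unfolding rules_def using finite_X by simp
qed

lemma computable_rewrite [computable_intros]:
  "computable z \<Longrightarrow> computable i \<Longrightarrow> computable (\<lambda>x. rewrite (z x) (i x))"
  unfolding rewrite_def by (intro computable_intros decidable_finite_set finite_rules)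

lemma rules_sound: "(l, r) \<in> rules \<Longrightarrow> valid l \<and> valid r \<and> cval l = cval r"
proof -
  assume "(l, r) \<in> rules"
  then consider g x where "g \<in> carrier H" "x \<in> X" "l = map c [x]" "r = map c (\<phi> g x)"
    | x where "x \<in> X" "l = map c [x, inv x]" "r = map c []"
    unfolding rules_def by auto
  then show ?thesis
  proof cases
    case 1
    then show ?thesis using flow_facts[of g x] cval_map_c[of "[x]"] by (simp add: c_less)
  next
    case 2
    then show ?thesis using cval_map_c[of "[x, inv x]"] by (simp add: c_less)
  qed
qed

lemma rewrite_sound:
  assumes "valid z" shows "valid (rewrite z i) \<and> cval (rewrite z i) = cval z"
proof -
  obtain u l r v where i: "i = (u, (l, r), v)" by (metis prod.exhaust)
  show ?thesis using assms rules_sound[of l r] by (auto simp: rewrite_def i)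
qed

lemma foldl_rewrite_sound: "valid z \<Longrightarrow> valid (foldl rewrite z L) \<and> cval (foldl rewrite z L) = cval z"
  by (induction L arbitrary: z) (auto simp: rewrite_sound)

lemma reach_refl [simp]: "reach z z"
  unfolding reach_def by (rule exI[of _ "[]"]) simp

lemma reach_trans: "reach x y \<Longrightarrow> reach y z \<Longrightarrow> reach x z"
  unfolding reach_def by (metis foldl_append)

lemma reach_rule: "(l, r) \<in> rules \<Longrightarrow> reach (u @ l @ v) (u @ r @ v)"
  unfolding reach_def by (rule exI[of _ "[(u, (l, r), v)]"]) (simp add: rewrite_def)

text \<open>The suffix \<open>y\<close> is arbitrary because completions are chained inside a longer
  word.\<close>

definition completes :: "'a \<times> 'a \<Rightarrow> bool" where
  "completes e \<longleftrightarrow> (\<forall>y. reach (map c (nf (fst e)) @ [c (snd e)] @ y) (map c (nf (fst e \<otimes> snd e)) @ y))"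

lemma completes_walk:
  assumes "w \<in> lists X" "g \<in> carrier H" "\<forall>e\<in>set (walk H g w). completes e"
  shows "reach (map c (nf g) @ map c w @ y) (map c (nf (g \<otimes> word_value H w)) @ y)"
  using assms
proof (induction w arbitrary: g)
  case (Cons x w)
  have x: "x \<in> X" "w \<in> lists X" using Cons.hyps by auto
  have "reach (map c (nf g) @ [c x] @ map c w @ y) (map c (nf (g \<otimes> x)) @ map c w @ y)"
    using Cons.prems(2) unfolding completes_def by fastforce
  moreover have "reach (map c (nf (g \<otimes> x)) @ map c w @ y) (map c (nf (g \<otimes> x \<otimes> word_value H w)) @ y)"
    using Cons.prems x by (intro Cons.IH) auto
  ultimately show ?case using x Cons.prems(1) by (auto simp: m_assoc intro: reach_trans)
qed simp

text \<open>A tree edge takes at most one cancellation. For any other edge \<open>x\<close> is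
  replaced by \<open>\<phi> g x\<close>, and each edge of that walk is a tree edge or smaller with
  respect to the flow.\<close>

lemma completes_arc: "g \<in> carrier H \<Longrightarrow> x \<in> X \<Longrightarrow> completes (g, x)"
proof -
  have "wf (word_flow_less H X nf \<phi>)" using flow by (simp add: word_flow_def)
  then have "fst e \<in> carrier H \<and> snd e \<in> X \<longrightarrow> completes e" for e
  proof (induction e rule: wf_induct_rule)
    case (less e)
    show ?case
    proof
      obtain g x where e: "e = (g, x)" by fastforce
      assume "fst e \<in> carrier H \<and> snd e \<in> X"
      then have gx: "g \<in> carrier H" "x \<in> X" by (auto simp: e)
      have arc: "completes (g, x)" if gx: "(g, x) \<in> nf_arcs H X nf" "g \<in> carrier H" "x \<in> X" for g x
      proof -
        consider "nf (g \<otimes> x) = nf g @ [x]" | "nf g = nf (g \<otimes> x) @ [inv x]"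
          using gx(1) by (auto simp: nf_arcs_def)
        then show ?thesis
        proof cases
          case 1
          then show ?thesis by (simp add: completes_def)
        next
          case 2
          \<comment> \<open>The cancellation rule of the letter \<open>inv x\<close> is the one that
            deletes \<open>inv x, x\<close>.\<close>
          have "([c (inv x), c (inv (inv x))], []) \<in> rules" using gx inv_X unfolding rules_def by blast
          then have "([c (inv x), c x], []) \<in> rules" using gx by simp
          from reach_rule[OF this] show ?thesis unfolding completes_def using 2 by simp
        qed
      qed
      show "completes e"
      proof (cases "(g, x) \<in> nf_arcs H X nf")
        case True
        then show ?thesis using arc gx e by simp
      next
        case False
        have "completes d" if d: "d \<in> set (walk H g (\<phi> g x))" for d
        proof -
          have dc: "fst d \<in> carrier H \<and> snd d \<in> X" using set_walk[OF gx(1) flow_facts(1)[OF gx]] d by auto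
          show ?thesis
          proof (cases "d \<in> nf_arcs H X nf")
            case True
            then show ?thesis using arc[of "fst d" "snd d"] dc by simp
          next
            case nt: False
            then have "(d, e) \<in> word_flow_less H X nf \<phi>" using False gx d by (simp add: word_flow_less_def e)
            then show ?thesis using less dc by blast
          qed
        qed
        then have "reach (map c (nf g) @ map c (\<phi> g x) @ y) (map c (nf (g \<otimes> x)) @ y)" for y
          using completes_walk[OF flow_facts(1)[OF gx] gx(1), of y] flow_facts(2)[OF gx] by simp
        moreover have "reach (map c (nf g) @ [c x] @ y) (map c (nf g) @ map c (\<phi> g x) @ y)" for y
          by (rule reach_rule) (use gx in \<open>auto simp: rules_def\<close>)
        ultimately show ?thesis unfolding completes_def e by (auto intro: reach_trans)
      qed
    qed
  qed
  then show "g \<in> carrier H \<Longrightarrow> x \<in> X \<Longrightarrow> completes (g, x)" by simp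
qed

lemma reach_nf: assumes "valid u" shows "reach u (map c (nf (cval u)))"
proof -
  have w: "map letter u \<in> lists X" using assms by simp
  have "\<forall>e\<in>set (walk H \<one> (map letter u)). completes e"
    using set_walk[OF one_closed w] completes_arc by auto
  from completes_walk[OF w one_closed this, of "[]"] show ?thesis
    using assms nf_one[OF nf_nf_system] by (simp add: cval_def del: map_map)
qed

definition is_nf_search :: "nat list \<Rightarrow> (nat list \<times> (nat list \<times> nat list) \<times> nat list) list \<times> nat list \<Rightarrow> bool" where
  "is_nf_search u q \<longleftrightarrow> valid u \<longrightarrow>
     (foldl rewrite u (fst q) = [] \<or> in_graph (foldl rewrite u (fst q)) [0] (snd q))"

definition nf_code :: "nat list \<Rightarrow> nat list" where
  "nf_code u = foldl rewrite u (fst (enc_least (is_nf_search u)))"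

lemma ex_is_nf_search: "\<exists>q. is_nf_search u q"
proof (cases "valid u \<and> nf (cval u) \<noteq> []")
  case True
  obtain L where L: "foldl rewrite u L = map c (nf (cval u))" using reach_nf[of u] True by (auto simp: reach_def)
  have "X \<noteq> {}" using True nf_in_X[of "cval u"] by (auto simp: in_lists_conv_set)
  then have "0 < card X" using finite_X by auto
  then have "in_graph (foldl rewrite u L) [0] (map c (\<phi> (cval u) (letter 0)))"
    using True L unfolding in_graph_iff by (intro bexI[of _ "cval u"] bexI[of _ "letter 0"]) auto
  then show ?thesis by (intro exI[of _ "(L, map c (\<phi> (cval u) (letter 0)))"]) (simp add: is_nf_search_def)
next
  case False
  then obtain L where "valid u \<longrightarrow> foldl rewrite u L = []" using reach_nf[of u] by (auto simp: reach_def)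
  then show ?thesis by (intro exI[of _ "(L, [])"]) (simp add: is_nf_search_def)
qed

text \<open>The word found is a normal form, and rewriting has preserved its value. This determines
  it, whichever steps the search has used.\<close>

lemma nf_code: assumes "valid u" shows "nf_code u = map c (nf (cval u))"
proof -
  obtain q0 where "is_nf_search u q0" using ex_is_nf_search by blast
  then have s: "is_nf_search u (enc_least (is_nf_search u))" by (rule enc_least)
  define v where "v = nf_code u"
  have v: "valid v" "cval v = cval u" using foldl_rewrite_sound[OF assms] by (auto simp: v_def nf_code_def)
  have "v = [] \<or> (\<exists>w. in_graph v [0] w)" using s assms by (auto simp: is_nf_search_def v_def nf_code_def)
  then have "\<exists>g\<in>carrier H. v = map c (nf g)"
  proof
    assume "v = []"
    then show ?thesis using nf_one[OF nf_nf_system] by (intro bexI[of _ \<one>]) auto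
  qed (auto simp: in_graph_iff)
  then obtain g where g: "g \<in> carrier H" "v = map c (nf g)" by blast
  then have "cval v = g" using nf_in_X nf_word_value by simp
  then show ?thesis using g v by (simp add: v_def)
qed

lemma computable_nf_code [computable_intros]: assumes "computable u" shows "computable (\<lambda>x. nf_code (u x))"
proof -
  have "computable (\<lambda>u. enc_least (is_nf_search u))"
  proof (rule computable_enc_least)
    show "decidable (\<lambda>p. is_nf_search (fst p) (snd p))"
      unfolding is_nf_search_def by (intro computable_intros)
  qed (rule ex_is_nf_search)
  then have "computable nf_code"
    unfolding nf_code_def by (intro computable_intros)
  then show ?thesis using assms by (rule computable_comp)
qed

lemma nf_inj: "g \<in> carrier H \<Longrightarrow> h \<in> carrier H \<Longrightarrow> map c (nf g) = map c (nf h) \<longleftrightarrow> g = h"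
  using nf_in_X nf_word_value cval_map_c by metis

lemma nf_code_eq_iff: "valid u \<Longrightarrow> valid v \<Longrightarrow> nf_code u = nf_code v \<longleftrightarrow> cval u = cval v"
  by (simp add: nf_code nf_inj)

end

text \<open>The sign of a stack entry is stored as \<open>0\<close> or \<open>1\<close>, since a
  type with a bijective \<open>enc\<close> is infinite.\<close>

type_synonym coded_state = "(nat list \<times> nat) list \<times> nat list"

section \<open>Representatives and factorizations of least code\<close>

locale coded_hnn = coded_flow H X c nf \<phi> f
  for H (structure) and X c nf \<phi> f +
  fixes C :: "bool \<Rightarrow> 'a set" and \<theta> :: "bool \<Rightarrow> 'a \<Rightarrow> 'a" and M :: "bool \<Rightarrow> nat list \<Rightarrow> bool"
    and gen wR :: "bool \<Rightarrow> nat \<Rightarrow> 'a list" and m :: "bool \<Rightarrow> nat"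
  assumes one_notin_X: "\<one> \<notin> X"
    and subgroup_Ce: "subgroup (C e) H"
    and \<theta>_hom: "x \<in> C e \<Longrightarrow> y \<in> C e \<Longrightarrow> \<theta> e (x \<otimes> y) = \<theta> e x \<otimes> \<theta> e y"
    and \<theta>_in: "x \<in> C e \<Longrightarrow> \<theta> e x \<in> C (\<not> e)"
    and \<theta>_left_inv: "x \<in> C e \<Longrightarrow> \<theta> (\<not> e) (\<theta> e x) = x"
    and M_decidable: "decidable (M e)"
    and M_iff: "valid u \<Longrightarrow> M e u \<longleftrightarrow> cval u \<in> C e"
    and gen_X: "j < m e \<Longrightarrow> gen e j \<in> lists X"
    and gen_C: "j < m e \<Longrightarrow> word_value H (gen e j) \<in> C e"
    and wR_in_X: "j < m e \<Longrightarrow> wR e j \<in> lists X"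
    and wR_val: "j < m e \<Longrightarrow> word_value H (wR e j) = \<theta> e (word_value H (gen e j))"
    and C_generated: "b \<in> C e \<Longrightarrow>
      \<exists>L. (\<forall>j\<in>set L. j < m e) \<and> foldr (\<lambda>j h. h \<otimes> word_value H (gen e j)) L \<one> = b"
begin

text \<open>The word may represent any element of the coset of \<open>h\<close>, so the least one
  depends on the coset only. The empty word has the smallest code of all, which gives
  \<open>tr e \<one> = \<one>\<close>.\<close>

definition tr :: "bool \<Rightarrow> 'a \<Rightarrow> 'a" where
  "tr e h = cval (enc_least (\<lambda>w. valid w \<and> inv (cval w) \<otimes> h \<in> C e))"

text \<open>Products are evaluated from right to left, so that the last factor is the head of the list and
  removing it decreases the code of the list.\<close>

definition gen_product :: "bool \<Rightarrow> nat list \<Rightarrow> 'a" where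
  "gen_product e L = foldr (\<lambda>j h. h \<otimes> word_value H (gen e j)) L \<one>"

definition gen_list :: "bool \<Rightarrow> 'a \<Rightarrow> nat list" where
  "gen_list e b = enc_least (\<lambda>L. (\<forall>j\<in>set L. j < m e) \<and> gen_product e L = b)"

definition first :: "nat list \<Rightarrow> nat" where
  "first L = (case L of [] \<Rightarrow> 0 | j # _ \<Rightarrow> j)"

definition wL :: "bool \<Rightarrow> nat \<Rightarrow> 'a list" where "wL e j = inverse_word H (gen e j)"
definition ch :: "bool \<Rightarrow> 'a \<Rightarrow> nat" where "ch e b = first (gen_list e b)"
definition \<mu> :: "bool \<Rightarrow> 'a \<Rightarrow> nat" where "\<mu> e b = enc (gen_list e b)"

lemma Ce_carrier: "x \<in> C e \<Longrightarrow> x \<in> carrier H"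
  using subgroup.mem_carrier[OF subgroup_Ce] .

lemma Ce_closed: "\<one> \<in> C e" "x \<in> C e \<Longrightarrow> y \<in> C e \<Longrightarrow> x \<otimes> y \<in> C e" "x \<in> C e \<Longrightarrow> inv x \<in> C e"
  using subgroup.one_closed[OF subgroup_Ce] subgroup.m_closed[OF subgroup_Ce]
    subgroup.m_inv_closed[OF subgroup_Ce] by auto

lemma tr_spec:
  assumes "h \<in> carrier H"
  shows "valid (enc_least (\<lambda>w. valid w \<and> inv (cval w) \<otimes> h \<in> C e))" "inv (tr e h) \<otimes> h \<in> C e"
proof -
  obtain u where "valid u" "cval u = h" using ex_code[OF assms] by blast
  then have "valid u \<and> inv (cval u) \<otimes> h \<in> C e" using assms Ce_closed(1) by simp
  from enc_least(1)[of "\<lambda>w. valid w \<and> inv (cval w) \<otimes> h \<in> C e", OF this]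
  show "valid (enc_least (\<lambda>w. valid w \<and> inv (cval w) \<otimes> h \<in> C e))" "inv (tr e h) \<otimes> h \<in> C e"
    unfolding tr_def by auto
qed

sublocale hnn_data H C \<theta> tr
proof unfold_locales
  fix e h assume h: "h \<in> carrier H"
  show "tr e h \<in> carrier H" "inv (tr e h) \<otimes> h \<in> C e" using tr_spec[OF h, of e] by (auto simp: tr_def)
  fix k assume k: "k \<in> C e"
  have "x \<otimes> (h \<otimes> k) \<in> C e \<longleftrightarrow> x \<otimes> h \<in> C e" if "x \<in> carrier H" for x
  proof
    assume "x \<otimes> (h \<otimes> k) \<in> C e"
    then have "x \<otimes> (h \<otimes> k) \<otimes> inv k \<in> C e" using k by (simp add: Ce_closed)
    then show "x \<otimes> h \<in> C e" using that h Ce_carrier[OF k] by (simp add: m_assoc)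
  next
    assume "x \<otimes> h \<in> C e"
    then have "x \<otimes> h \<otimes> k \<in> C e" using k by (simp add: Ce_closed)
    then show "x \<otimes> (h \<otimes> k) \<in> C e" using that h Ce_carrier[OF k] by (simp add: m_assoc)
  qed
  then have "(\<lambda>w. valid w \<and> inv (cval w) \<otimes> (h \<otimes> k) \<in> C e) = (\<lambda>w. valid w \<and> inv (cval w) \<otimes> h \<in> C e)"
    by auto
  then show "tr e (h \<otimes> k) = tr e h" by (simp add: tr_def)
next
  fix e
  have "enc (enc_least (\<lambda>w. valid w \<and> inv (cval w) \<otimes> \<one> \<in> C e)) = enc ([] :: nat list)"
    using enc_least(2)[of "\<lambda>w. valid w \<and> inv (cval w) \<otimes> \<one> \<in> C e" "[]"] Ce_closed(1) by simp
  then have "enc_least (\<lambda>w. valid w \<and> inv (cval w) \<otimes> \<one> \<in> C e) = []" by (simp only: enc_eq_iff)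
  then show "tr e \<one> = \<one>" by (simp add: tr_def)
qed (use Ce_carrier Ce_closed \<theta>_hom \<theta>_in \<theta>_left_inv in auto)

lemma gen_product_simps [simp]:
  "gen_product e [] = \<one>" "gen_product e (j # L) = gen_product e L \<otimes> word_value H (gen e j)"
  by (simp_all add: gen_product_def)

lemma gen_product_C: "\<forall>j\<in>set L. j < m e \<Longrightarrow> gen_product e L \<in> C e"
  by (induction L) (auto simp: Ce_closed gen_C)

lemma gen_list:
  assumes "b \<in> C e" shows "\<forall>j\<in>set (gen_list e b). j < m e" "gen_product e (gen_list e b) = b"
proof -
  obtain L where "(\<forall>j\<in>set L. j < m e) \<and> gen_product e L = b"
    using C_generated[OF assms] unfolding gen_product_def by blast
  from enc_least(1)[of "\<lambda>L. (\<forall>j\<in>set L. j < m e) \<and> gen_product e L = b", OF this]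
  show "\<forall>j\<in>set (gen_list e b). j < m e" "gen_product e (gen_list e b) = b"
    unfolding gen_list_def by auto
qed

lemma gen_list_Cons:
  assumes "b \<in> C e" "b \<noteq> \<one>"
  obtains L where "gen_list e b = ch e b # L" "ch e b < m e" "\<forall>j\<in>set L. j < m e"
    "b = gen_product e L \<otimes> word_value H (gen e (ch e b))"
proof -
  obtain j L where L: "gen_list e b = j # L" using gen_list(2)[OF assms(1)] assms(2) by (cases "gen_list e b") auto
  then have "ch e b = j" by (simp add: ch_def first_def)
  then show ?thesis using that[of L] L gen_list[OF assms(1)] by simp
qed

text \<open>Multiplication by the word \<open>wL\<close> removes the last factor of
  \<open>b\<close>, the head of its list. The tail of the list factors the result, so the least list
  for the result has at most the code of the tail, which is below the code of the whole
  list.\<close>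

sublocale hnn_flow H C \<theta> tr X nf \<phi> wL wR ch \<mu> m
proof unfold_locales
  show "\<one> \<notin> X" "word_flow H X nf \<phi>" using one_notin_X flow by auto
  fix e b assume b: "b \<in> C e" "b \<noteq> \<one>"
  obtain L where L: "gen_list e b = ch e b # L" "ch e b < m e" "\<forall>j\<in>set L. j < m e"
    "b = gen_product e L \<otimes> word_value H (gen e (ch e b))" using gen_list_Cons[OF b] by blast
  show "ch e b < m e" by (rule L)
  have "b \<otimes> word_value H (wL e (ch e b)) = gen_product e L"
    using arg_cong[OF L(4), of "\<lambda>x. x \<otimes> word_value H (wL e (ch e b))"] gen_X[OF L(2)]
      Ce_carrier[OF gen_product_C[OF L(3)]]
    by (simp add: wL_def)
  then have "\<mu> e (b \<otimes> word_value H (wL e (ch e b))) \<le> enc L"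
    using enc_least(2)[of "\<lambda>K. (\<forall>j\<in>set K. j < m e) \<and> gen_product e K = gen_product e L" L] L(3)
    by (simp add: \<mu>_def gen_list_def)
  also have "enc L < \<mu> e b"
    using L(1) le_prod_encode_2[of "enc L" "enc (ch e b)"] by (simp add: \<mu>_def)
  finally show "\<mu> e (b \<otimes> word_value H (wL e (ch e b))) < \<mu> e b" .
next
  fix e j assume j: "j < m e"
  show "wL e j \<in> lists X" "wR e j \<in> lists X" "word_value H (wL e j) \<in> C e"
    "word_value H (wR e j) = \<theta> e (inv (word_value H (wL e j)))"
    using gen_X[OF j] gen_C[OF j] wR_in_X[OF j] wR_val[OF j] by (simp_all add: wL_def Ce_closed)
qed

section \<open>Computing representatives, remainders and the isomorphisms\<close>

lemma decidable_M [computable_intros]: "computable u \<Longrightarrow> decidable (\<lambda>x. M e (u x))"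
  using decidable_comp[OF M_decidable] .

definition tr_code :: "bool \<Rightarrow> nat list \<Rightarrow> nat list" where
  "tr_code e u = nf_code (enc_least (\<lambda>w. valid u \<longrightarrow> valid w \<and> M e (inv_code w @ u)))"

text \<open>On valid input the search predicate coincides with the one in \<open>tr\<close>, so the
  least solutions coincide and the algorithm returns the very representative used in the
  tree.\<close>

lemma tr_code: assumes "valid u" shows "tr_code e u = map c (nf (tr e (cval u)))"
proof -
  have "(\<lambda>w. valid u \<longrightarrow> valid w \<and> M e (inv_code w @ u)) = (\<lambda>w. valid w \<and> inv (cval w) \<otimes> cval u \<in> C e)"
    using assms by (auto simp: M_iff)
  then show ?thesis using tr_spec(1)[of "cval u" e] assms by (simp add: tr_code_def tr_def nf_code)
qed

lemma computable_tr_code [computable_intros]: assumes "computable u" shows "computable (\<lambda>x. tr_code e (u x))"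
proof -
  have "computable (\<lambda>u. enc_least (\<lambda>w. valid u \<longrightarrow> valid w \<and> M e (inv_code w @ u)))"
  proof (rule computable_enc_least)
    show "decidable (\<lambda>p. valid (fst p) \<longrightarrow> valid (snd p) \<and> M e (inv_code (snd p) @ fst p))"
      by (intro computable_intros)
    \<comment> \<open>The word \<open>u\<close> itself represents an element of its coset.\<close>
    show "\<exists>w. valid u \<longrightarrow> valid w \<and> M e (inv_code w @ u)" for u
      using tr_spec(1)[of "cval u" e] tr_spec(2)[of "cval u" e] Ce_closed(1)
      by (intro exI[of _ u]) (auto simp: M_iff)
  qed
  then have "computable (tr_code e)" unfolding tr_code_def by (intro computable_intros)
  then show ?thesis using assms by (rule computable_comp)
qed

definition rem_code :: "bool \<Rightarrow> nat list \<Rightarrow> nat list" where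
  "rem_code e u = nf_code (inv_code (tr_code e u) @ u)"

lemma nf_closed: "h \<in> carrier H \<Longrightarrow> valid (map c (nf h))" "h \<in> carrier H \<Longrightarrow> cval (map c (nf h)) = h"
  using nf_in_X nf_word_value by auto

lemma rem_code: "valid u \<Longrightarrow> rem_code e u = map c (nf (rem e (cval u)))"
  by (simp add: rem_code_def nf_code tr_code nf_closed rem_def del: valid_map_c cval_map_c)

lemma computable_rem_code [computable_intros]: "computable u \<Longrightarrow> computable (\<lambda>x. rem_code e (u x))"
  unfolding rem_code_def by (intro computable_intros)

text \<open>The list is reversed because its head is the last factor; the test \<open>j < n\<close>
  makes the words a finite table.\<close>

definition product_code :: "(nat \<Rightarrow> 'a list) \<Rightarrow> nat \<Rightarrow> nat list \<Rightarrow> nat list" where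
  "product_code w n L = concat (map (\<lambda>j. if j < n then map c (w j) else []) (rev L))"

lemma computable_product_code [computable_intros]:
  "computable L \<Longrightarrow> computable (\<lambda>x. product_code w n (L x))"
  unfolding product_code_def
  by (intro computable_intros computable_finite_table[where f = "\<lambda>j. map c (w j)"])

lemma product_code_Cons [simp]:
  "product_code w n [] = []" "j < n \<Longrightarrow> product_code w n (j # L) = product_code w n L @ map c (w j)"
  by (simp_all add: product_code_def)

lemma valid_product_code: "(\<And>j. j < n \<Longrightarrow> w j \<in> lists X) \<Longrightarrow> valid (product_code w n L)"
  by (induction L) (auto simp: product_code_def)

lemma cval_product_code_gen:
  "\<forall>j\<in>set L. j < m e \<Longrightarrow> cval (product_code (gen e) (m e) L) = gen_product e L"
  by (induction L) (simp_all add: valid_product_code gen_X)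

text \<open>As \<open>\<theta> e\<close> is multiplicative, it is evaluated by replacing each
  generator in a factorization by a word for its image. The isomorphism is thereby reduced to
  finitely many stored words.\<close>

lemma cval_product_code_wR:
  "\<forall>j\<in>set L. j < m e \<Longrightarrow> cval (product_code (wR e) (m e) L) = \<theta> e (gen_product e L)"
  by (induction L) (simp_all add: valid_product_code wR_in_X wR_val \<theta>_mult gen_product_C gen_C)

text \<open>Equality in \<open>H\<close> is tested on normal forms, that is, by the word problem.
  The premise keeps the search total.\<close>

definition gen_list_code :: "bool \<Rightarrow> nat list \<Rightarrow> nat list" where
  "gen_list_code e u = enc_least (\<lambda>L. valid u \<and> M e u \<longrightarrow>
     (\<forall>j\<in>set L. j < m e) \<and> nf_code (product_code (gen e) (m e) L) = nf_code u)"

lemma gen_list_code_iff: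
  "valid u \<Longrightarrow> M e u \<Longrightarrow>
    (\<forall>j\<in>set L. j < m e) \<and> nf_code (product_code (gen e) (m e) L) = nf_code u \<longleftrightarrow>
    (\<forall>j\<in>set L. j < m e) \<and> gen_product e L = cval u"
  using nf_code_eq_iff[of "product_code (gen e) (m e) L" u] valid_product_code[of "m e" "gen e" L] gen_X
    cval_product_code_gen[of L e] by metis

lemma gen_list_code: "valid u \<Longrightarrow> cval u \<in> C e \<Longrightarrow> gen_list_code e u = gen_list e (cval u)"
  by (simp add: gen_list_code_def gen_list_def gen_list_code_iff M_iff)

lemma computable_gen_list_code [computable_intros]:
  assumes "computable u" shows "computable (\<lambda>x. gen_list_code e (u x))"
proof -
  have "computable (gen_list_code e)"
    unfolding gen_list_code_def
  proof (rule computable_enc_least)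
    show "decidable (\<lambda>p. valid (fst p) \<and> M e (fst p) \<longrightarrow>
        (\<forall>j\<in>set (snd p). j < m e) \<and> nf_code (product_code (gen e) (m e) (snd p)) = nf_code (fst p))"
      by (intro computable_intros)
    show "\<exists>L. valid u \<and> M e u \<longrightarrow>
        (\<forall>j\<in>set L. j < m e) \<and> nf_code (product_code (gen e) (m e) L) = nf_code u" for u
      using gen_list_code_iff[of u e] gen_list[of "cval u" e] M_iff[of u e] by blast
  qed
  then show ?thesis using assms by (rule computable_comp)
qed

definition \<theta>_code :: "bool \<Rightarrow> nat list \<Rightarrow> nat list" where
  "\<theta>_code e u = nf_code (product_code (wR e) (m e) (gen_list_code e u))"

lemma \<theta>_code: "valid u \<Longrightarrow> cval u \<in> C e \<Longrightarrow> \<theta>_code e u = map c (nf (\<theta> e (cval u)))"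
  using gen_list[of "cval u" e]
  by (simp add: \<theta>_code_def gen_list_code nf_code valid_product_code wR_in_X cval_product_code_wR)

lemma computable_\<theta>_code [computable_intros]: "computable u \<Longrightarrow> computable (\<lambda>x. \<theta>_code e (u x))"
  unfolding \<theta>_code_def by (intro computable_intros)

section \<open>Evaluation of words in the extension\<close>

definition state_code :: "'a hnn_state \<Rightarrow> coded_state" where
  "state_code \<omega> = (map (\<lambda>p. (map c (nf (fst p)), of_bool (snd p))) (fst \<omega>), map c (nf (snd \<omega>)))"

text \<open>Mirrors \<open>stable_act\<close>; as elements are stored by their normal forms, the
  test \<open>tr e h = \<one>\<close> becomes a comparison with the empty list.\<close>

definition stable_code :: "bool \<Rightarrow> coded_state \<Rightarrow> coded_state" where
  "stable_code e s =
     (case fst s of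
        [] \<Rightarrow> ([(tr_code e (snd s), of_bool e)], \<theta>_code e (rem_code e (snd s)))
      | p # S \<Rightarrow>
          if tr_code e (snd s) = [] \<and> snd p = of_bool (\<not> e)
          then (S, nf_code (fst p @ \<theta>_code e (rem_code e (snd s))))
          else ((tr_code e (snd s), of_bool e) # p # S, \<theta>_code e (rem_code e (snd s))))"

lemma computable_stable_code [computable_intros]: "computable s \<Longrightarrow> computable (\<lambda>x. stable_code e (s x))"
proof -
  have "computable (stable_code e)" unfolding stable_code_def by (intro computable_intros)
  then show "computable s \<Longrightarrow> computable (\<lambda>x. stable_code e (s x))" by (rule computable_comp)
qed

lemma stable_code:
  assumes "valid_state \<omega>" shows "stable_code e (state_code \<omega>) = state_code (stable_act e \<omega>)"
proof -
  obtain st h where \<omega>: "\<omega> = (st, h)" by fastforce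
  have v: "valid_stack st" "h \<in> carrier H" using assms by (auto simp: \<omega> valid_state_def)
  have b: "rem e h \<in> C e" using rem_in[OF v(2)] .
  note nfh = nf_closed[OF v(2)]
  have t: "tr_code e (map c (nf h)) = map c (nf (tr e h))" using tr_code nfh by metis
  have "rem_code e (map c (nf h)) = map c (nf (rem e h))" using rem_code nfh by metis
  then have r: "\<theta>_code e (rem_code e (map c (nf h))) = map c (nf (\<theta> e (rem e h)))"
    using \<theta>_code[of "map c (nf (rem e h))" e] nf_closed[of "rem e h"] b Ce_carrier[OF b] by metis
  have t1: "tr_code e (map c (nf h)) = [] \<longleftrightarrow> tr e h = \<one>"
    unfolding t using nf_Nil_iff[of "tr e h"] v by simp
  show ?thesis
  proof (cases st)
    case Nil
    then show ?thesis
      by (simp add: \<omega> stable_code_def state_code_def stable_act_def cancels_def t r)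
  next
    case (Cons p S)
    have p: "fst p \<in> carrier H" using v Cons by (cases p) auto
    have "nf_code (map c (nf (fst p)) @ map c (nf (\<theta> e (rem e h)))) = map c (nf (fst p \<otimes> \<theta> e (rem e h)))"
      using nf_closed[OF p] nf_closed[OF \<theta>_carrier[OF b]] by (simp add: nf_code del: valid_map_c cval_map_c)
    moreover have "(of_bool (snd p) = (of_bool (\<not> e) :: nat)) \<longleftrightarrow> snd p = (\<not> e)" by simp
    ultimately show ?thesis using t1
      by (simp add: \<omega> Cons stable_code_def state_code_def stable_act_def cancels_def t r)
  qed
qed

text \<open>The letters of \<open>X\<close> keep their numbers and the stable letters take the next
  two, so the algorithms of \<open>H\<close> apply unchanged to base letters.\<close>

definition letter_code :: "'a hnn_elem \<Rightarrow> nat" where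
  "letter_code a = (if a \<in> \<iota> ` X then c (snd (state a)) else if a = \<sigma> True then card X else Suc (card X))"

lemma letter_code_simps [simp]:
  "x \<in> X \<Longrightarrow> letter_code (\<iota> x) = c x" "letter_code (\<sigma> e) = (if e then card X else Suc (card X))"
  using \<sigma>_notin[of e] by (auto simp: letter_code_def state_\<iota>_one \<sigma>_inj)

lemma bij_letter_code: "bij_betw letter_code XG {..<card XG}" and card_XG: "card XG = card X + 2"
proof -
  have inj: "inj_on letter_code XG"
  proof (rule inj_onI)
    fix a b assume "a \<in> XG" "b \<in> XG" "letter_code a = letter_code b"
    moreover have "c x < card X" if "x \<in> X" for x using c_less[OF that] .
    moreover have "x = y" if "c x = c y" "x \<in> X" "y \<in> X" for x y using letter_c that by metis
    ultimately show "a = b" unfolding XG_def by (auto split: if_splits) (metis less_irrefl not_less_eq less_SucI)+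
  qed
  have "letter_code ` XG = {..<card X + 2}"
  proof
    show "letter_code ` XG \<subseteq> {..<card X + 2}" using c_less by (fastforce simp: XG_def)
    show "{..<card X + 2} \<subseteq> letter_code ` XG"
    proof
      fix i assume "i \<in> {..<card X + 2}"
      then consider "i < card X" | "i = card X" | "i = Suc (card X)" by fastforce
      then show "i \<in> letter_code ` XG"
      proof cases
        case 1
        then show ?thesis using \<iota>_XG[of "letter i"] by (intro image_eqI[of _ _ "\<iota> (letter i)"]) auto
      next
        case 2
        then show ?thesis by (intro image_eqI[of _ _ "\<sigma> True"]) auto
      next
        case 3
        then show ?thesis by (intro image_eqI[of _ _ "\<sigma> False"]) auto
      qed
    qed
  qed
  then show "card XG = card X + 2" "bij_betw letter_code XG {..<card XG}"
    using inj card_image[OF inj] by (auto simp: bij_betw_def)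
qed

lemma map_letter_code_inj: "u \<in> lists XG \<Longrightarrow> v \<in> lists XG \<Longrightarrow> map letter_code u = map letter_code v \<longleftrightarrow> u = v"
  by (rule inj_on_map_eq_map, rule inj_on_subset[OF bij_betw_imp_inj_on[OF bij_letter_code]])
    (auto simp: in_lists_conv_set)

lemma map_letter_code_\<iota>: "w \<in> lists X \<Longrightarrow> map letter_code (map \<iota> w) = map c w"
  by (induction w) auto

definition step_code :: "coded_state \<Rightarrow> nat \<Rightarrow> coded_state" where
  "step_code s i = (if i < card X then (fst s, nf_code (snd s @ [i]))
     else if i = card X then stable_code True s else stable_code False s)"

definition run_code :: "nat list \<Rightarrow> coded_state" where
  "run_code u = foldl step_code ([], []) u"

definition word_of_code :: "coded_state \<Rightarrow> nat list" where
  "word_of_code s = concat (map (\<lambda>p. fst p @ [if snd p = 0 then Suc (card X) else card X]) (rev (fst s))) @ snd s"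

lemma computable_run_code [computable_intros]: "computable u \<Longrightarrow> computable (\<lambda>x. run_code (u x))"
  unfolding run_code_def step_code_def by (intro computable_intros)

lemma computable_word_of_code [computable_intros]: "computable s \<Longrightarrow> computable (\<lambda>x. word_of_code (s x))"
  unfolding word_of_code_def by (intro computable_intros)

lemma step_code:
  assumes g: "g \<in> carrier G" and a: "a \<in> XG"
  shows "step_code (state_code (state g)) (letter_code a) = state_code (state (g \<cdot> a))"
proof -
  consider x where "x \<in> X" "a = \<iota> x" | e where "a = \<sigma> e" using a by (auto simp: XG_def)
  then show ?thesis
  proof cases
    case 1
    define h where "h = snd (state g)"
    have h: "h \<in> carrier H" using state_closed[OF g] by (simp add: h_def)
    have "nf_code (map c (nf h) @ [c x]) = map c (nf (h \<otimes> x))"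
      using nf_closed[OF h] 1 by (simp add: nf_code c_less del: valid_map_c cval_map_c)
    then show ?thesis using 1 c_less g by (simp add: step_code_def state_code_def state_\<iota>_eq h_def)
  next
    case 2
    then show ?thesis using stable_code[OF valid_state_state[OF g], of e] state_\<sigma>[OF g, of e]
      by (auto simp: step_code_def)
  qed
qed

lemma run_code:
  "w \<in> lists XG \<Longrightarrow> run_code (map letter_code w) = state_code (state (word_value G w))"
proof (induction w rule: rev_induct)
  case Nil
  then show ?case by (simp add: run_code_def state_code_def)
next
  case (snoc a w)
  then show ?case using step_code[of "word_value G w" a] XG_closed[of a] by (simp add: run_code_def)
qed

lemma word_of_code:
  "valid_state \<omega> \<Longrightarrow> word_of_code (state_code \<omega>) = map letter_code (state_word \<omega>)"
proof -
  assume v: "valid_state \<omega>"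
  have st: "valid_stack st \<Longrightarrow> concat (map (\<lambda>p. fst p @ [if snd p = 0 then Suc (card X) else card X])
      (rev (map (\<lambda>p. (map c (nf (fst p)), of_bool (snd p))) st))) = map letter_code (stack_word st)" for st
  proof (induction st)
    case (Cons p st)
    then have "fst p \<in> carrier H" "valid_stack st" by (cases p; simp)+
    then show ?case using Cons.IH map_letter_code_\<iota>[OF nf_in_X[of "fst p"]] by simp
  qed simp
  show ?thesis using v st[of "fst \<omega>"] map_letter_code_\<iota>[OF nf_in_X[of "snd \<omega>"]]
    by (simp add: word_of_code_def state_code_def state_word_def valid_state_def)
qed

section \<open>Deciding the graph of the stacking map\<close>

definition stable_flow_code :: "bool \<Rightarrow> nat \<Rightarrow> nat list \<Rightarrow> nat list" where
  "stable_flow_code e a u = (let b = rem_code e u; j = first (gen_list_code e b) in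
     if b = [] then [a] else (if j < m e then map c (wL e j) else []) @ [a] @ (if j < m e then map c (wR e j) else []))"

text \<open>A word is a normal form iff evaluating it and writing out the resulting state returns
  the word. For a letter of \<open>X\<close> the decision procedure of \<open>H\<close> is asked
  about the base component; for a stable letter the flow word is computed and compared.\<close>

definition graph_code :: "nat list \<Rightarrow> nat list \<Rightarrow> nat list \<Rightarrow> bool" where
  "graph_code u v w \<longleftrightarrow> (let s = run_code u; a = first v in
     word_of_code s = u \<and> v = [a] \<and>
     (if a < card X then in_graph (snd s) [a] w
      else if a = card X then w = stable_flow_code True a (snd s) else w = stable_flow_code False a (snd s)))"

lemma computable_first [computable_intros]: "computable L \<Longrightarrow> computable (\<lambda>x. first (L x))"
  unfolding first_def by (intro computable_intros)

lemma computable_stable_flow_code [computable_intros]: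
  "computable a \<Longrightarrow> computable u \<Longrightarrow> computable (\<lambda>x. stable_flow_code e (a x) (u x))"
  unfolding stable_flow_code_def Let_def
  by (intro computable_intros computable_finite_table[where f = "\<lambda>j. map c (wL e j)"]
      computable_finite_table[where f = "\<lambda>j. map c (wR e j)"])

lemma decidable_graph_code: "decidable (\<lambda>p. graph_code (fst p) (fst (snd p)) (snd (snd p)))"
  unfolding graph_code_def Let_def by (intro computable_intros)

lemma stable_flow_code:
  assumes g: "g \<in> carrier G"
  shows "stable_flow_code e (letter_code (\<sigma> e)) (map c (nf (snd (state g)))) = map letter_code (\<phi>G g (\<sigma> e))"
proof -
  define h where "h = snd (state g)"
  have h: "h \<in> carrier H" using state_closed[OF g] by (simp add: h_def)
  define b where "b = rem e h"
  have b: "b \<in> C e" "b \<in> carrier H" using rem_in[OF h] Ce_carrier by (auto simp: b_def)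
  have r: "rem_code e (map c (nf h)) = map c (nf b)" using rem_code nf_closed[OF h] unfolding b_def by metis
  have "first (gen_list_code e (map c (nf b))) = ch e b"
    using gen_list_code[of "map c (nf b)" e] nf_closed[OF b(2)] b(1) unfolding ch_def by metis
  then show ?thesis
    using r nf_Nil_iff[OF b(2)] ch_less[OF b(1)] wL_X[of "ch e b" e] wR_X[of "ch e b" e]
      map_letter_code_\<iota>[of "wL e (ch e b)"] map_letter_code_\<iota>[of "wR e (ch e b)"]
    by (simp add: stable_flow_code_def \<phi>G_\<sigma> h_def[symmetric] b_def[symmetric] Let_def)
qed

lemma graph_code_iff:
  assumes "u \<in> lists XG" "v \<in> lists XG" "w \<in> lists XG"
  shows "graph_code (map letter_code u) (map letter_code v) (map letter_code w) \<longleftrightarrow>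
    [u, v, w] \<in> {[nfG g, [a], \<phi>G g a] | g a. g \<in> carrier G \<and> a \<in> XG}"
proof -
  define g where "g = word_value G u"
  have g: "g \<in> carrier G" using assms(1) by (simp add: g_def)
  have run: "run_code (map letter_code u) = state_code (state g)" using run_code[OF assms(1)] by (simp add: g_def)
  have nfg: "nfG g \<in> lists XG" using nf_systemD(1)[OF nf_system_nfG g] .
  have word: "word_of_code (state_code (state g)) = map letter_code u \<longleftrightarrow> u = nfG g"
    using word_of_code[OF valid_state_state[OF g]] map_letter_code_inj[OF nfg assms(1)] by (auto simp: nfG_def)
  have flow: "(if letter_code a < card X then in_graph (snd (state_code (state g))) [letter_code a] (map letter_code w)
      else if letter_code a = card X then map letter_code w = stable_flow_code True (letter_code a) (snd (state_code (state g)))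
      else map letter_code w = stable_flow_code False (letter_code a) (snd (state_code (state g)))) \<longleftrightarrow> w = \<phi>G g a"
    if a: "a \<in> XG" for a
  proof -
    have inj: "map letter_code w = map letter_code (\<phi>G g a) \<longleftrightarrow> w = \<phi>G g a"
      using map_letter_code_inj[OF assms(3) \<phi>G_value(1)[OF g a]] .
    consider x where "x \<in> X" "a = \<iota> x" | e where "a = \<sigma> e" using a by (auto simp: XG_def)
    then show ?thesis
    proof cases
      case 1
      define h where "h = snd (state g)"
      have h: "h \<in> carrier H" using state_closed[OF g] by (simp add: h_def)
      \<comment> \<open>Normal forms and letter numbers are injective, so this pair has exactly one
        third component in the graph of \<open>H\<close>.\<close>
      have "in_graph (map c (nf h)) [c x] z \<longleftrightarrow> z = map c (\<phi> h x)" for z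
        unfolding in_graph_iff using nf_inj[OF h] h 1(1) letter_c by (metis list.inject)
      moreover have "map letter_code (\<phi>G g a) = map c (\<phi> h x)"
        using 1 map_letter_code_\<iota>[OF \<phi>_X[OF h 1(1)]] by (simp add: \<phi>G_\<iota> h_def)
      ultimately show ?thesis using inj 1 c_less[OF 1(1)] by (simp add: state_code_def h_def)
    next
      case 2
      then show ?thesis using inj stable_flow_code[OF g, of e] by (cases e) (simp_all add: state_code_def)
    qed
  qed
  show ?thesis
  proof
    assume gc: "graph_code (map letter_code u) (map letter_code v) (map letter_code w)"
    then have u: "u = nfG g" and "map letter_code v = [first (map letter_code v)]"
      using word by (simp_all add: graph_code_def run Let_def)
    then obtain a where v: "v = [a]" by (auto simp: map_eq_Cons_conv)
    then have a: "a \<in> XG" using assms(2) by simp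
    have "w = \<phi>G g a" using gc flow[OF a] by (simp add: graph_code_def run Let_def v first_def)
    then show "[u, v, w] \<in> {[nfG g, [a], \<phi>G g a] | g a. g \<in> carrier G \<and> a \<in> XG}" using u v g a by blast
  next
    assume "[u, v, w] \<in> {[nfG g, [a], \<phi>G g a] | g a. g \<in> carrier G \<and> a \<in> XG}"
    then obtain g' a where ga: "u = nfG g'" "v = [a]" "w = \<phi>G g' a" "g' \<in> carrier G" "a \<in> XG" by auto
    then have "g = g'" using nf_systemD(2)[OF nf_system_nfG] by (simp add: g_def)
    then have v: "first (map letter_code v) = letter_code a" "map letter_code v = [letter_code a]"
      and u: "u = nfG g" and w: "w = \<phi>G g a"
      using ga by (simp_all add: first_def)
    show "graph_code (map letter_code u) (map letter_code v) (map letter_code w)"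
      unfolding graph_code_def run Let_def v(1)
      by (intro conjI v(2) iffD2[OF word u] iffD2[OF flow[OF ga(5)] w])
  qed
qed

lemma algorithmically_stackable_G: "algorithmically_stackable G"
proof (rule algorithmically_stackable_GI)
  have "computable (\<lambda>p. of_bool (graph_code (fst p) (fst (snd p)) (snd (snd p))) :: nat)"
    using decidable_graph_code unfolding decidable_def .
  then obtain F where F: "recursive_fn 3 F" "\<And>x y z. F [enc x, enc y, enc z] = of_bool (graph_code x y z)"
    by (rule recursive_fn3_computable) auto
  have "F (map (word_code letter_code) ws) =
      (if ws \<in> {[nfG g, [a], \<phi>G g a] | g a. g \<in> carrier G \<and> a \<in> XG} then 1 else 0)"
    if ws: "length ws = 3" "set ws \<subseteq> lists XG" for ws
  proof -
    obtain u v w where uvw: "ws = [u, v, w]" using ws(1) by (auto simp: numeral_3_eq_3 length_Suc_conv)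
    then show ?thesis using ws(2) F(2) graph_code_iff[of u v w]
      by (simp add: word_code_def enc_list_def[symmetric] enc_nat_def) (simp add: enc_list_def enc_nat_def)
  qed
  then show "decidable_rel 3 XG {[nfG g, [a], \<phi>G g a] | g a. g \<in> carrier G \<and> a \<in> XG}"
    unfolding decidable_rel_def using F(1) bij_letter_code by blast
qed

end

section \<open>From the hypotheses to coded data\<close>

lemma (in coded_gen_group) membership_decidable_codes:
  assumes Y: "fin_inv_closed_gen_set H Y" and K: "membership_decidable H Y K"
  shows "\<exists>M. decidable M \<and> (\<forall>u. valid u \<longrightarrow> (M u \<longleftrightarrow> cval u \<in> K))"
proof -
  interpret Y: gen_group H Y by unfold_locales (rule Y)
  obtain d F where F: "recursive_fn 1 F" and dec: "\<And>ws. length ws = 1 \<Longrightarrow> set ws \<subseteq> lists Y \<Longrightarrow>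
      F (map (word_code d) ws) = (if ws \<in> {[w] | w. w \<in> lists Y \<and> word_value H w \<in> K} then 1 else 0)"
    using K unfolding membership_decidable_def decidable_rel_def by blast
  \<comment> \<open>Membership is decided over \<open>Y\<close> while the flow lives over
    \<open>X\<close>. Each letter of \<open>X\<close> is replaced by a fixed word over
    \<open>Y\<close>, whose letters are numbered by \<open>d\<close>.\<close>
  have "\<forall>i. \<exists>w. i < card X \<longrightarrow> w \<in> lists Y \<and> word_value H w = letter i"
    using Y.ex_word letter_X X_closed by metis
  then obtain t where t: "\<And>i. i < card X \<Longrightarrow> t i \<in> lists Y \<and> word_value H (t i) = letter i" by metis
  define M where "M u \<longleftrightarrow> F [enc (concat (map (\<lambda>i. if i < card X then map d (t i) else []) u))] = 1" for u
  have "decidable M"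
    unfolding M_def
    by (intro computable_intros computable_recursive_fn1[OF F] computable_finite_table[where f = "\<lambda>i. map d (t i)"])
  moreover have "M u \<longleftrightarrow> cval u \<in> K" if "valid u" for u
  proof -
    have "concat (map t u) \<in> lists Y \<and> word_value H (concat (map t u)) = cval u \<and>
        concat (map (\<lambda>i. if i < card X then map d (t i) else []) u) = map d (concat (map t u))"
      using that by (induction u) (use t in \<open>auto simp: cval_def\<close>)
    then show ?thesis
      using dec[of "[concat (map t u)]"] by (simp add: M_def word_code_def enc_list_def enc_nat_def)
  qed
  ultimately show ?thesis by blast
qed

text \<open>\<open>generate\<close> allows inverses of elements of \<open>S\<close>, whereas
  products over \<open>gen\<close> have none; so the generators listed are the elements of
  \<open>S\<close> and their inverses.\<close>

lemma (in gen_group) fin_gen_subgroup_words: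
  assumes "fin_gen_subgroup K G"
  shows "\<exists>(n :: nat) gen. (\<forall>j<n. gen j \<in> lists X \<and> word_value G (gen j) \<in> K) \<and>
    (\<forall>b\<in>K. \<exists>L. (\<forall>j\<in>set L. j < n) \<and> foldr (\<lambda>j h. h \<otimes> word_value G (gen j)) L \<one> = b)"
proof -
  obtain S where K: "subgroup K G" and S: "finite S" "S \<subseteq> carrier G" "generate G S = K"
    using assms unfolding fin_gen_subgroup_def by blast
  obtain zs where zs: "set zs = S \<union> m_inv G ` S" using S(1) finite_list by (metis finite_UnI finite_imageI)
  have zsK: "z \<in> K" if "z \<in> set zs" for z
    using that zs S(3) generate.incl[of _ S G] generate.inv[of _ S G] by auto
  have "\<forall>j. \<exists>w. j < length zs \<longrightarrow> w \<in> lists X \<and> word_value G w = zs ! j"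
    using ex_word zsK subgroup.mem_carrier[OF K] nth_mem by metis
  then obtain gen where gen: "\<And>j. j < length zs \<Longrightarrow> gen j \<in> lists X \<and> word_value G (gen j) = zs ! j" by metis
  \<comment> \<open>The starting value is kept variable so that lists can be concatenated.
    \<open>foldr\<close> consumes the right end first, hence a product of \<open>g\<close> and
    \<open>h\<close> belongs to \<open>L2 @ L1\<close>.\<close>
  define prd where "prd L h = foldr (\<lambda>j h. h \<otimes> word_value G (gen j)) L h" for L h
  have prd_simps: "prd [] h = h" "prd (j # L) h = prd L h \<otimes> word_value G (gen j)" for j L h
    by (simp_all add: prd_def)
  have prd_closed: "prd L h \<in> carrier G" if "\<forall>j\<in>set L. j < length zs" "h \<in> carrier G" for L h
    using that
  proof (induction L)
    case (Cons j L)
    have "word_value G (gen j) \<in> carrier G" using gen[of j] Cons.prems by (intro word_value_closed) simp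
    then show ?case using Cons by (simp add: prd_simps)
  qed (simp add: prd_simps)
  have prd: "prd L h = h \<otimes> prd L \<one>" if "\<forall>j\<in>set L. j < length zs" "h \<in> carrier G" for L h
    using that
  proof (induction L)
    case (Cons j L)
    have "word_value G (gen j) \<in> carrier G" using gen[of j] Cons.prems by (intro word_value_closed) simp
    then show ?case using Cons prd_closed[of L \<one>] by (simp add: prd_simps m_assoc)
  qed (simp add: prd_simps)
  have single: "\<exists>L. (\<forall>j\<in>set L. j < length zs) \<and> prd L \<one> = z" if z: "z \<in> set zs" for z
  proof -
    obtain j where "j < length zs" "zs ! j = z" using z by (auto simp: in_set_conv_nth)
    then show ?thesis using gen[of j] zsK[OF z] subgroup.mem_carrier[OF K]
      by (intro exI[of _ "[j]"]) (simp add: prd_simps)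
  qed
  have "\<exists>L. (\<forall>j\<in>set L. j < length zs) \<and> prd L \<one> = b" if "b \<in> generate G S" for b
    using that
  proof induction
    case one
    then show ?case by (intro exI[of _ "[]"]) (simp add: prd_simps)
  next
    case (incl h)
    then show ?case using single zs by auto
  next
    case (inv h)
    then show ?case using single zs by auto
  next
    case (eng g h)
    then obtain L1 L2 where L: "\<forall>j\<in>set L1. j < length zs" "prd L1 \<one> = g" "\<forall>j\<in>set L2. j < length zs" "prd L2 \<one> = h"
      by blast
    have "prd (L2 @ L1) \<one> = prd L2 (prd L1 \<one>)" by (simp add: prd_def)
    also have "\<dots> = g \<otimes> h" using prd[OF L(3), of g] prd_closed[OF L(1) one_closed] L by simp
    finally show ?case using L by (intro exI[of _ "L2 @ L1"]) auto
  qed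
  then show ?thesis
    using gen zsK nth_mem S(3) unfolding prd_def by (intro exI[of _ "length zs"] exI[of _ gen]) auto
qed

theorem corollary4p7:
  fixes H :: "('h, 'm) monoid_scheme" and A B Y :: "'h set" and \<psi> :: "'h \<Rightarrow> 'h"
  assumes "algorithmically_stackable H"
    and "fin_gen_subgroup A H" and "fin_gen_subgroup B H"
    and "\<psi> \<in> iso (H\<lparr>carrier := A\<rparr>) (H\<lparr>carrier := B\<rparr>)"
    and "fin_inv_closed_gen_set H Y"
    and "membership_decidable H Y A" and "membership_decidable H Y B"
  shows "algorithmically_stackable (hnn_extension H A \<psi>)"
proof -
  obtain X where "group H" and X: "fin_inv_closed_gen_set H X" "\<one>\<^bsub>H\<^esub> \<notin> X" "algorithmically_stackable_over H X"
    using assms(1) unfolding algorithmically_stackable_def by blast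
  interpret H: group H by fact
  interpret H: gen_group H X by unfold_locales (rule X)
  obtain nf \<phi> where flow: "word_flow H X nf \<phi>"
    and dec: "decidable_rel 3 X {[nf g, [a], \<phi> g a] | g a. g \<in> carrier H \<and> a \<in> X}"
    using X(3) H.algorithmically_stackable_over_iff by blast
  obtain c f where c: "bij_betw c X {..<card X}" and f: "recursive_fn 3 f"
    "\<forall>ws. length ws = 3 \<and> set ws \<subseteq> lists X \<longrightarrow> f (map (word_code c) ws) =
      (if ws \<in> {[nf g, [a], \<phi> g a] | g a. g \<in> carrier H \<and> a \<in> X} then 1 else 0)"
    using dec unfolding decidable_rel_def by blast
  interpret H: coded_flow H X c nf \<phi> f
    using c flow f by unfold_locales auto
  define C where "C e = (if e then B else A)" for e
  define \<theta> where "\<theta> e = (if e then inv_into A \<psi> else \<psi>)" for e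
  have sub: "subgroup (C e) H" and fg: "fin_gen_subgroup (C e) H" and md: "membership_decidable H Y (C e)" for e
    using assms(2,3,6,7) by (auto simp: C_def fin_gen_subgroup_def)
  have bij: "bij_betw \<psi> A B" and hom: "\<And>x y. x \<in> A \<Longrightarrow> y \<in> A \<Longrightarrow> \<psi> (x \<otimes>\<^bsub>H\<^esub> y) = \<psi> x \<otimes>\<^bsub>H\<^esub> \<psi> y"
    using assms(4) by (auto simp: iso_def hom_def)
  note \<psi> = bij_betw_inv_into_left[OF bij] bij_betw_inv_into_right[OF bij]
    bij_betw_apply[OF bij] bij_betw_apply[OF bij_betw_inv_into[OF bij]]
  have \<theta>_in: "\<theta> e x \<in> C (\<not> e)" and \<theta>_inv: "\<theta> (\<not> e) (\<theta> e x) = x" if "x \<in> C e" for x e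
    using that \<psi> by (auto simp: C_def \<theta>_def)
  have \<theta>_mult: "\<theta> e (x \<otimes>\<^bsub>H\<^esub> y) = \<theta> e x \<otimes>\<^bsub>H\<^esub> \<theta> e y" if xy: "x \<in> C e" "y \<in> C e" for x y e
  proof (cases e)
    case True
    have *: "inv_into A \<psi> x \<in> A" "inv_into A \<psi> y \<in> A" "x = \<psi> (inv_into A \<psi> x)" "y = \<psi> (inv_into A \<psi> y)"
      using xy True \<psi> by (auto simp: C_def)
    have "inv_into A \<psi> x \<otimes>\<^bsub>H\<^esub> inv_into A \<psi> y \<in> A"
      using *(1,2) subgroup.m_closed[OF sub[of False]] by (simp add: C_def)
    then have "inv_into A \<psi> (\<psi> (inv_into A \<psi> x \<otimes>\<^bsub>H\<^esub> inv_into A \<psi> y)) = inv_into A \<psi> x \<otimes>\<^bsub>H\<^esub> inv_into A \<psi> y"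
      by (rule \<psi>(1))
    then show ?thesis using hom[OF *(1,2)] *(3,4) True by (simp add: \<theta>_def)
  qed (use hom xy in \<open>simp add: C_def \<theta>_def\<close>)
  have "\<forall>e. \<exists>M. decidable M \<and> (\<forall>u. H.valid u \<longrightarrow> (M u \<longleftrightarrow> H.cval u \<in> C e))"
    using H.membership_decidable_codes[OF assms(5) md] by blast
  then obtain M where M: "\<And>e. decidable (M e)" "\<And>e u. H.valid u \<Longrightarrow> M e u \<longleftrightarrow> H.cval u \<in> C e"
    by metis
  define P where "P e n gen \<longleftrightarrow> (\<forall>j<n. gen j \<in> lists X \<and> word_value H (gen j) \<in> C e) \<and>
      (\<forall>b\<in>C e. \<exists>L. (\<forall>j\<in>set L. j < n) \<and> foldr (\<lambda>j h. h \<otimes>\<^bsub>H\<^esub> word_value H (gen j)) L \<one>\<^bsub>H\<^esub> = b)"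
    for e and n :: nat and gen
  have "\<forall>e. \<exists>n gen. P e n gen"
    using H.fin_gen_subgroup_words[OF fg] unfolding P_def by blast
  then obtain m gen where P: "\<And>e. P e (m e) (gen e)"
    by metis
  have gen: "j < m e \<Longrightarrow> gen e j \<in> lists X \<and> word_value H (gen e j) \<in> C e"
    "b \<in> C e \<Longrightarrow> \<exists>L. (\<forall>j\<in>set L. j < m e) \<and>
      foldr (\<lambda>j h. h \<otimes>\<^bsub>H\<^esub> word_value H (gen e j)) L \<one>\<^bsub>H\<^esub> = b" for e j b
    using P[of e] unfolding P_def by blast+
  \<comment> \<open>Any word for the image of a generator will do: finitely many are used, and they
    become table entries.\<close>
  define wR where "wR e j = (SOME w. w \<in> lists X \<and> word_value H w = \<theta> e (word_value H (gen e j)))" for e j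
  have wR: "wR e j \<in> lists X \<and> word_value H (wR e j) = \<theta> e (word_value H (gen e j))" if j: "j < m e" for e j
  proof -
    have "\<theta> e (word_value H (gen e j)) \<in> carrier H"
      using subgroup.mem_carrier[OF sub \<theta>_in] gen(1)[OF j] by blast
    then obtain w where "w \<in> lists X \<and> word_value H w = \<theta> e (word_value H (gen e j))"
      using H.ex_word by blast
    then show ?thesis unfolding wR_def by (rule someI)
  qed
  interpret hnn: coded_hnn H X c nf \<phi> f C \<theta> M gen wR m
  proof (intro coded_hnn.intro coded_hnn_axioms.intro)
    show "coded_flow H X c nf \<phi> f" by (rule H.coded_flow_axioms)
  qed (fact X(2) sub \<theta>_mult \<theta>_in \<theta>_inv M gen conjunct1[OF gen(1)] conjunct2[OF gen(1)] conjunct1[OF wR] conjunct2[OF wR])+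
  \<comment> \<open>\<open>C False\<close> is \<open>A\<close> and \<open>\<theta> False\<close> is
    \<open>\<psi>\<close>, so the extension built in the locale is the given one.\<close>
  show ?thesis
    using hnn.algorithmically_stackable_G by (simp add: C_def \<theta>_def)
qed

end
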